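(* Let $(F,H,s)$ be a normal lax (or normal oplax) shadow functor between bicategories with shadow. Any two parallel formal morphisms for $(F,H,s)$ whose lifts to the free normal lax shadow functor induce the same underlying cyclic permutation of letters are equal. In particular, if the letters involved form an aperiodic list, all formal diagrams for $(F,H,s)$ commute.
   Context: A bicategory with shadow has functors $\langle\!\langle-\rangle\!\rangle:\mathcal B(A,A)\to\mathcal B_{Sh}$ and natural isomorphisms $\theta:\langle\!\langle M\odot N\rangle\!\rangle\cong\langle\!\langle N\odot M\rangle\!\rangle$ with $\theta\theta=1$, $\ell\theta=r$ on $\langle\!\langle X\odot I\rangle\!\rangle$, and the associativity hexagon $\theta\alpha\theta=\alpha\theta\alpha$. A lax shadow functor $(F,H,s)$ consists of a lax functor $F:\mathcal C\to\mathcal D$, a functor $H:\mathcal C_{Sh}\to\mathcal D_{Sh}$ and natural maps $s:\langle\!\langle F(M)\rangle\!\rangle\to H\langle\!\langle M\rangle\!\rangle$ with $H(\theta)\circ s\circ\langle\!\langle m\rangle\!\rangle=s\circ\langle\!\langle m\rangle\!\rangle\circ\theta$; it is normal if the unit comparisons $i:I\to F(I)$ are isomorphisms. The free normal lax shadow functor on a directed graph $G$ is $(\Phi_G,\Psi_G):(\mathcal F(G),\mathrm{Sh}(G))\to(\mathcal N(G),\mathrm{Sh}_N(G))$, left adjoint to the functor from normal lax shadow functors (and commuting squares of strict shadow functors) to graphs taking the underlying graph of the source bicategory; explicitly $\mathrm{Sh}_N(G)$ has objects $\Psi\langle\!\langle w\rangle\!\rangle$ ($w$ an endomorphism 1-cell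 of the free bicategory $\mathcal F(G)$) and $\langle\!\langle W\rangle\!\rangle$ ($W$ a parenthesized word in formal units and terms $\Phi(w)$), with morphisms generated by associators, unitors, outermost rotators, invertible $i:I\to\Phi(I)$, $m:\Phi(w)\odot\Phi(w')\to\Phi(w\odot w')$ and $s:\langle\!\langle\Phi(w)\rangle\!\rangle\to\Psi\langle\!\langle w\rangle\!\rangle$, modulo the relations making it a normal lax shadow functor. Formal morphisms for $(F,H,s)$ are images of morphisms of $\mathrm{Sh}_N(U\mathcal C)$ under the induced strict functor to $\mathcal D_{Sh}$. The underlying cyclic permutation is the induced bijection of edge occurrences; a list is aperiodic if no nontrivial rotation fixes it. *)

theory Defs
  imports Main
begin

text \<open>A bicategory is given by objects of type 'o, 1-cells of type 'c and 2-cells of type 'm,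
  with total operations whose axioms are imposed only where the operands are composable.
  Horizontal composition is written in diagrammatic order: bhc M N = M \<odot> N is defined
  when btgt M = bsrc N.  Vertical composition bvc g f = g \<circ> f is defined when bcod f = bdom g.
  bassoc M N P : (M \<odot> N) \<odot> P \<Rightarrow> M \<odot> (N \<odot> P),
  blu M : I \<odot> M \<Rightarrow> M, bru M : M \<odot> I \<Rightarrow> M.\<close>

record ('o,'c,'m) bicat =
  bsrc :: "'c \<Rightarrow> 'o"
  btgt :: "'c \<Rightarrow> 'o"
  bhc :: "'c \<Rightarrow> 'c \<Rightarrow> 'c"
  bunit :: "'o \<Rightarrow> 'c"
  bdom :: "'m \<Rightarrow> 'c"
  bcod :: "'m \<Rightarrow> 'c"
  bvc :: "'m \<Rightarrow> 'm \<Rightarrow> 'm"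
  bid :: "'c \<Rightarrow> 'm"
  bhm :: "'m \<Rightarrow> 'm \<Rightarrow> 'm"
  bassoc :: "'c \<Rightarrow> 'c \<Rightarrow> 'c \<Rightarrow> 'm"
  blu :: "'c \<Rightarrow> 'm"
  bru :: "'c \<Rightarrow> 'm"

definition is_iso2 :: "('o,'c,'m) bicat \<Rightarrow> 'm \<Rightarrow> bool" where
  "is_iso2 B f \<longleftrightarrow> (\<exists>g. bdom B g = bcod B f \<and> bcod B g = bdom B f \<and>
      bvc B g f = bid B (bdom B f) \<and> bvc B f g = bid B (bcod B f))"

definition inv2 :: "('o,'c,'m) bicat \<Rightarrow> 'm \<Rightarrow> 'm" where
  "inv2 B f = (THE g. bdom B g = bcod B f \<and> bcod B g = bdom B f \<and>
      bvc B g f = bid B (bdom B f) \<and> bvc B f g = bid B (bcod B f))"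

definition bicat :: "('o,'c,'m) bicat \<Rightarrow> bool" where
  "bicat B \<longleftrightarrow>
    \<comment> \<open>hom-categories\<close>
    (\<forall>f. bsrc B (bdom B f) = bsrc B (bcod B f) \<and> btgt B (bdom B f) = btgt B (bcod B f)) \<and>
    (\<forall>M. bdom B (bid B M) = M \<and> bcod B (bid B M) = M) \<and>
    (\<forall>f g. bcod B f = bdom B g \<longrightarrow>
        bdom B (bvc B g f) = bdom B f \<and> bcod B (bvc B g f) = bcod B g) \<and>
    (\<forall>f. bvc B f (bid B (bdom B f)) = f \<and> bvc B (bid B (bcod B f)) f = f) \<and>
    (\<forall>f g h. bcod B f = bdom B g \<and> bcod B g = bdom B h \<longrightarrow>
        bvc B h (bvc B g f) = bvc B (bvc B h g) f) \<and>
    \<comment> \<open>horizontal composition and units\<close>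
    (\<forall>M N. btgt B M = bsrc B N \<longrightarrow>
        bsrc B (bhc B M N) = bsrc B M \<and> btgt B (bhc B M N) = btgt B N) \<and>
    (\<forall>A. bsrc B (bunit B A) = A \<and> btgt B (bunit B A) = A) \<and>
    (\<forall>f g. btgt B (bdom B f) = bsrc B (bdom B g) \<longrightarrow>
        bdom B (bhm B f g) = bhc B (bdom B f) (bdom B g) \<and>
        bcod B (bhm B f g) = bhc B (bcod B f) (bcod B g)) \<and>
    (\<forall>M N. btgt B M = bsrc B N \<longrightarrow> bhm B (bid B M) (bid B N) = bid B (bhc B M N)) \<and>
    (\<forall>f f' g g'. bcod B f = bdom B f' \<and> bcod B g = bdom B g' \<and>
        btgt B (bdom B f) = bsrc B (bdom B g) \<longrightarrow>
        bhm B (bvc B f' f) (bvc B g' g) = bvc B (bhm B f' g') (bhm B f g)) \<and>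
    \<comment> \<open>associator and unitors: typing and invertibility\<close>
    (\<forall>M N P. btgt B M = bsrc B N \<and> btgt B N = bsrc B P \<longrightarrow>
        bdom B (bassoc B M N P) = bhc B (bhc B M N) P \<and>
        bcod B (bassoc B M N P) = bhc B M (bhc B N P) \<and> is_iso2 B (bassoc B M N P)) \<and>
    (\<forall>M. bdom B (blu B M) = bhc B (bunit B (bsrc B M)) M \<and> bcod B (blu B M) = M \<and>
        is_iso2 B (blu B M)) \<and>
    (\<forall>M. bdom B (bru B M) = bhc B M (bunit B (btgt B M)) \<and> bcod B (bru B M) = M \<and>
        is_iso2 B (bru B M)) \<and>
    \<comment> \<open>naturality\<close>
    (\<forall>f g h. btgt B (bdom B f) = bsrc B (bdom B g) \<and> btgt B (bdom B g) = bsrc B (bdom B h) \<longrightarrow>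
        bvc B (bassoc B (bcod B f) (bcod B g) (bcod B h)) (bhm B (bhm B f g) h) =
        bvc B (bhm B f (bhm B g h)) (bassoc B (bdom B f) (bdom B g) (bdom B h))) \<and>
    (\<forall>f. bvc B (blu B (bcod B f)) (bhm B (bid B (bunit B (bsrc B (bdom B f)))) f) =
         bvc B f (blu B (bdom B f))) \<and>
    (\<forall>f. bvc B (bru B (bcod B f)) (bhm B f (bid B (bunit B (btgt B (bdom B f))))) =
         bvc B f (bru B (bdom B f))) \<and>
    \<comment> \<open>pentagon and triangle\<close>
    (\<forall>M N P Q. btgt B M = bsrc B N \<and> btgt B N = bsrc B P \<and> btgt B P = bsrc B Q \<longrightarrow>
        bvc B (bassoc B M N (bhc B P Q)) (bassoc B (bhc B M N) P Q) =
        bvc B (bhm B (bid B M) (bassoc B N P Q))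
              (bvc B (bassoc B M (bhc B N P) Q) (bhm B (bassoc B M N P) (bid B Q)))) \<and>
    (\<forall>M N. btgt B M = bsrc B N \<longrightarrow>
        bvc B (bhm B (bid B M) (blu B N)) (bassoc B M (bunit B (btgt B M)) N) =
        bhm B (bru B M) (bid B N))"

text \<open>The shadow category B_Sh has objects of type 's and morphisms of type 'n
  (scomp g f = g \<circ> f).  sh0/sh1 is the shadow functor on endomorphism 1-cells / 2-cells between
  them, and srot M N : \<langle>\<langle>M \<odot> N\<rangle>\<rangle> \<rightarrow> \<langle>\<langle>N \<odot> M\<rangle>\<rangle> is the rotator \<theta>.\<close>

record ('s,'n,'c,'m) shadow =
  sdom :: "'n \<Rightarrow> 's"
  scod :: "'n \<Rightarrow> 's"
  scomp :: "'n \<Rightarrow> 'n \<Rightarrow> 'n"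
  sid :: "'s \<Rightarrow> 'n"
  sh0 :: "'c \<Rightarrow> 's"
  sh1 :: "'m \<Rightarrow> 'n"
  srot :: "'c \<Rightarrow> 'c \<Rightarrow> 'n"

definition category_part :: "('s,'n,'c,'m) shadow \<Rightarrow> bool" where
  "category_part S \<longleftrightarrow>
    (\<forall>f g. scod S f = sdom S g \<longrightarrow> sdom S (scomp S g f) = sdom S f \<and> scod S (scomp S g f) = scod S g) \<and>
    (\<forall>x. sdom S (sid S x) = x \<and> scod S (sid S x) = x) \<and>
    (\<forall>f. scomp S f (sid S (sdom S f)) = f \<and> scomp S (sid S (scod S f)) f = f) \<and>
    (\<forall>f g h. scod S f = sdom S g \<and> scod S g = sdom S h \<longrightarrow>
        scomp S h (scomp S g f) = scomp S (scomp S h g) f)"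

definition bicat_with_shadow :: "('o,'c,'m) bicat \<Rightarrow> ('s,'n,'c,'m) shadow \<Rightarrow> bool" where
  "bicat_with_shadow B S \<longleftrightarrow> bicat B \<and> category_part S \<and>
    \<comment> \<open>shadow functor on each B(A,A)\<close>
    (\<forall>f. bsrc B (bdom B f) = btgt B (bdom B f) \<longrightarrow>
        sdom S (sh1 S f) = sh0 S (bdom B f) \<and> scod S (sh1 S f) = sh0 S (bcod B f)) \<and>
    (\<forall>M. bsrc B M = btgt B M \<longrightarrow> sh1 S (bid B M) = sid S (sh0 S M)) \<and>
    (\<forall>f g. bsrc B (bdom B f) = btgt B (bdom B f) \<and> bcod B f = bdom B g \<longrightarrow>
        sh1 S (bvc B g f) = scomp S (sh1 S g) (sh1 S f)) \<and>
    \<comment> \<open>rotators: typing and naturality\<close>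
    (\<forall>M N. btgt B M = bsrc B N \<and> btgt B N = bsrc B M \<longrightarrow>
        sdom S (srot S M N) = sh0 S (bhc B M N) \<and> scod S (srot S M N) = sh0 S (bhc B N M)) \<and>
    (\<forall>f g. btgt B (bdom B f) = bsrc B (bdom B g) \<and> btgt B (bdom B g) = bsrc B (bdom B f) \<longrightarrow>
        scomp S (srot S (bcod B f) (bcod B g)) (sh1 S (bhm B f g)) =
        scomp S (sh1 S (bhm B g f)) (srot S (bdom B f) (bdom B g))) \<and>
    \<comment> \<open>\<theta>\<theta> = 1\<close>
    (\<forall>M N. btgt B M = bsrc B N \<and> btgt B N = bsrc B M \<longrightarrow>
        scomp S (srot S N M) (srot S M N) = sid S (sh0 S (bhc B M N))) \<and>
    \<comment> \<open>\<ell>\<theta> = r on \<langle>\<langle>X \<odot> I\<rangle>\<rangle>\<close>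
    (\<forall>X. bsrc B X = btgt B X \<longrightarrow>
        scomp S (sh1 S (blu B X)) (srot S X (bunit B (bsrc B X))) = sh1 S (bru B X)) \<and>
    \<comment> \<open>hexagon \<theta> a\<inverse> \<theta> = a \<theta> a on \<langle>\<langle>(M \<odot> N) \<odot> P\<rangle>\<rangle>\<close>
    (\<forall>M N P. btgt B M = bsrc B N \<and> btgt B N = bsrc B P \<and> btgt B P = bsrc B M \<longrightarrow>
        scomp S (srot S (bhc B P M) N)
          (scomp S (sh1 S (inv2 B (bassoc B P M N))) (srot S (bhc B M N) P)) =
        scomp S (sh1 S (bassoc B N P M))
          (scomp S (srot S M (bhc B N P)) (sh1 S (bassoc B M N P))))"

record ('a,'b,'c,'f,'g,'h) laxf =
  lf0 :: "'a \<Rightarrow> 'f"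
  lf1 :: "'b \<Rightarrow> 'g"
  lf2 :: "'c \<Rightarrow> 'h"
  lfm :: "'b \<Rightarrow> 'b \<Rightarrow> 'h"   \<comment> \<open>lax: F M \<odot> F N \<Rightarrow> F(M \<odot> N); oplax: the reverse\<close>
  lfi :: "'a \<Rightarrow> 'h"          \<comment> \<open>lax: I \<Rightarrow> F I; oplax: the reverse\<close>

record ('d,'e,'i,'j) shfun =
  hf0 :: "'d \<Rightarrow> 'i"
  hf1 :: "'e \<Rightarrow> 'j"

definition local_functor_part ::
  "('a,'b,'c) bicat \<Rightarrow> ('f,'g,'h) bicat \<Rightarrow> ('a,'b,'c,'f,'g,'h) laxf \<Rightarrow> bool" where
  "local_functor_part C D F \<longleftrightarrow>
    (\<forall>M. bsrc D (lf1 F M) = lf0 F (bsrc C M) \<and> btgt D (lf1 F M) = lf0 F (btgt C M)) \<and>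
    (\<forall>f. bdom D (lf2 F f) = lf1 F (bdom C f) \<and> bcod D (lf2 F f) = lf1 F (bcod C f)) \<and>
    (\<forall>M. lf2 F (bid C M) = bid D (lf1 F M)) \<and>
    (\<forall>f g. bcod C f = bdom C g \<longrightarrow> lf2 F (bvc C g f) = bvc D (lf2 F g) (lf2 F f))"

definition lax_functor ::
  "('a,'b,'c) bicat \<Rightarrow> ('f,'g,'h) bicat \<Rightarrow> ('a,'b,'c,'f,'g,'h) laxf \<Rightarrow> bool" where
  "lax_functor C D F \<longleftrightarrow> local_functor_part C D F \<and>
    (\<forall>M N. btgt C M = bsrc C N \<longrightarrow>
        bdom D (lfm F M N) = bhc D (lf1 F M) (lf1 F N) \<and> bcod D (lfm F M N) = lf1 F (bhc C M N)) \<and>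
    (\<forall>A. bdom D (lfi F A) = bunit D (lf0 F A) \<and> bcod D (lfi F A) = lf1 F (bunit C A)) \<and>
    (\<forall>f g. btgt C (bdom C f) = bsrc C (bdom C g) \<longrightarrow>
        bvc D (lf2 F (bhm C f g)) (lfm F (bdom C f) (bdom C g)) =
        bvc D (lfm F (bcod C f) (bcod C g)) (bhm D (lf2 F f) (lf2 F g))) \<and>
    (\<forall>M N P. btgt C M = bsrc C N \<and> btgt C N = bsrc C P \<longrightarrow>
        bvc D (lf2 F (bassoc C M N P))
          (bvc D (lfm F (bhc C M N) P) (bhm D (lfm F M N) (bid D (lf1 F P)))) =
        bvc D (lfm F M (bhc C N P))
          (bvc D (bhm D (bid D (lf1 F M)) (lfm F N P)) (bassoc D (lf1 F M) (lf1 F N) (lf1 F P)))) \<and>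
    (\<forall>M. bvc D (lf2 F (blu C M))
          (bvc D (lfm F (bunit C (bsrc C M)) M) (bhm D (lfi F (bsrc C M)) (bid D (lf1 F M)))) =
        blu D (lf1 F M)) \<and>
    (\<forall>M. bvc D (lf2 F (bru C M))
          (bvc D (lfm F M (bunit C (btgt C M))) (bhm D (bid D (lf1 F M)) (lfi F (btgt C M)))) =
        bru D (lf1 F M))"

definition oplax_functor ::
  "('a,'b,'c) bicat \<Rightarrow> ('f,'g,'h) bicat \<Rightarrow> ('a,'b,'c,'f,'g,'h) laxf \<Rightarrow> bool" where
  "oplax_functor C D F \<longleftrightarrow> local_functor_part C D F \<and>
    (\<forall>M N. btgt C M = bsrc C N \<longrightarrow>
        bdom D (lfm F M N) = lf1 F (bhc C M N) \<and> bcod D (lfm F M N) = bhc D (lf1 F M) (lf1 F N)) \<and>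
    (\<forall>A. bdom D (lfi F A) = lf1 F (bunit C A) \<and> bcod D (lfi F A) = bunit D (lf0 F A)) \<and>
    (\<forall>f g. btgt C (bdom C f) = bsrc C (bdom C g) \<longrightarrow>
        bvc D (bhm D (lf2 F f) (lf2 F g)) (lfm F (bdom C f) (bdom C g)) =
        bvc D (lfm F (bcod C f) (bcod C g)) (lf2 F (bhm C f g))) \<and>
    (\<forall>M N P. btgt C M = bsrc C N \<and> btgt C N = bsrc C P \<longrightarrow>
        bvc D (bassoc D (lf1 F M) (lf1 F N) (lf1 F P))
          (bvc D (bhm D (lfm F M N) (bid D (lf1 F P))) (lfm F (bhc C M N) P)) =
        bvc D (bhm D (bid D (lf1 F M)) (lfm F N P))
          (bvc D (lfm F M (bhc C N P)) (lf2 F (bassoc C M N P)))) \<and>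
    (\<forall>M. bvc D (blu D (lf1 F M))
          (bvc D (bhm D (lfi F (bsrc C M)) (bid D (lf1 F M))) (lfm F (bunit C (bsrc C M)) M)) =
        lf2 F (blu C M)) \<and>
    (\<forall>M. bvc D (bru D (lf1 F M))
          (bvc D (bhm D (bid D (lf1 F M)) (lfi F (btgt C M))) (lfm F M (bunit C (btgt C M)))) =
        lf2 F (bru C M))"

definition sh_functor :: "('d,'e,'c1,'m1) shadow \<Rightarrow> ('i,'j,'c2,'m2) shadow \<Rightarrow> ('d,'e,'i,'j) shfun \<Rightarrow> bool" where
  "sh_functor S T H \<longleftrightarrow>
    (\<forall>f. sdom T (hf1 H f) = hf0 H (sdom S f) \<and> scod T (hf1 H f) = hf0 H (scod S f)) \<and>
    (\<forall>x. hf1 H (sid S x) = sid T (hf0 H x)) \<and>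
    (\<forall>f g. scod S f = sdom S g \<longrightarrow> hf1 H (scomp S g f) = scomp T (hf1 H g) (hf1 H f))"

definition normal_lax_shadow_functor ::
  "('a,'b,'c) bicat \<Rightarrow> ('d,'e,'b,'c) shadow \<Rightarrow> ('f,'g,'h) bicat \<Rightarrow> ('i,'j,'g,'h) shadow \<Rightarrow>
   ('a,'b,'c,'f,'g,'h) laxf \<Rightarrow> ('d,'e,'i,'j) shfun \<Rightarrow> ('b \<Rightarrow> 'j) \<Rightarrow> bool" where
  "normal_lax_shadow_functor C CS D DS F H s \<longleftrightarrow>
    lax_functor C D F \<and> sh_functor CS DS H \<and>
    (\<forall>M. bsrc C M = btgt C M \<longrightarrow>
        sdom DS (s M) = sh0 DS (lf1 F M) \<and> scod DS (s M) = hf0 H (sh0 CS M)) \<and>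
    (\<forall>f. bsrc C (bdom C f) = btgt C (bdom C f) \<longrightarrow>
        scomp DS (s (bcod C f)) (sh1 DS (lf2 F f)) = scomp DS (hf1 H (sh1 CS f)) (s (bdom C f))) \<and>
    (\<forall>M N. btgt C M = bsrc C N \<and> btgt C N = bsrc C M \<longrightarrow>
        scomp DS (hf1 H (srot CS M N)) (scomp DS (s (bhc C M N)) (sh1 DS (lfm F M N))) =
        scomp DS (s (bhc C N M)) (scomp DS (sh1 DS (lfm F N M)) (srot DS (lf1 F M) (lf1 F N)))) \<and>
    (\<forall>A. is_iso2 D (lfi F A))"

definition normal_oplax_shadow_functor ::
  "('a,'b,'c) bicat \<Rightarrow> ('d,'e,'b,'c) shadow \<Rightarrow> ('f,'g,'h) bicat \<Rightarrow> ('i,'j,'g,'h) shadow \<Rightarrow>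
   ('a,'b,'c,'f,'g,'h) laxf \<Rightarrow> ('d,'e,'i,'j) shfun \<Rightarrow> ('b \<Rightarrow> 'j) \<Rightarrow> bool" where
  "normal_oplax_shadow_functor C CS D DS F H s \<longleftrightarrow>
    oplax_functor C D F \<and> sh_functor CS DS H \<and>
    (\<forall>M. bsrc C M = btgt C M \<longrightarrow>
        sdom DS (s M) = hf0 H (sh0 CS M) \<and> scod DS (s M) = sh0 DS (lf1 F M)) \<and>
    (\<forall>f. bsrc C (bdom C f) = btgt C (bdom C f) \<longrightarrow>
        scomp DS (sh1 DS (lf2 F f)) (s (bdom C f)) = scomp DS (s (bcod C f)) (hf1 H (sh1 CS f))) \<and>
    (\<forall>M N. btgt C M = bsrc C N \<and> btgt C N = bsrc C M \<longrightarrow>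
        scomp DS (sh1 DS (lfm F N M)) (scomp DS (s (bhc C N M)) (hf1 H (srot CS M N))) =
        scomp DS (srot DS (lf1 F M) (lf1 F N)) (scomp DS (sh1 DS (lfm F M N)) (s (bhc C M N)))) \<and>
    (\<forall>A. is_iso2 D (lfi F A))"

section \<open>Duals: an oplax shadow functor is a lax shadow functor between the 2-cell duals\<close>

definition co :: "('o,'c,'m) bicat \<Rightarrow> ('o,'c,'m) bicat" where
  "co B = B\<lparr>bdom := bcod B, bcod := bdom B, bvc := (\<lambda>g f. bvc B f g),
      bassoc := (\<lambda>M N P. inv2 B (bassoc B M N P)),
      blu := (\<lambda>M. inv2 B (blu B M)), bru := (\<lambda>M. inv2 B (bru B M))\<rparr>"

definition co_sh :: "('s,'n,'c,'m) shadow \<Rightarrow> ('s,'n,'c,'m) shadow" where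
  "co_sh S = S\<lparr>sdom := scod S, scod := sdom S, scomp := (\<lambda>g f. scomp S f g),
      srot := (\<lambda>M N. srot S N M)\<rparr>"

section \<open>The free normal lax shadow functor on the underlying graph of C (syntax)\<close>

text \<open>The underlying graph of C has the objects of C as vertices and the 1-cells of C as edges.
  Morphisms of Sh_N(UC) are represented by generating terms; formal morphisms are their images.\<close>

text \<open>1-cells of the free bicategory F(G): parenthesized words in edges and units.\<close>
datatype ('a,'b) fw = FE 'b | FU 'a | FC "('a,'b) fw" "('a,'b) fw"

fun fsrc :: "('a,'b,'c) bicat \<Rightarrow> ('a,'b) fw \<Rightarrow> 'a" and ftgt :: "('a,'b,'c) bicat \<Rightarrow> ('a,'b) fw \<Rightarrow> 'a" where
  "fsrc C (FE M) = bsrc C M" | "fsrc C (FU A) = A" | "fsrc C (FC u v) = fsrc C u"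
| "ftgt C (FE M) = btgt C M" | "ftgt C (FU A) = A" | "ftgt C (FC u v) = ftgt C v"

fun fwf :: "('a,'b,'c) bicat \<Rightarrow> ('a,'b) fw \<Rightarrow> bool" where
  "fwf C (FE M) = True" | "fwf C (FU A) = True"
| "fwf C (FC u v) = (fwf C u \<and> fwf C v \<and> ftgt C u = fsrc C v)"

fun fletters :: "('a,'b) fw \<Rightarrow> 'b list" where
  "fletters (FE M) = [M]" | "fletters (FU A) = []" | "fletters (FC u v) = fletters u @ fletters v"

text \<open>Generating 2-cells of F(G) (associators, unitors, their inverses, composites).\<close>
datatype ('a,'b) f2 = FId "('a,'b) fw" | FAs "('a,'b) fw" "('a,'b) fw" "('a,'b) fw"
  | FAsI "('a,'b) fw" "('a,'b) fw" "('a,'b) fw" | FLu "('a,'b) fw" | FLuI "('a,'b) fw"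
  | FRu "('a,'b) fw" | FRuI "('a,'b) fw" | FV "('a,'b) f2" "('a,'b) f2" | FH "('a,'b) f2" "('a,'b) f2"

fun fdom :: "('a,'b,'c) bicat \<Rightarrow> ('a,'b) f2 \<Rightarrow> ('a,'b) fw" and fcod :: "('a,'b,'c) bicat \<Rightarrow> ('a,'b) f2 \<Rightarrow> ('a,'b) fw" where
  "fdom C (FId w) = w" | "fdom C (FAs u v w) = FC (FC u v) w" | "fdom C (FAsI u v w) = FC u (FC v w)"
| "fdom C (FLu w) = FC (FU (fsrc C w)) w" | "fdom C (FLuI w) = w"
| "fdom C (FRu w) = FC w (FU (ftgt C w))" | "fdom C (FRuI w) = w"
| "fdom C (FV g f) = fdom C f" | "fdom C (FH f g) = FC (fdom C f) (fdom C g)"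
| "fcod C (FId w) = w" | "fcod C (FAs u v w) = FC u (FC v w)" | "fcod C (FAsI u v w) = FC (FC u v) w"
| "fcod C (FLu w) = w" | "fcod C (FLuI w) = FC (FU (fsrc C w)) w"
| "fcod C (FRu w) = w" | "fcod C (FRuI w) = FC w (FU (ftgt C w))"
| "fcod C (FV g f) = fcod C g" | "fcod C (FH f g) = FC (fcod C f) (fcod C g)"

fun f2wf :: "('a,'b,'c) bicat \<Rightarrow> ('a,'b) f2 \<Rightarrow> bool" where
  "f2wf C (FId w) = fwf C w"
| "f2wf C (FAs u v w) = (fwf C u \<and> fwf C v \<and> fwf C w \<and> ftgt C u = fsrc C v \<and> ftgt C v = fsrc C w)"
| "f2wf C (FAsI u v w) = (fwf C u \<and> fwf C v \<and> fwf C w \<and> ftgt C u = fsrc C v \<and> ftgt C v = fsrc C w)"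
| "f2wf C (FLu w) = fwf C w" | "f2wf C (FLuI w) = fwf C w"
| "f2wf C (FRu w) = fwf C w" | "f2wf C (FRuI w) = fwf C w"
| "f2wf C (FV g f) = (f2wf C g \<and> f2wf C f \<and> fcod C f = fdom C g)"
| "f2wf C (FH f g) = (f2wf C f \<and> f2wf C g \<and> ftgt C (fdom C f) = fsrc C (fdom C g))"

text \<open>1-cells of N(G): parenthesized words in formal units and terms \<Phi>(w).\<close>
datatype ('a,'b) nw = NPhi "('a,'b) fw" | NU 'a | NC "('a,'b) nw" "('a,'b) nw"

fun nsrc :: "('a,'b,'c) bicat \<Rightarrow> ('a,'b) nw \<Rightarrow> 'a" and ntgt :: "('a,'b,'c) bicat \<Rightarrow> ('a,'b) nw \<Rightarrow> 'a" where
  "nsrc C (NPhi w) = fsrc C w" | "nsrc C (NU A) = A" | "nsrc C (NC u v) = nsrc C u"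
| "ntgt C (NPhi w) = ftgt C w" | "ntgt C (NU A) = A" | "ntgt C (NC u v) = ntgt C v"

fun nwf :: "('a,'b,'c) bicat \<Rightarrow> ('a,'b) nw \<Rightarrow> bool" where
  "nwf C (NPhi w) = fwf C w" | "nwf C (NU A) = True"
| "nwf C (NC u v) = (nwf C u \<and> nwf C v \<and> ntgt C u = nsrc C v)"

fun nletters :: "('a,'b) nw \<Rightarrow> 'b list" where
  "nletters (NPhi w) = fletters w" | "nletters (NU A) = []" | "nletters (NC u v) = nletters u @ nletters v"

text \<open>Generating 2-cells of N(G): associators, unitors (and inverses), i, i\<inverse>, m, \<Phi> of 2-cells
  of F(G), vertical and horizontal composites.\<close>
datatype ('a,'b) n2 = NId "('a,'b) nw" | NAs "('a,'b) nw" "('a,'b) nw" "('a,'b) nw"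
  | NAsI "('a,'b) nw" "('a,'b) nw" "('a,'b) nw" | NLu "('a,'b) nw" | NLuI "('a,'b) nw"
  | NRu "('a,'b) nw" | NRuI "('a,'b) nw" | NI 'a | NII 'a | NM "('a,'b) fw" "('a,'b) fw"
  | NPhi2 "('a,'b) f2" | NV "('a,'b) n2" "('a,'b) n2" | NH "('a,'b) n2" "('a,'b) n2"

fun n2dom :: "('a,'b,'c) bicat \<Rightarrow> ('a,'b) n2 \<Rightarrow> ('a,'b) nw" and n2cod :: "('a,'b,'c) bicat \<Rightarrow> ('a,'b) n2 \<Rightarrow> ('a,'b) nw" where
  "n2dom C (NId w) = w" | "n2dom C (NAs u v w) = NC (NC u v) w" | "n2dom C (NAsI u v w) = NC u (NC v w)"
| "n2dom C (NLu w) = NC (NU (nsrc C w)) w" | "n2dom C (NLuI w) = w"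
| "n2dom C (NRu w) = NC w (NU (ntgt C w))" | "n2dom C (NRuI w) = w"
| "n2dom C (NI A) = NU A" | "n2dom C (NII A) = NPhi (FU A)"
| "n2dom C (NM u v) = NC (NPhi u) (NPhi v)" | "n2dom C (NPhi2 a) = NPhi (fdom C a)"
| "n2dom C (NV g f) = n2dom C f" | "n2dom C (NH f g) = NC (n2dom C f) (n2dom C g)"
| "n2cod C (NId w) = w" | "n2cod C (NAs u v w) = NC u (NC v w)" | "n2cod C (NAsI u v w) = NC (NC u v) w"
| "n2cod C (NLu w) = w" | "n2cod C (NLuI w) = NC (NU (nsrc C w)) w"
| "n2cod C (NRu w) = w" | "n2cod C (NRuI w) = NC w (NU (ntgt C w))"
| "n2cod C (NI A) = NPhi (FU A)" | "n2cod C (NII A) = NU A"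
| "n2cod C (NM u v) = NPhi (FC u v)" | "n2cod C (NPhi2 a) = NPhi (fcod C a)"
| "n2cod C (NV g f) = n2cod C g" | "n2cod C (NH f g) = NC (n2cod C f) (n2cod C g)"

fun n2wf :: "('a,'b,'c) bicat \<Rightarrow> ('a,'b) n2 \<Rightarrow> bool" where
  "n2wf C (NId w) = nwf C w"
| "n2wf C (NAs u v w) = (nwf C u \<and> nwf C v \<and> nwf C w \<and> ntgt C u = nsrc C v \<and> ntgt C v = nsrc C w)"
| "n2wf C (NAsI u v w) = (nwf C u \<and> nwf C v \<and> nwf C w \<and> ntgt C u = nsrc C v \<and> ntgt C v = nsrc C w)"
| "n2wf C (NLu w) = nwf C w" | "n2wf C (NLuI w) = nwf C w"
| "n2wf C (NRu w) = nwf C w" | "n2wf C (NRuI w) = nwf C w"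
| "n2wf C (NI A) = True" | "n2wf C (NII A) = True"
| "n2wf C (NM u v) = (fwf C u \<and> fwf C v \<and> ftgt C u = fsrc C v)"
| "n2wf C (NPhi2 a) = f2wf C a"
| "n2wf C (NV g f) = (n2wf C g \<and> n2wf C f \<and> n2cod C f = n2dom C g)"
| "n2wf C (NH f g) = (n2wf C f \<and> n2wf C g \<and> ntgt C (n2dom C f) = nsrc C (n2dom C g))"

text \<open>Objects of Sh_N(G): \<Psi>\<langle>\<langle>w\<rangle>\<rangle> and \<langle>\<langle>W\<rangle>\<rangle>.\<close>
datatype ('a,'b) so = SPsi "('a,'b) fw" | SSh "('a,'b) nw"

fun soletters :: "('a,'b) so \<Rightarrow> 'b list" where
  "soletters (SPsi w) = fletters w" | "soletters (SSh W) = nletters W"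

text \<open>Generating morphisms of Sh_N(G): \<Psi>\<langle>\<langle>\<alpha>\<rangle>\<rangle>, \<Psi>(\<theta>) (images of the generators of Sh(G)),
  \<langle>\<langle>f\<rangle>\<rangle> for 2-cells f of N(G), outermost rotators \<theta>, s, and composites.\<close>
datatype ('a,'b) sm = SPsi2 "('a,'b) f2" | SPsiRot "('a,'b) fw" "('a,'b) fw"
  | SSh2 "('a,'b) n2" | SRot "('a,'b) nw" "('a,'b) nw" | Ss "('a,'b) fw" | SV "('a,'b) sm" "('a,'b) sm"

fun smdom :: "('a,'b,'c) bicat \<Rightarrow> ('a,'b) sm \<Rightarrow> ('a,'b) so" and smcod :: "('a,'b,'c) bicat \<Rightarrow> ('a,'b) sm \<Rightarrow> ('a,'b) so" where
  "smdom C (SPsi2 a) = SPsi (fdom C a)" | "smdom C (SPsiRot u v) = SPsi (FC u v)"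
| "smdom C (SSh2 f) = SSh (n2dom C f)" | "smdom C (SRot U V) = SSh (NC U V)"
| "smdom C (Ss w) = SSh (NPhi w)" | "smdom C (SV g f) = smdom C f"
| "smcod C (SPsi2 a) = SPsi (fcod C a)" | "smcod C (SPsiRot u v) = SPsi (FC v u)"
| "smcod C (SSh2 f) = SSh (n2cod C f)" | "smcod C (SRot U V) = SSh (NC V U)"
| "smcod C (Ss w) = SPsi w" | "smcod C (SV g f) = smcod C g"

fun smwf :: "('a,'b,'c) bicat \<Rightarrow> ('a,'b) sm \<Rightarrow> bool" where
  "smwf C (SPsi2 a) = (f2wf C a \<and> fsrc C (fdom C a) = ftgt C (fdom C a))"
| "smwf C (SPsiRot u v) = (fwf C u \<and> fwf C v \<and> ftgt C u = fsrc C v \<and> ftgt C v = fsrc C u)"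
| "smwf C (SSh2 f) = (n2wf C f \<and> nsrc C (n2dom C f) = ntgt C (n2dom C f))"
| "smwf C (SRot U V) = (nwf C U \<and> nwf C V \<and> ntgt C U = nsrc C V \<and> ntgt C V = nsrc C U)"
| "smwf C (Ss w) = (fwf C w \<and> fsrc C w = ftgt C w)"
| "smwf C (SV g f) = (smwf C g \<and> smwf C f \<and> smcod C f = smdom C g)"

text \<open>Underlying cyclic permutation: the bijection from letter occurrences (positions) in the
  source to positions in the target.  Only rotators move letters.\<close>
fun smperm :: "('a,'b) sm \<Rightarrow> nat \<Rightarrow> nat" where
  "smperm (SPsiRot u v) = (\<lambda>p. (p + length (fletters v)) mod (length (fletters u) + length (fletters v)))"
| "smperm (SRot U V) = (\<lambda>p. (p + length (nletters V)) mod (length (nletters U) + length (nletters V)))"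
| "smperm (SV g f) = smperm g \<circ> smperm f"
| "smperm (SPsi2 a) = id" | "smperm (SSh2 f) = id" | "smperm (Ss w) = id"

section \<open>Interpretation: the induced strict functor Sh_N(UC) \<rightarrow> D_Sh\<close>

fun fev :: "('a,'b,'c) bicat \<Rightarrow> ('a,'b) fw \<Rightarrow> 'b" where
  "fev C (FE M) = M" | "fev C (FU A) = bunit C A" | "fev C (FC u v) = bhc C (fev C u) (fev C v)"

fun f2ev :: "('a,'b,'c) bicat \<Rightarrow> ('a,'b) f2 \<Rightarrow> 'c" where
  "f2ev C (FId w) = bid C (fev C w)"
| "f2ev C (FAs u v w) = bassoc C (fev C u) (fev C v) (fev C w)"
| "f2ev C (FAsI u v w) = inv2 C (bassoc C (fev C u) (fev C v) (fev C w))"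
| "f2ev C (FLu w) = blu C (fev C w)" | "f2ev C (FLuI w) = inv2 C (blu C (fev C w))"
| "f2ev C (FRu w) = bru C (fev C w)" | "f2ev C (FRuI w) = inv2 C (bru C (fev C w))"
| "f2ev C (FV g f) = bvc C (f2ev C g) (f2ev C f)"
| "f2ev C (FH f g) = bhm C (f2ev C f) (f2ev C g)"

fun nev :: "('a,'b,'c) bicat \<Rightarrow> ('f,'g,'h) bicat \<Rightarrow> ('a,'b,'c,'f,'g,'h) laxf \<Rightarrow> ('a,'b) nw \<Rightarrow> 'g" where
  "nev C D F (NPhi w) = lf1 F (fev C w)" | "nev C D F (NU A) = bunit D (lf0 F A)"
| "nev C D F (NC u v) = bhc D (nev C D F u) (nev C D F v)"

fun n2ev :: "('a,'b,'c) bicat \<Rightarrow> ('f,'g,'h) bicat \<Rightarrow> ('a,'b,'c,'f,'g,'h) laxf \<Rightarrow> ('a,'b) n2 \<Rightarrow> 'h" where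
  "n2ev C D F (NId w) = bid D (nev C D F w)"
| "n2ev C D F (NAs u v w) = bassoc D (nev C D F u) (nev C D F v) (nev C D F w)"
| "n2ev C D F (NAsI u v w) = inv2 D (bassoc D (nev C D F u) (nev C D F v) (nev C D F w))"
| "n2ev C D F (NLu w) = blu D (nev C D F w)" | "n2ev C D F (NLuI w) = inv2 D (blu D (nev C D F w))"
| "n2ev C D F (NRu w) = bru D (nev C D F w)" | "n2ev C D F (NRuI w) = inv2 D (bru D (nev C D F w))"
| "n2ev C D F (NI A) = lfi F A" | "n2ev C D F (NII A) = inv2 D (lfi F A)"
| "n2ev C D F (NM u v) = lfm F (fev C u) (fev C v)"
| "n2ev C D F (NPhi2 a) = lf2 F (f2ev C a)"
| "n2ev C D F (NV g f) = bvc D (n2ev C D F g) (n2ev C D F f)"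
| "n2ev C D F (NH f g) = bhm D (n2ev C D F f) (n2ev C D F g)"

fun smev :: "('a,'b,'c) bicat \<Rightarrow> ('d,'e,'b,'c) shadow \<Rightarrow> ('f,'g,'h) bicat \<Rightarrow> ('i,'j,'g,'h) shadow \<Rightarrow>
   ('a,'b,'c,'f,'g,'h) laxf \<Rightarrow> ('d,'e,'i,'j) shfun \<Rightarrow> ('b \<Rightarrow> 'j) \<Rightarrow> ('a,'b) sm \<Rightarrow> 'j" where
  "smev C CS D DS F H s (SPsi2 a) = hf1 H (sh1 CS (f2ev C a))"
| "smev C CS D DS F H s (SPsiRot u v) = hf1 H (srot CS (fev C u) (fev C v))"
| "smev C CS D DS F H s (SSh2 f) = sh1 DS (n2ev C D F f)"
| "smev C CS D DS F H s (SRot U V) = srot DS (nev C D F U) (nev C D F V)"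
| "smev C CS D DS F H s (Ss w) = s (fev C w)"
| "smev C CS D DS F H s (SV g f) = scomp DS (smev C CS D DS F H s g) (smev C CS D DS F H s f)"

definition aperiodic :: "'x list \<Rightarrow> bool" where
  "aperiodic xs \<longleftrightarrow> (\<forall>k. 0 < k \<and> k < length xs \<longrightarrow> rotate k xs \<noteq> xs)"

definition formal_coherence ::
  "('a,'b,'c) bicat \<Rightarrow> ('d,'e,'b,'c) shadow \<Rightarrow> ('f,'g,'h) bicat \<Rightarrow> ('i,'j,'g,'h) shadow \<Rightarrow>
   ('a,'b,'c,'f,'g,'h) laxf \<Rightarrow> ('d,'e,'i,'j) shfun \<Rightarrow> ('b \<Rightarrow> 'j) \<Rightarrow> bool" where
  "formal_coherence C CS D DS F H s \<longleftrightarrow>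
    (\<forall>t1 t2. smwf C t1 \<and> smwf C t2 \<and> smdom C t1 = smdom C t2 \<and> smcod C t1 = smcod C t2 \<and>
       (\<forall>p < length (soletters (smdom C t1)). smperm t1 p = smperm t2 p) \<longrightarrow>
       smev C CS D DS F H s t1 = smev C CS D DS F H s t2) \<and>
    (\<forall>t1 t2. smwf C t1 \<and> smwf C t2 \<and> smdom C t1 = smdom C t2 \<and> smcod C t1 = smcod C t2 \<and>
       aperiodic (soletters (smdom C t1)) \<longrightarrow>
       smev C CS D DS F H s t1 = smev C CS D DS F H s t2)"

end

theory Submission imports Defs begin

text \<open>Every bicategory with shadow is compared with strict data on lists. A 1-cell built from a
  composable list \<open>xs\<close> has the right-bracketed normal form \<open>nf xs\<close>, and the canonical isomorphisms
  \<open>nf xs \<odot> nf ys \<rightarrow> nf (xs @ ys)\<close> are associative and unital by the pentagon and Kelly's unit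
  lemmas. Conjugating a rotator with them gives a rotation \<open>nf (xs @ ys) \<rightarrow> nf (ys @ xs)\<close> of
  shadows, and the shadow axioms say exactly that rotations compose like cyclic shifts, the full
  turn being the identity.

  Normality makes every \<open>\<Phi>\<close>-factor without letters invertible to a unit, so a word in \<open>\<Phi>\<close>-factors is
  determined up to canonical isomorphism by its list of nonempty blocks of letters. The images
  \<open>F (nf b)\<close> form a graded monoid, and a 2-cell of words is the multiplication of consecutive blocks;
  it is determined by the two block lists, because blocks are nonempty. A formal morphism thus
  becomes a rotation of blocks followed by such a multiplication (and, if it ends in \<open>\<Psi>\<close>, total
  multiplication, \<open>s\<close>, and a rotation of letters), and the induced permutation of letters recovers
  these data. The oplax case is the lax case for the 2-cell duals.\<close>

text \<open>The obstacle is that a permutation of letters sees nothing of a factor without letters.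
  Without normality, the rotator and the identity on \<open>NC (NPhi (FU A)) (NPhi (FU A))\<close>
  both induce the empty permutation, yet their values can differ (swap two copies of an algebra).
  Once letterless factors are gone, the letter count of a rotation tells at which block it cuts. Its
  residue cannot separate the zero turn from the full turn, which is harmless because both are
  identities. Merging blocks is not invertible, so a morphism cannot simply be normalized away.
  Instead its value is described by an equation: the normalization of the target after the morphism
  equals explicit list data after the normalization of the source. Normalizations are invertible, so
  the data determine the value, and in a composite the middle normalization passes from one equation
  to the next. The data are kept in a fixed order, first rotate and then merge;
  \<open>rho_pm\<close> and \<open>shs_rho\<close> restore this order after composition.\<close>

notation bhc (infixr "\<odot>\<index>" 70)
notation bvc (infixr "\<bullet>\<index>" 55)
notation bhm (infixr "\<star>\<index>" 70)
notation scomp (infixr "\<diamondop>\<index>" 55)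

section \<open>The bicategory axioms as rewrite rules\<close>

locale bicategory =
  fixes B :: "('o,'c,'m) bicat" (structure)
  assumes bicat: "bicat B"
begin

lemmas ax1 = bicat[unfolded bicat_def, THEN conjunct1]
lemmas ax2 = bicat[unfolded bicat_def, THEN conjunct2, THEN conjunct1]
lemmas ax3 = bicat[unfolded bicat_def, THEN conjunct2, THEN conjunct2, THEN conjunct1]
lemmas ax4 = bicat[unfolded bicat_def, THEN conjunct2, THEN conjunct2, THEN conjunct2, THEN conjunct1]
lemmas ax5 = bicat[unfolded bicat_def, THEN conjunct2, THEN conjunct2, THEN conjunct2, THEN conjunct2, THEN conjunct1]
lemmas ax6 = bicat[unfolded bicat_def, THEN conjunct2, THEN conjunct2, THEN conjunct2, THEN conjunct2, THEN conjunct2, THEN conjunct1]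
lemmas ax7 = bicat[unfolded bicat_def, THEN conjunct2, THEN conjunct2, THEN conjunct2, THEN conjunct2, THEN conjunct2, THEN conjunct2, THEN conjunct1]
lemmas ax8 = bicat[unfolded bicat_def, THEN conjunct2, THEN conjunct2, THEN conjunct2, THEN conjunct2, THEN conjunct2, THEN conjunct2, THEN conjunct2, THEN conjunct1]
lemmas ax9 = bicat[unfolded bicat_def, THEN conjunct2, THEN conjunct2, THEN conjunct2, THEN conjunct2, THEN conjunct2, THEN conjunct2, THEN conjunct2, THEN conjunct2, THEN conjunct1]
lemmas ax10 = bicat[unfolded bicat_def, THEN conjunct2, THEN conjunct2, THEN conjunct2, THEN conjunct2, THEN conjunct2, THEN conjunct2, THEN conjunct2, THEN conjunct2, THEN conjunct2, THEN conjunct1]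
lemmas ax11 = bicat[unfolded bicat_def, THEN conjunct2, THEN conjunct2, THEN conjunct2, THEN conjunct2, THEN conjunct2, THEN conjunct2, THEN conjunct2, THEN conjunct2, THEN conjunct2, THEN conjunct2, THEN conjunct1]
lemmas ax12 = bicat[unfolded bicat_def, THEN conjunct2, THEN conjunct2, THEN conjunct2, THEN conjunct2, THEN conjunct2, THEN conjunct2, THEN conjunct2, THEN conjunct2, THEN conjunct2, THEN conjunct2, THEN conjunct2, THEN conjunct1]
lemmas ax13 = bicat[unfolded bicat_def, THEN conjunct2, THEN conjunct2, THEN conjunct2, THEN conjunct2, THEN conjunct2, THEN conjunct2, THEN conjunct2, THEN conjunct2, THEN conjunct2, THEN conjunct2, THEN conjunct2, THEN conjunct2, THEN conjunct1]
lemmas ax14 = bicat[unfolded bicat_def, THEN conjunct2, THEN conjunct2, THEN conjunct2, THEN conjunct2, THEN conjunct2, THEN conjunct2, THEN conjunct2, THEN conjunct2, THEN conjunct2, THEN conjunct2, THEN conjunct2, THEN conjunct2, THEN conjunct2, THEN conjunct1]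
lemmas ax15 = bicat[unfolded bicat_def, THEN conjunct2, THEN conjunct2, THEN conjunct2, THEN conjunct2, THEN conjunct2, THEN conjunct2, THEN conjunct2, THEN conjunct2, THEN conjunct2, THEN conjunct2, THEN conjunct2, THEN conjunct2, THEN conjunct2, THEN conjunct2, THEN conjunct1]
lemmas ax16 = bicat[unfolded bicat_def, THEN conjunct2, THEN conjunct2, THEN conjunct2, THEN conjunct2, THEN conjunct2, THEN conjunct2, THEN conjunct2, THEN conjunct2, THEN conjunct2, THEN conjunct2, THEN conjunct2, THEN conjunct2, THEN conjunct2, THEN conjunct2, THEN conjunct2, THEN conjunct1]
lemmas ax17 = bicat[unfolded bicat_def, THEN conjunct2, THEN conjunct2, THEN conjunct2, THEN conjunct2, THEN conjunct2, THEN conjunct2, THEN conjunct2, THEN conjunct2, THEN conjunct2, THEN conjunct2, THEN conjunct2, THEN conjunct2, THEN conjunct2, THEN conjunct2, THEN conjunct2, THEN conjunct2, THEN conjunct1]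
lemmas ax18 = bicat[unfolded bicat_def, THEN conjunct2, THEN conjunct2, THEN conjunct2, THEN conjunct2, THEN conjunct2, THEN conjunct2, THEN conjunct2, THEN conjunct2, THEN conjunct2, THEN conjunct2, THEN conjunct2, THEN conjunct2, THEN conjunct2, THEN conjunct2, THEN conjunct2, THEN conjunct2, THEN conjunct2]

lemma src_cod [simp]: "bsrc B (bcod B f) = bsrc B (bdom B f)"
  and tgt_cod [simp]: "btgt B (bcod B f) = btgt B (bdom B f)"
  and dom_id [simp]: "bdom B (bid B M) = M"
  and cod_id [simp]: "bcod B (bid B M) = M"
  and src_unit [simp]: "bsrc B (bunit B A) = A"
  and tgt_unit [simp]: "btgt B (bunit B A) = A"
  by (metis ax1 ax2 ax7)+

lemma dom_vc [simp]: "bcod B f = bdom B g \<Longrightarrow> bdom B (g \<bullet> f) = bdom B f"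
  and cod_vc [simp]: "bcod B f = bdom B g \<Longrightarrow> bcod B (g \<bullet> f) = bcod B g"
  by (metis ax3)+

lemma vc_id_right [simp]: "bdom B f = M \<Longrightarrow> f \<bullet> bid B M = f"
  and vc_id_left [simp]: "bcod B f = M \<Longrightarrow> bid B M \<bullet> f = f"
  by (metis ax4)+

lemma vc_assoc [simp]:
  "\<lbrakk>bcod B f = bdom B g; bcod B g = bdom B h\<rbrakk> \<Longrightarrow> (h \<bullet> g) \<bullet> f = h \<bullet> (g \<bullet> f)"
  by (metis ax5)+

lemma src_hc [simp]: "btgt B M = bsrc B N \<Longrightarrow> bsrc B (M \<odot> N) = bsrc B M"
  and tgt_hc [simp]: "btgt B M = bsrc B N \<Longrightarrow> btgt B (M \<odot> N) = btgt B N"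
  by (metis ax6)+

lemma dom_hm [simp]:
    "btgt B (bdom B f) = bsrc B (bdom B g) \<Longrightarrow> bdom B (f \<star> g) = bdom B f \<odot> bdom B g"
  and cod_hm [simp]:
    "btgt B (bdom B f) = bsrc B (bdom B g) \<Longrightarrow> bcod B (f \<star> g) = bcod B f \<odot> bcod B g"
  and hm_id [simp]: "btgt B M = bsrc B N \<Longrightarrow> bid B M \<star> bid B N = bid B (M \<odot> N)"
  by (metis ax8 ax9)+

text \<open>Interchange is oriented towards fusing two adjacent horizontal composites;
  \<open>hm_vc_chain\<close> does the same inside a longer composite.\<close>

lemma hm_vc [simp]:
  "\<lbrakk>bcod B f = bdom B f'; bcod B g = bdom B g'; btgt B (bdom B f) = bsrc B (bdom B g)\<rbrakk>
    \<Longrightarrow> (f' \<star> g') \<bullet> (f \<star> g) = (f' \<bullet> f) \<star> (g' \<bullet> g)"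
  by (metis ax10)+

lemma hm_vc_chain [simp]:
  "\<lbrakk>bcod B f = bdom B f'; bcod B g = bdom B g'; btgt B (bdom B f) = bsrc B (bdom B g);
    bcod B k = bdom B f \<odot> bdom B g\<rbrakk>
    \<Longrightarrow> (f' \<star> g') \<bullet> (f \<star> g) \<bullet> k = ((f' \<bullet> f) \<star> (g' \<bullet> g)) \<bullet> k"
  using tgt_cod[of f] src_cod[of g]
  by (subst vc_assoc[symmetric]) (auto simp del: vc_assoc src_cod tgt_cod)

text \<open>Simplification brackets composites to the right, so an equation for
  \<open>g \<bullet> f\<close> no longer matches when more factors follow. This form carries it into
  the longer composite.\<close>

lemma vc_chain:
  "\<lbrakk>g \<bullet> f = h; bcod B f = bdom B g; bcod B k = bdom B f\<rbrakk> \<Longrightarrow> g \<bullet> f \<bullet> k = h \<bullet> k"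
  by (subst vc_assoc[symmetric]) auto

lemma as_type:
  "\<lbrakk>btgt B M = bsrc B N; btgt B N = bsrc B P\<rbrakk> \<Longrightarrow>
   bdom B (bassoc B M N P) = (M \<odot> N) \<odot> P \<and> bcod B (bassoc B M N P) = M \<odot> (N \<odot> P) \<and>
   is_iso2 B (bassoc B M N P)"
  by (metis ax11)+

lemma dom_as [simp]:
    "\<lbrakk>btgt B M = bsrc B N; btgt B N = bsrc B P\<rbrakk> \<Longrightarrow> bdom B (bassoc B M N P) = (M \<odot> N) \<odot> P"
  and cod_as [simp]:
    "\<lbrakk>btgt B M = bsrc B N; btgt B N = bsrc B P\<rbrakk> \<Longrightarrow> bcod B (bassoc B M N P) = M \<odot> (N \<odot> P)"
  and iso_as [simp]:
    "\<lbrakk>btgt B M = bsrc B N; btgt B N = bsrc B P\<rbrakk> \<Longrightarrow> is_iso2 B (bassoc B M N P)"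
  by (simp_all add: as_type)

lemma dom_lu [simp]: "bdom B (blu B M) = bunit B (bsrc B M) \<odot> M"
  and cod_lu [simp]: "bcod B (blu B M) = M"
  and iso_lu [simp]: "is_iso2 B (blu B M)"
  and dom_ru [simp]: "bdom B (bru B M) = M \<odot> bunit B (btgt B M)"
  and cod_ru [simp]: "bcod B (bru B M) = M"
  and iso_ru [simp]: "is_iso2 B (bru B M)"
  by (metis ax12 ax13)+

lemma as_nat:
  "\<lbrakk>btgt B (bdom B f) = bsrc B (bdom B g); btgt B (bdom B g) = bsrc B (bdom B h)\<rbrakk> \<Longrightarrow>
   bassoc B (bcod B f) (bcod B g) (bcod B h) \<bullet> ((f \<star> g) \<star> h) =
   (f \<star> (g \<star> h)) \<bullet> bassoc B (bdom B f) (bdom B g) (bdom B h)"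
  by (metis ax14)+

lemma lu_nat: "blu B (bcod B f) \<bullet> (bid B (bunit B (bsrc B (bdom B f))) \<star> f) = f \<bullet> blu B (bdom B f)"
  and ru_nat: "bru B (bcod B f) \<bullet> (f \<star> bid B (bunit B (btgt B (bdom B f)))) = f \<bullet> bru B (bdom B f)"
  by (metis ax15 ax16)+

lemma pentagon:
  "\<lbrakk>btgt B M = bsrc B N; btgt B N = bsrc B P; btgt B P = bsrc B Q\<rbrakk> \<Longrightarrow>
   bassoc B M N (P \<odot> Q) \<bullet> bassoc B (M \<odot> N) P Q =
   (bid B M \<star> bassoc B N P Q) \<bullet> bassoc B M (N \<odot> P) Q \<bullet> (bassoc B M N P \<star> bid B Q)"
  by (metis ax17)+

lemma triangle:
  "btgt B M = bsrc B N \<Longrightarrow>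
   (bid B M \<star> blu B N) \<bullet> bassoc B M (bunit B (btgt B M)) N = bru B M \<star> bid B N"
  by (metis ax18)+

subsection \<open>Invertible 2-cells\<close>

text \<open>\<open>inv2\<close> is a definite description; two-sided inverses are unique, so
  exhibiting one computes it.\<close>

lemma inv2_eq:
  assumes "bdom B g = bcod B f" "bcod B g = bdom B f"
    "g \<bullet> f = bid B (bdom B f)" "f \<bullet> g = bid B (bcod B f)"
  shows "inv2 B f = g"
  unfolding inv2_def
proof (rule the_equality)
  fix h assume h: "bdom B h = bcod B f \<and> bcod B h = bdom B f \<and>
      h \<bullet> f = bid B (bdom B f) \<and> f \<bullet> h = bid B (bcod B f)"
  have "h = h \<bullet> (f \<bullet> g)" using assms h by simp
  also have "\<dots> = (h \<bullet> f) \<bullet> g" using assms h by (subst vc_assoc) auto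
  also have "\<dots> = g" using assms h by simp
  finally show "h = g" .
qed (use assms in simp)

lemma iso2I:
  assumes "bdom B g = bcod B f" "bcod B g = bdom B f"
    "g \<bullet> f = bid B (bdom B f)" "f \<bullet> g = bid B (bcod B f)"
  shows "is_iso2 B f"
  using assms unfolding is_iso2_def by blast

context fixes f assumes f: "is_iso2 B f"
begin

lemma inv2_props:
  "bdom B (inv2 B f) = bcod B f \<and> bcod B (inv2 B f) = bdom B f \<and>
   inv2 B f \<bullet> f = bid B (bdom B f) \<and> f \<bullet> inv2 B f = bid B (bcod B f)"
proof -
  obtain g where "bdom B g = bcod B f" "bcod B g = bdom B f"
    "g \<bullet> f = bid B (bdom B f)" "f \<bullet> g = bid B (bcod B f)"
    using f unfolding is_iso2_def by blast
  moreover from this have "inv2 B f = g" by (rule inv2_eq)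
  ultimately show ?thesis by (simp only: simp_thms)
qed

lemma dom_inv2 [simp]: "bdom B (inv2 B f) = bcod B f"
  and cod_inv2 [simp]: "bcod B (inv2 B f) = bdom B f"
  and inv2_left [simp]: "inv2 B f \<bullet> f = bid B (bdom B f)"
  and inv2_right [simp]: "f \<bullet> inv2 B f = bid B (bcod B f)"
  using inv2_props by auto

lemma inv2_left_chain [simp]: "bcod B k = bdom B f \<Longrightarrow> inv2 B f \<bullet> f \<bullet> k = k"
  and inv2_right_chain [simp]: "bcod B k = bcod B f \<Longrightarrow> f \<bullet> inv2 B f \<bullet> k = k"
  by (simp add: vc_chain[OF inv2_left], simp add: vc_chain[OF inv2_right])

lemma iso_inv2 [simp]: "is_iso2 B (inv2 B f)"
  by (rule iso2I[of f]) auto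

lemma inv2_inv2 [simp]: "inv2 B (inv2 B f) = f"
  by (rule inv2_eq) auto

lemma iso_cancel_right:
  "\<lbrakk>g \<bullet> f = h \<bullet> f; bdom B g = bcod B f; bdom B h = bcod B f\<rbrakk> \<Longrightarrow> g = h"
proof -
  assume gh: "g \<bullet> f = h \<bullet> f" "bdom B g = bcod B f" "bdom B h = bcod B f"
  have "(g \<bullet> f) \<bullet> inv2 B f = (h \<bullet> f) \<bullet> inv2 B f" by (simp only: gh(1))
  with gh(2,3) show "g = h" by simp
qed

lemma iso_cancel_left:
  "\<lbrakk>f \<bullet> g = f \<bullet> h; bcod B g = bdom B f; bcod B h = bdom B f\<rbrakk> \<Longrightarrow> g = h"
proof -
  assume gh: "f \<bullet> g = f \<bullet> h" "bcod B g = bdom B f" "bcod B h = bdom B f"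
  have "inv2 B f \<bullet> f \<bullet> g = inv2 B f \<bullet> f \<bullet> h" by (simp only: gh(1))
  with gh(2,3) show "g = h" by simp
qed

end

lemma iso_id [simp]: "is_iso2 B (bid B M)"
  by (rule iso2I[of "bid B M"]) auto

lemma inv2_id [simp]: "inv2 B (bid B M) = bid B M"
  by (rule inv2_eq) auto

lemma iso_vc [simp]:
  "\<lbrakk>is_iso2 B f; is_iso2 B g; bcod B f = bdom B g\<rbrakk> \<Longrightarrow> is_iso2 B (g \<bullet> f)"
  by (rule iso2I[of "inv2 B f \<bullet> inv2 B g"]) auto

lemma iso_hm [simp]:
  "\<lbrakk>is_iso2 B f; is_iso2 B g; btgt B (bdom B f) = bsrc B (bdom B g)\<rbrakk> \<Longrightarrow> is_iso2 B (f \<star> g)"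
  by (rule iso2I[of "inv2 B f \<star> inv2 B g"]) auto

lemma inv2_hm:
  "\<lbrakk>is_iso2 B f; is_iso2 B g; btgt B (bdom B f) = bsrc B (bdom B g)\<rbrakk>
    \<Longrightarrow> inv2 B (f \<star> g) = inv2 B f \<star> inv2 B g"
  by (rule inv2_eq) auto

lemma inv2_vc:
  "\<lbrakk>is_iso2 B f; is_iso2 B g; bcod B f = bdom B g\<rbrakk> \<Longrightarrow> inv2 B (g \<bullet> f) = inv2 B f \<bullet> inv2 B g"
  by (rule inv2_eq) auto

subsection \<open>Unit coherence\<close>

text \<open>By naturality, conjugating with the left unitor removes the whiskering, so whiskering by
  a unit is faithful.\<close>

lemma unit_whisker_left_cancel:
  assumes "bid B (bunit B A) \<star> f = bid B (bunit B A) \<star> g"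
    "bdom B f = bdom B g" "bcod B f = bcod B g" "bsrc B (bdom B f) = A"
  shows "f = g"
proof -
  have "f \<bullet> blu B (bdom B f) = g \<bullet> blu B (bdom B f)"
    using lu_nat[of f] lu_nat[of g] assms by simp
  then show ?thesis by (rule iso_cancel_right[rotated]) (use assms in auto)
qed

lemma unit_whisker_right_cancel:
  assumes "f \<star> bid B (bunit B A) = g \<star> bid B (bunit B A)"
    "bdom B f = bdom B g" "bcod B f = bcod B g" "btgt B (bdom B f) = A"
  shows "f = g"
proof -
  have "f \<bullet> bru B (bdom B f) = g \<bullet> bru B (bdom B f)"
    using ru_nat[of f] ru_nat[of g] assms by simp
  then show ?thesis by (rule iso_cancel_right[rotated]) (use assms in auto)
qed

text \<open>Kelly's derivation from pentagon and triangle. Both sides are whiskered by the unit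
  \<open>?I\<close> and precomposed with the invertible \<open>?X\<close>; the pentagon for
  \<open>?I\<close>, \<open>?I\<close>, \<open>M\<close>, \<open>N\<close> and the triangles at
  \<open>M \<odot> N\<close> and at \<open>M\<close> connect them, and both changes cancel.\<close>

lemma lu_hc:
  assumes MN: "btgt B M = bsrc B N"
  shows "blu B (M \<odot> N) \<bullet> bassoc B (bunit B (bsrc B M)) M N = blu B M \<star> bid B N"
proof -
  let ?I = "bunit B (bsrc B M)"
  let ?X = "bassoc B ?I (?I \<odot> M) N \<bullet> (bassoc B ?I ?I M \<star> bid B N)"
  have "(bid B ?I \<star> (blu B (M \<odot> N) \<bullet> bassoc B ?I M N)) \<bullet> ?X
      = (bid B ?I \<star> blu B (M \<odot> N)) \<bullet> (bid B ?I \<star> bassoc B ?I M N) \<bullet> ?X"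
    using MN by simp
  also have "\<dots> = (bid B ?I \<star> blu B (M \<odot> N)) \<bullet> bassoc B ?I ?I (M \<odot> N) \<bullet> bassoc B (?I \<odot> ?I) M N"
    using MN pentagon[of ?I ?I M N] by simp
  also have "\<dots> = (bru B ?I \<star> bid B (M \<odot> N)) \<bullet> bassoc B (?I \<odot> ?I) M N"
    using MN triangle[of ?I "M \<odot> N"] by (subst vc_chain) auto
  also have "\<dots> = bassoc B ?I M N \<bullet> ((bru B ?I \<star> bid B M) \<star> bid B N)"
    using MN as_nat[of "bru B ?I" "bid B M" "bid B N"] by simp
  also have "\<dots> = bassoc B ?I M N \<bullet> ((bid B ?I \<star> blu B M) \<star> bid B N) \<bullet> (bassoc B ?I ?I M \<star> bid B N)"
    using MN triangle[of ?I M] by simp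
  also have "\<dots> = (bid B ?I \<star> (blu B M \<star> bid B N)) \<bullet> ?X"
    using MN as_nat[of "bid B ?I" "blu B M" "bid B N"] by (subst vc_chain) auto
  finally have "bid B ?I \<star> (blu B (M \<odot> N) \<bullet> bassoc B ?I M N) = bid B ?I \<star> (blu B M \<star> bid B N)"
    by (rule iso_cancel_right[rotated]) (use MN in auto)
  then show ?thesis by (rule unit_whisker_left_cancel) (use MN in auto)
qed

text \<open>Mirror image of \<open>lu_hc\<close>: whisker by the unit on the right, use two
  triangles and the pentagon for \<open>M\<close>, \<open>N\<close>, \<open>?I\<close>,
  \<open>?I\<close>, and cancel the associator on the left.\<close>

lemma ru_hc:
  assumes MN: "btgt B M = bsrc B N"
  shows "(bid B M \<star> bru B N) \<bullet> bassoc B M N (bunit B (btgt B N)) = bru B (M \<odot> N)"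
proof -
  let ?I = "bunit B (btgt B N)"
  have "bassoc B M N ?I \<bullet> (bru B (M \<odot> N) \<star> bid B ?I)
      = bassoc B M N ?I \<bullet> (bid B (M \<odot> N) \<star> blu B ?I) \<bullet> bassoc B (M \<odot> N) ?I ?I"
    using MN triangle[of "M \<odot> N" ?I] by simp
  also have "\<dots> = (bid B M \<star> (bid B N \<star> blu B ?I)) \<bullet> bassoc B M N (?I \<odot> ?I) \<bullet> bassoc B (M \<odot> N) ?I ?I"
    using MN as_nat[of "bid B M" "bid B N" "blu B ?I"] by (subst vc_chain) auto
  also have "\<dots> = (bid B M \<star> ((bid B N \<star> blu B ?I) \<bullet> bassoc B N ?I ?I)) \<bullet>
      bassoc B M (N \<odot> ?I) ?I \<bullet> (bassoc B M N ?I \<star> bid B ?I)"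
    using MN pentagon[of M N ?I ?I] by simp
  also have "\<dots> = (bid B M \<star> (bru B N \<star> bid B ?I)) \<bullet>
      bassoc B M (N \<odot> ?I) ?I \<bullet> (bassoc B M N ?I \<star> bid B ?I)"
    using MN triangle[of N ?I] by simp
  also have "\<dots> = bassoc B M N ?I \<bullet> (((bid B M \<star> bru B N) \<bullet> bassoc B M N ?I) \<star> bid B ?I)"
    using MN vc_chain[OF as_nat[of "bid B M" "bru B N" "bid B ?I"], where k = "bassoc B M N ?I \<star> bid B ?I"]
    by simp
  finally have "bru B (M \<odot> N) \<star> bid B ?I = ((bid B M \<star> bru B N) \<bullet> bassoc B M N ?I) \<star> bid B ?I"
    by (rule iso_cancel_left[rotated]) (use MN in auto)
  then show ?thesis by (rule unit_whisker_right_cancel[symmetric]) (use MN in auto)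
qed

text \<open>Naturality of the left unitor at itself identifies the unitor of
  \<open>?I \<odot> ?I\<close> with a whiskered unitor; \<open>lu_hc\<close> and the triangle then
  compare the two unitors after whiskering by the unit.\<close>

lemma lu_unit: "blu B (bunit B A) = bru B (bunit B A)"
proof -
  let ?I = "bunit B A"
  have "blu B ?I \<bullet> blu B (?I \<odot> ?I) = blu B ?I \<bullet> (bid B ?I \<star> blu B ?I)"
    using lu_nat[of "blu B ?I"] by simp
  then have "blu B (?I \<odot> ?I) = bid B ?I \<star> blu B ?I"
    by (rule iso_cancel_left[rotated]) auto
  then have "blu B ?I \<star> bid B ?I = bru B ?I \<star> bid B ?I"
    using lu_hc[of ?I ?I] triangle[of ?I ?I] by simp
  then show ?thesis by (rule unit_whisker_right_cancel) auto
qed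

end

context bicategory
begin

subsection \<open>List normal forms of 1-cells\<close>

text \<open>With the final unit replaced by any 1-cell \<open>x\<close>, concatenation becomes
  composition of functions: \<open>ap_append\<close> is an equality and needs no coherence
  cell.\<close>

primrec ap :: "'c list \<Rightarrow> 'c \<Rightarrow> 'c" where
  "ap [] x = x" | "ap (M # xs) x = M \<odot> ap xs x"

abbreviation nf :: "'c list \<Rightarrow> 'o \<Rightarrow> 'c" where
  "nf xs A \<equiv> ap xs (bunit B A)"

text \<open>An empty list has no endpoints of its own, hence the explicit final vertex
  \<open>A\<close>, which all later list data carry along.\<close>

primrec vs :: "'c list \<Rightarrow> 'o \<Rightarrow> 'o" where
  "vs [] A = A" | "vs (M # xs) A = bsrc B M"

primrec chn :: "'c list \<Rightarrow> 'o \<Rightarrow> bool" where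
  "chn [] A = True" | "chn (M # xs) A = (btgt B M = vs xs A \<and> chn xs A)"

text \<open>The canonical isomorphism from \<open>nf xs (bsrc B x) \<odot> x\<close> to
  \<open>ap xs x\<close>; for \<open>x = nf ys A\<close> it multiplies two normal forms.\<close>

primrec lam :: "'c list \<Rightarrow> 'c \<Rightarrow> 'm" where
  "lam [] x = blu B x"
| "lam (M # xs) x = (bid B M \<star> lam xs x) \<bullet> bassoc B M (nf xs (bsrc B x)) x"

lemma ap_append [simp]: "ap (xs @ ys) x = ap xs (ap ys x)"
  by (induction xs) auto

lemma vs_append [simp]: "vs (xs @ ys) A = vs xs (vs ys A)"
  by (cases xs) auto

lemma chn_append [simp]: "chn (xs @ ys) A \<longleftrightarrow> chn xs (vs ys A) \<and> chn ys A"
  by (induction xs) auto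

lemma btgt_last: "\<lbrakk>chn xs A; xs \<noteq> []\<rbrakk> \<Longrightarrow> btgt B (last xs) = A"
  by (induction xs) auto

lemma src_tgt_ap:
  "chn xs (bsrc B x) \<Longrightarrow> bsrc B (ap xs x) = vs xs (bsrc B x) \<and> btgt B (ap xs x) = btgt B x"
  by (induction xs) auto

lemma src_ap [simp]: "chn xs (bsrc B x) \<Longrightarrow> bsrc B (ap xs x) = vs xs (bsrc B x)"
  and tgt_ap [simp]: "chn xs (bsrc B x) \<Longrightarrow> btgt B (ap xs x) = btgt B x"
  by (simp_all add: src_tgt_ap)

lemma lam_type:
  "chn xs (bsrc B x) \<Longrightarrow> bdom B (lam xs x) = nf xs (bsrc B x) \<odot> x \<and>
    bcod B (lam xs x) = ap xs x \<and> is_iso2 B (lam xs x)"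
  by (induction xs) auto

lemma dom_lam [simp]: "chn xs (bsrc B x) \<Longrightarrow> bdom B (lam xs x) = nf xs (bsrc B x) \<odot> x"
  and cod_lam [simp]: "chn xs (bsrc B x) \<Longrightarrow> bcod B (lam xs x) = ap xs x"
  and iso_lam [simp]: "chn xs (bsrc B x) \<Longrightarrow> is_iso2 B (lam xs x)"
  by (simp_all add: lam_type)

text \<open>Right unitality of the multiplication: \<open>lu_unit\<close> is the empty case and
  \<open>ru_hc\<close> the step.\<close>

lemma lam_unit: "chn xs A \<Longrightarrow> lam xs (bunit B A) = bru B (nf xs A)"
proof (induction xs)
  case (Cons M xs)
  then show ?case using ru_hc[of M "nf xs A"] by simp
qed (simp add: lu_unit)

text \<open>Associativity of the multiplication, by induction on the first factor:
  \<open>lu_hc\<close> is the empty case, and the step is one pentagon with naturality of the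
  associator on either side of it.\<close>

lemma lam_append:
  assumes "chn (xs @ ys) (bsrc B x)"
  shows "lam (xs @ ys) x \<bullet> (lam xs (nf ys (bsrc B x)) \<star> bid B x) =
    lam xs (ap ys x) \<bullet> (bid B (nf xs (vs ys (bsrc B x))) \<star> lam ys x) \<bullet>
      bassoc B (nf xs (vs ys (bsrc B x))) (nf ys (bsrc B x)) x"
  using assms
proof (induction xs)
  case Nil
  let ?I = "bunit B (vs ys (bsrc B x))" and ?Y = "nf ys (bsrc B x)"
  have "lam ys x \<bullet> (blu B ?Y \<star> bid B x) = lam ys x \<bullet> blu B (?Y \<odot> x) \<bullet> bassoc B ?I ?Y x"
    using lu_hc[of ?Y x] Nil by simp
  also have "\<dots> = blu B (ap ys x) \<bullet> (bid B ?I \<star> lam ys x) \<bullet> bassoc B ?I ?Y x"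
    using vc_chain[OF lu_nat[of "lam ys x"], where k = "bassoc B ?I ?Y x"] Nil by simp
  finally show ?case using Nil by simp
next
  case (Cons M xs)
  let ?X = "nf xs (vs ys (bsrc B x))" and ?Y = "nf ys (bsrc B x)"
  let ?XY = "ap xs ?Y"
  have "lam ((M # xs) @ ys) x \<bullet> (lam (M # xs) ?Y \<star> bid B x)
     = (bid B M \<star> lam (xs @ ys) x) \<bullet> bassoc B M ?XY x \<bullet>
       ((bid B M \<star> lam xs ?Y) \<star> bid B x) \<bullet> (bassoc B M ?X ?Y \<star> bid B x)"
    using Cons.prems by simp
  also have "\<dots> = (bid B M \<star> (lam (xs @ ys) x \<bullet> (lam xs ?Y \<star> bid B x))) \<bullet>
       bassoc B M (?X \<odot> ?Y) x \<bullet> (bassoc B M ?X ?Y \<star> bid B x)"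
    using Cons.prems vc_chain[OF as_nat[of "bid B M" "lam xs ?Y" "bid B x"],
        where k = "bassoc B M ?X ?Y \<star> bid B x"] by simp
  also have "\<dots> = (bid B M \<star> (lam xs (ap ys x) \<bullet> (bid B ?X \<star> lam ys x))) \<bullet>
      (bid B M \<star> bassoc B ?X ?Y x) \<bullet> bassoc B M (?X \<odot> ?Y) x \<bullet> (bassoc B M ?X ?Y \<star> bid B x)"
    using Cons by simp
  also have "\<dots> = (bid B M \<star> (lam xs (ap ys x) \<bullet> (bid B ?X \<star> lam ys x))) \<bullet>
      bassoc B M ?X (?Y \<odot> x) \<bullet> bassoc B (M \<odot> ?X) ?Y x"
    using Cons.prems pentagon[of M ?X ?Y x] by simp
  also have "\<dots> = (bid B M \<star> lam xs (ap ys x)) \<bullet> bassoc B M ?X (ap ys x) \<bullet>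
      (bid B (M \<odot> ?X) \<star> lam ys x) \<bullet> bassoc B (M \<odot> ?X) ?Y x"
    using Cons.prems vc_chain[OF as_nat[of "bid B M" "bid B ?X" "lam ys x"],
        where k = "bassoc B (M \<odot> ?X) ?Y x"] by simp
  finally show ?case using Cons.prems by simp
qed

end

section \<open>Bicategories with shadow\<close>

locale shadowed = bicategory B for B :: "('o,'c,'m) bicat" (structure) +
  fixes S :: "('s,'n,'c,'m) shadow"
  assumes shadow: "bicat_with_shadow B S"
begin

lemmas cat = shadow[unfolded bicat_with_shadow_def, THEN conjunct2, THEN conjunct1, unfolded category_part_def]
lemmas shad = shadow[unfolded bicat_with_shadow_def, THEN conjunct2, THEN conjunct2]

lemma sdom_sc [simp]: "scod S f = sdom S g \<Longrightarrow> sdom S (g \<diamondop>\<^bsub>S\<^esub> f) = sdom S f"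
  and scod_sc [simp]: "scod S f = sdom S g \<Longrightarrow> scod S (g \<diamondop>\<^bsub>S\<^esub> f) = scod S g"
  and sdom_id [simp]: "sdom S (sid S x) = x"
  and scod_id [simp]: "scod S (sid S x) = x"
  and sc_id_right [simp]: "sdom S f = x \<Longrightarrow> f \<diamondop>\<^bsub>S\<^esub> sid S x = f"
  and sc_id_left [simp]: "scod S f = x \<Longrightarrow> sid S x \<diamondop>\<^bsub>S\<^esub> f = f"
  and sc_assoc [simp]: "\<lbrakk>scod S f = sdom S g; scod S g = sdom S h\<rbrakk> \<Longrightarrow>
    (h \<diamondop>\<^bsub>S\<^esub> g) \<diamondop>\<^bsub>S\<^esub> f = h \<diamondop>\<^bsub>S\<^esub> g \<diamondop>\<^bsub>S\<^esub> f"
  by (metis cat)+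

lemma sc_chain:
  "\<lbrakk>g \<diamondop>\<^bsub>S\<^esub> f = h; scod S f = sdom S g; scod S k = sdom S f\<rbrakk> \<Longrightarrow> g \<diamondop>\<^bsub>S\<^esub> f \<diamondop>\<^bsub>S\<^esub> k = h \<diamondop>\<^bsub>S\<^esub> k"
  by (subst sc_assoc[symmetric]) auto

lemma sdom_sh1 [simp]: "bsrc B (bdom B f) = btgt B (bdom B f) \<Longrightarrow> sdom S (sh1 S f) = sh0 S (bdom B f)"
  and scod_sh1 [simp]: "bsrc B (bdom B f) = btgt B (bdom B f) \<Longrightarrow> scod S (sh1 S f) = sh0 S (bcod B f)"
  and sh1_id [simp]: "bsrc B M = btgt B M \<Longrightarrow> sh1 S (bid B M) = sid S (sh0 S M)"
  and sh1_vc: "\<lbrakk>bsrc B (bdom B f) = btgt B (bdom B f); bcod B f = bdom B g\<rbrakk> \<Longrightarrow>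
    sh1 S (g \<bullet> f) = sh1 S g \<diamondop>\<^bsub>S\<^esub> sh1 S f"
  using shad by meson+

lemma sdom_rot [simp]: "\<lbrakk>btgt B M = bsrc B N; btgt B N = bsrc B M\<rbrakk> \<Longrightarrow> sdom S (srot S M N) = sh0 S (M \<odot> N)"
  and scod_rot [simp]: "\<lbrakk>btgt B M = bsrc B N; btgt B N = bsrc B M\<rbrakk> \<Longrightarrow> scod S (srot S M N) = sh0 S (N \<odot> M)"
  and rot_nat: "\<lbrakk>btgt B (bdom B f) = bsrc B (bdom B g); btgt B (bdom B g) = bsrc B (bdom B f)\<rbrakk> \<Longrightarrow>
    srot S (bcod B f) (bcod B g) \<diamondop>\<^bsub>S\<^esub> sh1 S (f \<star> g) = sh1 S (g \<star> f) \<diamondop>\<^bsub>S\<^esub> srot S (bdom B f) (bdom B g)"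
  and rot_rot: "\<lbrakk>btgt B M = bsrc B N; btgt B N = bsrc B M\<rbrakk> \<Longrightarrow>
    srot S N M \<diamondop>\<^bsub>S\<^esub> srot S M N = sid S (sh0 S (M \<odot> N))"
  and rot_unit: "bsrc B X = btgt B X \<Longrightarrow>
    sh1 S (blu B X) \<diamondop>\<^bsub>S\<^esub> srot S X (bunit B (bsrc B X)) = sh1 S (bru B X)"
  and hexagon: "\<lbrakk>btgt B M = bsrc B N; btgt B N = bsrc B P; btgt B P = bsrc B M\<rbrakk> \<Longrightarrow>
    srot S (P \<odot> M) N \<diamondop>\<^bsub>S\<^esub> sh1 S (inv2 B (bassoc B P M N)) \<diamondop>\<^bsub>S\<^esub> srot S (M \<odot> N) P =
    sh1 S (bassoc B N P M) \<diamondop>\<^bsub>S\<^esub> srot S M (N \<odot> P) \<diamondop>\<^bsub>S\<^esub> sh1 S (bassoc B M N P)"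
  using shad by meson+

lemma sh1_inv_left [simp]:
  "\<lbrakk>is_iso2 B f; bsrc B (bdom B f) = btgt B (bdom B f)\<rbrakk> \<Longrightarrow>
    sh1 S (inv2 B f) \<diamondop>\<^bsub>S\<^esub> sh1 S f = sid S (sh0 S (bdom B f))"
  by (subst sh1_vc[symmetric]) auto

lemma sh1_inv_right [simp]:
  "\<lbrakk>is_iso2 B f; bsrc B (bdom B f) = btgt B (bdom B f)\<rbrakk> \<Longrightarrow>
    sh1 S f \<diamondop>\<^bsub>S\<^esub> sh1 S (inv2 B f) = sid S (sh0 S (bcod B f))"
  by (subst sh1_vc[symmetric]) auto

lemma sh1_iso_cancel_right:
  assumes "g \<diamondop>\<^bsub>S\<^esub> sh1 S f = h \<diamondop>\<^bsub>S\<^esub> sh1 S f" "is_iso2 B f" "bsrc B (bdom B f) = btgt B (bdom B f)"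
    "sdom S g = sh0 S (bcod B f)" "sdom S h = sh0 S (bcod B f)"
  shows "g = h"
proof -
  have "(g \<diamondop>\<^bsub>S\<^esub> sh1 S f) \<diamondop>\<^bsub>S\<^esub> sh1 S (inv2 B f) = (h \<diamondop>\<^bsub>S\<^esub> sh1 S f) \<diamondop>\<^bsub>S\<^esub> sh1 S (inv2 B f)"
    by (simp only: assms(1))
  then show ?thesis using assms(2-) by simp
qed

lemma sh1_iso_cancel_left:
  assumes "sh1 S f \<diamondop>\<^bsub>S\<^esub> g = sh1 S f \<diamondop>\<^bsub>S\<^esub> h" "is_iso2 B f" "bsrc B (bdom B f) = btgt B (bdom B f)"
    "scod S g = sh0 S (bdom B f)" "scod S h = sh0 S (bdom B f)"
  shows "g = h"
proof -
  have "sh1 S (inv2 B f) \<diamondop>\<^bsub>S\<^esub> sh1 S f \<diamondop>\<^bsub>S\<^esub> g = sh1 S (inv2 B f) \<diamondop>\<^bsub>S\<^esub> sh1 S f \<diamondop>\<^bsub>S\<^esub> h"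
    by (simp only: assms(1))
  then show ?thesis using assms(2-)
    sc_chain[OF sh1_inv_left, of f g] sc_chain[OF sh1_inv_left, of f h] by simp
qed

subsection \<open>Rotation of list normal forms\<close>

definition rho :: "'c list \<Rightarrow> 'c list \<Rightarrow> 'o \<Rightarrow> 'n" where
  "rho xs ys A = sh1 S (lam ys (nf xs (vs ys A))) \<diamondop>\<^bsub>S\<^esub>
     srot S (nf xs (vs ys A)) (nf ys A) \<diamondop>\<^bsub>S\<^esub> sh1 S (inv2 B (lam xs (nf ys A)))"

definition cyc :: "'c list \<Rightarrow> 'o \<Rightarrow> bool" where
  "cyc xs A \<longleftrightarrow> chn xs A \<and> vs xs A = A"

lemma cyc_rotate: "cyc (xs @ ys) A \<Longrightarrow> cyc (ys @ xs) (vs ys A)"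
  by (auto simp: cyc_def)

lemma sdom_rho [simp]: "cyc (xs @ ys) A \<Longrightarrow> sdom S (rho xs ys A) = sh0 S (nf (xs @ ys) A)"
  and scod_rho [simp]: "cyc (xs @ ys) A \<Longrightarrow> scod S (rho xs ys A) = sh0 S (nf (ys @ xs) (vs ys A))"
  by (simp_all add: rho_def cyc_def)

lemma rho_lam:
  "cyc (xs @ ys) A \<Longrightarrow> rho xs ys A \<diamondop>\<^bsub>S\<^esub> sh1 S (lam xs (nf ys A)) =
    sh1 S (lam ys (nf xs (vs ys A))) \<diamondop>\<^bsub>S\<^esub> srot S (nf xs (vs ys A)) (nf ys A)"
  by (simp add: rho_def cyc_def)

text \<open>As \<open>lam\<close> is invertible, \<open>rho\<close> is pinned down by its composite
  with \<open>lam\<close>, an equation in which no inverse occurs.\<close>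

lemma rho_eqI:
  assumes "cyc (xs @ ys) A" "sdom S g = sh0 S (nf (xs @ ys) A)"
    "g \<diamondop>\<^bsub>S\<^esub> sh1 S (lam xs (nf ys A)) =
      sh1 S (lam ys (nf xs (vs ys A))) \<diamondop>\<^bsub>S\<^esub> srot S (nf xs (vs ys A)) (nf ys A)"
  shows "rho xs ys A = g"
  by (rule sh1_iso_cancel_right[of _ "lam xs (nf ys A)"])
     (use assms rho_lam[OF assms(1)] in \<open>auto simp: cyc_def\<close>)

text \<open>This is the shadow unit axiom: \<open>lam [] x\<close> is the left unitor, and
  \<open>lam xs\<close> at a unit is the right unitor.\<close>

lemma rho_Nil_right [simp]: "cyc xs A \<Longrightarrow> rho xs [] A = sid S (sh0 S (nf xs A))"
  by (rule rho_eqI) (use rot_unit[of "nf xs A"] in \<open>auto simp: lam_unit cyc_def\<close>)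

lemma rho_rho:
  assumes "cyc (xs @ ys) A"
  shows "rho ys xs (vs ys A) \<diamondop>\<^bsub>S\<^esub> rho xs ys A = sid S (sh0 S (nf (xs @ ys) A))"
proof (rule sh1_iso_cancel_right[of _ "lam xs (nf ys A)"])
  have c: "cyc (ys @ xs) (vs ys A)" using cyc_rotate[OF assms] .
  show "(rho ys xs (vs ys A) \<diamondop>\<^bsub>S\<^esub> rho xs ys A) \<diamondop>\<^bsub>S\<^esub> sh1 S (lam xs (nf ys A)) =
    sid S (sh0 S (nf (xs @ ys) A)) \<diamondop>\<^bsub>S\<^esub> sh1 S (lam xs (nf ys A))"
    using assms c rho_lam[OF assms] sc_chain[OF rho_lam[OF c], where k="srot S (nf xs (vs ys A)) (nf ys A)"]
      rot_rot[of "nf xs (vs ys A)" "nf ys A"]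
    by (simp add: cyc_def)
qed (use assms cyc_rotate[OF assms] in \<open>auto simp: cyc_def\<close>)

text \<open>Carrying \<open>xs @ ys\<close> past \<open>zs\<close> at once or in two turns is the
  hexagon, once both sides are precomposed with invertible multiplications of normal forms.\<close>

lemma rho_append:
  assumes c: "cyc (xs @ ys @ zs) A"
  shows "rho (xs @ ys) zs A = rho ys (zs @ xs) (vs (ys @ zs) A) \<diamondop>\<^bsub>S\<^esub> rho xs (ys @ zs) A"
proof (rule rho_eqI)
  let ?Z = "nf zs A" and ?Y = "nf ys (vs zs A)" and ?X = "nf xs (vs ys (vs zs A))"
  have t: "chn xs (vs ys (vs zs A))" "chn ys (vs zs A)" "chn zs A"
    "vs xs (vs ys (vs zs A)) = A" using c by (auto simp: cyc_def)
  have c1: "cyc (xs @ (ys @ zs)) A" and c2: "cyc (ys @ zs @ xs) (vs ys (vs zs A))"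
    using t by (auto simp: cyc_def)
  let ?XY = "ap xs ?Y" and ?YZ = "ap ys ?Z" and ?ZX = "ap zs ?X"
  let ?R = "rho ys (zs @ xs) (vs ys (vs zs A)) \<diamondop>\<^bsub>S\<^esub> rho xs (ys @ zs) A"
  \<comment> \<open>\<open>1\<close>, \<open>2\<close> and \<open>3\<close> are associativity for
    the three cyclic orders of the lists: at the source, between the two turns, and at the
    target.\<close>
  have 1: "lam (xs @ ys) ?Z \<bullet> (lam xs ?Y \<star> bid B ?Z) =
      lam xs ?YZ \<bullet> (bid B ?X \<star> lam ys ?Z) \<bullet> bassoc B ?X ?Y ?Z"
    using t lam_append[of xs ys ?Z] by simp
  have 2: "lam (ys @ zs) ?X \<bullet> (lam ys ?Z \<star> bid B ?X) =
      lam ys ?ZX \<bullet> (bid B ?Y \<star> lam zs ?X) \<bullet> bassoc B ?Y ?Z ?X"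
    using t lam_append[of ys zs ?X] by simp
  have 3: "lam (zs @ xs) ?Y \<bullet> (lam zs ?X \<star> bid B ?Y) =
      lam zs ?XY \<bullet> (bid B ?Z \<star> lam xs ?Y) \<bullet> bassoc B ?Z ?X ?Y"
    using t lam_append[of zs xs ?Y] by simp
  have "?R \<diamondop>\<^bsub>S\<^esub> sh1 S (lam (xs @ ys) ?Z) \<diamondop>\<^bsub>S\<^esub> sh1 S (lam xs ?Y \<star> bid B ?Z)
     = ?R \<diamondop>\<^bsub>S\<^esub> sh1 S (lam xs ?YZ \<bullet> (bid B ?X \<star> lam ys ?Z) \<bullet> bassoc B ?X ?Y ?Z)"
    using t by (simp add: 1[symmetric] sh1_vc)
  also have "\<dots> = rho ys (zs @ xs) (vs ys (vs zs A)) \<diamondop>\<^bsub>S\<^esub>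
      (rho xs (ys @ zs) A \<diamondop>\<^bsub>S\<^esub> sh1 S (lam xs ?YZ)) \<diamondop>\<^bsub>S\<^esub>
      sh1 S (bid B ?X \<star> lam ys ?Z) \<diamondop>\<^bsub>S\<^esub> sh1 S (bassoc B ?X ?Y ?Z)"
    using t c1 c2 by (simp add: sh1_vc)
  also have "rho xs (ys @ zs) A \<diamondop>\<^bsub>S\<^esub> sh1 S (lam xs ?YZ) =
      sh1 S (lam (ys @ zs) ?X) \<diamondop>\<^bsub>S\<^esub> srot S ?X ?YZ"
    using rho_lam[OF c1] by simp
  also have "rho ys (zs @ xs) (vs ys (vs zs A)) \<diamondop>\<^bsub>S\<^esub> (sh1 S (lam (ys @ zs) ?X) \<diamondop>\<^bsub>S\<^esub> srot S ?X ?YZ) \<diamondop>\<^bsub>S\<^esub>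
      sh1 S (bid B ?X \<star> lam ys ?Z) \<diamondop>\<^bsub>S\<^esub> sh1 S (bassoc B ?X ?Y ?Z) =
      rho ys (zs @ xs) (vs ys (vs zs A)) \<diamondop>\<^bsub>S\<^esub> sh1 S (lam (ys @ zs) ?X) \<diamondop>\<^bsub>S\<^esub>
      sh1 S (lam ys ?Z \<star> bid B ?X) \<diamondop>\<^bsub>S\<^esub> srot S ?X (?Y \<odot> ?Z) \<diamondop>\<^bsub>S\<^esub> sh1 S (bassoc B ?X ?Y ?Z)"
    using t c1 c2 sc_chain[OF rot_nat[of "bid B ?X" "lam ys ?Z"], where k = "sh1 S (bassoc B ?X ?Y ?Z)"]
    by simp
  also have "\<dots> = rho ys (zs @ xs) (vs ys (vs zs A)) \<diamondop>\<^bsub>S\<^esub>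
      sh1 S (lam (ys @ zs) ?X \<bullet> (lam ys ?Z \<star> bid B ?X)) \<diamondop>\<^bsub>S\<^esub> srot S ?X (?Y \<odot> ?Z) \<diamondop>\<^bsub>S\<^esub> sh1 S (bassoc B ?X ?Y ?Z)"
    using t c1 c2 by (simp add: sh1_vc)
  also have "\<dots> = (rho ys (zs @ xs) (vs ys (vs zs A)) \<diamondop>\<^bsub>S\<^esub> sh1 S (lam ys ?ZX)) \<diamondop>\<^bsub>S\<^esub>
      sh1 S (bid B ?Y \<star> lam zs ?X) \<diamondop>\<^bsub>S\<^esub> sh1 S (bassoc B ?Y ?Z ?X) \<diamondop>\<^bsub>S\<^esub>
      srot S ?X (?Y \<odot> ?Z) \<diamondop>\<^bsub>S\<^esub> sh1 S (bassoc B ?X ?Y ?Z)"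
    using t c1 c2 by (simp add: 2 sh1_vc)
  also have "rho ys (zs @ xs) (vs ys (vs zs A)) \<diamondop>\<^bsub>S\<^esub> sh1 S (lam ys ?ZX) =
      sh1 S (lam (zs @ xs) ?Y) \<diamondop>\<^bsub>S\<^esub> srot S ?Y ?ZX"
    using rho_lam[OF c2] t by simp
  also have "(sh1 S (lam (zs @ xs) ?Y) \<diamondop>\<^bsub>S\<^esub> srot S ?Y ?ZX) \<diamondop>\<^bsub>S\<^esub>
      sh1 S (bid B ?Y \<star> lam zs ?X) \<diamondop>\<^bsub>S\<^esub> sh1 S (bassoc B ?Y ?Z ?X) \<diamondop>\<^bsub>S\<^esub>
      srot S ?X (?Y \<odot> ?Z) \<diamondop>\<^bsub>S\<^esub> sh1 S (bassoc B ?X ?Y ?Z)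
    = sh1 S (lam (zs @ xs) ?Y) \<diamondop>\<^bsub>S\<^esub> sh1 S (lam zs ?X \<star> bid B ?Y) \<diamondop>\<^bsub>S\<^esub> srot S ?Y (?Z \<odot> ?X) \<diamondop>\<^bsub>S\<^esub>
      sh1 S (bassoc B ?Y ?Z ?X) \<diamondop>\<^bsub>S\<^esub> srot S ?X (?Y \<odot> ?Z) \<diamondop>\<^bsub>S\<^esub> sh1 S (bassoc B ?X ?Y ?Z)"
    using t c1 c2 sc_chain[OF rot_nat[of "bid B ?Y" "lam zs ?X"], where k = "sh1 S (bassoc B ?Y ?Z ?X) \<diamondop>\<^bsub>S\<^esub>
      srot S ?X (?Y \<odot> ?Z) \<diamondop>\<^bsub>S\<^esub> sh1 S (bassoc B ?X ?Y ?Z)"]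
    by simp
  \<comment> \<open>The hexagon shortens the tail to a composite whose last rotator is
    \<open>srot S (?Z \<odot> ?X) ?Y\<close>; it cancels against
    \<open>srot S ?Y (?Z \<odot> ?X)\<close>.\<close>
  also have "\<dots> = sh1 S (lam (zs @ xs) ?Y) \<diamondop>\<^bsub>S\<^esub> sh1 S (lam zs ?X \<star> bid B ?Y) \<diamondop>\<^bsub>S\<^esub>
      sh1 S (inv2 B (bassoc B ?Z ?X ?Y)) \<diamondop>\<^bsub>S\<^esub> srot S (?X \<odot> ?Y) ?Z"
    using t hexagon[of ?X ?Y ?Z] sc_chain[OF rot_rot[of "?Z \<odot> ?X" ?Y],
       where k="sh1 S (inv2 B (bassoc B ?Z ?X ?Y)) \<diamondop>\<^bsub>S\<^esub> srot S (?X \<odot> ?Y) ?Z"]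
    by (simp flip: hexagon)
  also have "\<dots> = sh1 S ((lam (zs @ xs) ?Y \<bullet> (lam zs ?X \<star> bid B ?Y)) \<bullet> inv2 B (bassoc B ?Z ?X ?Y)) \<diamondop>\<^bsub>S\<^esub>
      srot S (?X \<odot> ?Y) ?Z"
    using t by (simp add: sh1_vc)
  also have "\<dots> = sh1 S (lam zs ?XY) \<diamondop>\<^bsub>S\<^esub> sh1 S (bid B ?Z \<star> lam xs ?Y) \<diamondop>\<^bsub>S\<^esub> srot S (?X \<odot> ?Y) ?Z"
    unfolding 3 using t by (simp add: sh1_vc)
  also have "\<dots> = (sh1 S (lam zs ?XY) \<diamondop>\<^bsub>S\<^esub> srot S ?XY ?Z) \<diamondop>\<^bsub>S\<^esub> sh1 S (lam xs ?Y \<star> bid B ?Z)"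
    using t rot_nat[of "lam xs ?Y" "bid B ?Z"] by simp
  finally have *: "(?R \<diamondop>\<^bsub>S\<^esub> sh1 S (lam (xs @ ys) ?Z)) \<diamondop>\<^bsub>S\<^esub> sh1 S (lam xs ?Y \<star> bid B ?Z) = 
    (sh1 S (lam zs ?XY) \<diamondop>\<^bsub>S\<^esub> srot S ?XY ?Z) \<diamondop>\<^bsub>S\<^esub> sh1 S (lam xs ?Y \<star> bid B ?Z)"
    using t c1 c2 by simp
  have "?R \<diamondop>\<^bsub>S\<^esub> sh1 S (lam (xs @ ys) ?Z) = sh1 S (lam zs ?XY) \<diamondop>\<^bsub>S\<^esub> srot S ?XY ?Z"
    by (rule sh1_iso_cancel_right[OF *]) (use t c1 c2 in auto)
  then show "(rho ys (zs @ xs) (vs (ys @ zs) A) \<diamondop>\<^bsub>S\<^esub> rho xs (ys @ zs) A) \<diamondop>\<^bsub>S\<^esub> sh1 S (lam (xs @ ys) (nf zs A)) =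
    sh1 S (lam zs (nf (xs @ ys) (vs zs A))) \<diamondop>\<^bsub>S\<^esub> srot S (nf (xs @ ys) (vs zs A)) (nf zs A)"
    by simp
qed (use assms in \<open>auto simp: cyc_def\<close>)

text \<open>Two successive rotations compose to one; the two cases are whether the second cut
  lies before or after the image of the starting point.\<close>

lemma rho_comp_short:
  assumes "cyc (xs @ ys @ zs) A"
  shows "rho ys (zs @ xs) (vs (ys @ zs) A) \<diamondop>\<^bsub>S\<^esub> rho xs (ys @ zs) A = rho (xs @ ys) zs A"
  using rho_append[OF assms] by simp

lemma rho_comp_long:
  assumes c: "cyc (xs @ ys @ zs) A"
  shows "rho (zs @ xs) ys (vs zs A) \<diamondop>\<^bsub>S\<^esub> rho (xs @ ys) zs A = rho xs (ys @ zs) A"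
proof -
  have c2: "cyc (zs @ xs @ ys) (vs zs A)" and c3: "cyc ((xs @ ys) @ zs) A"
     and c1: "cyc (xs @ (ys @ zs)) A" using c by (auto simp: cyc_def)
  have v: "vs xs (vs ys (vs zs A)) = A" using c by (simp add: cyc_def)
  \<comment> \<open>This is \<open>rho_append\<close> for the rotated triple \<open>zs\<close>,
    \<open>xs\<close>, \<open>ys\<close>; the turn performed first undoes
    \<open>rho (xs @ ys) zs A\<close>.\<close>
  have "rho (zs @ xs) ys (vs zs A) =
    rho xs (ys @ zs) A \<diamondop>\<^bsub>S\<^esub> rho zs (xs @ ys) (vs zs A)"
    using rho_append[OF c2] v by simp
  then show ?thesis using rho_rho[OF c3] c1 c2 c3 v by simp
qed

end

\<comment> \<open>Typing rules are stated for \<open>map G (map concat bss)\<close>, which must not be fused.\<close>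
declare map_map [simp del]

context bicategory
begin

subsection \<open>Coherence for words in a bicategory\<close>

text \<open>\<open>lam_append\<close> with arbitrary 2-cells into the three normal forms. The
  associator cases for words of letters and for words of \<Phi>-factors are both instances.\<close>

lemma lam_assoc:
  assumes "chn (xs @ ys @ zs) A"
    and "bcod B \<alpha> = nf xs (vs (ys @ zs) A)" "bcod B \<beta> = nf ys (vs zs A)" "bcod B \<gamma> = nf zs A"
  shows "(lam xs (nf (ys @ zs) A) \<bullet> (\<alpha> \<star> (lam ys (nf zs A) \<bullet> (\<beta> \<star> \<gamma>)))) \<bullet>
      bassoc B (bdom B \<alpha>) (bdom B \<beta>) (bdom B \<gamma>) =
    lam (xs @ ys) (nf zs A) \<bullet> ((lam xs (nf ys (vs zs A)) \<bullet> (\<alpha> \<star> \<beta>)) \<star> \<gamma>)"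
proof -
  have t: "bsrc B (bdom B \<alpha>) = vs xs (vs ys (vs zs A))" "btgt B (bdom B \<alpha>) = vs ys (vs zs A)"
     "bsrc B (bdom B \<beta>) = vs ys (vs zs A)" "btgt B (bdom B \<beta>) = vs zs A"
     "bsrc B (bdom B \<gamma>) = vs zs A" "btgt B (bdom B \<gamma>) = A"
    using assms src_cod[of \<alpha>] tgt_cod[of \<alpha>] src_cod[of \<beta>] tgt_cod[of \<beta>] src_cod[of \<gamma>] tgt_cod[of \<gamma>]
    by (simp_all del: src_cod tgt_cod)
  let ?X = "nf xs (vs ys (vs zs A))" and ?Y = "nf ys (vs zs A)" and ?Z = "nf zs A"
  have c: "chn xs (vs ys (vs zs A))" "chn ys (vs zs A)" "chn zs A" using assms by auto
  have "lam (xs @ ys) ?Z \<bullet> ((lam xs ?Y \<bullet> (\<alpha> \<star> \<beta>)) \<star> \<gamma>)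
    = (lam (xs @ ys) ?Z \<bullet> (lam xs ?Y \<star> bid B ?Z)) \<bullet> ((\<alpha> \<star> \<beta>) \<star> \<gamma>)"
    using assms t c by simp
  also have "\<dots> = lam xs (ap ys ?Z) \<bullet> (bid B ?X \<star> lam ys ?Z) \<bullet> bassoc B ?X ?Y ?Z \<bullet> ((\<alpha> \<star> \<beta>) \<star> \<gamma>)"
    using lam_append[of xs ys ?Z] assms t c by simp
  also have "\<dots> = lam xs (ap ys ?Z) \<bullet> (bid B ?X \<star> lam ys ?Z) \<bullet> (\<alpha> \<star> (\<beta> \<star> \<gamma>)) \<bullet>
      bassoc B (bdom B \<alpha>) (bdom B \<beta>) (bdom B \<gamma>)"
    using as_nat[of \<alpha> \<beta> \<gamma>] assms t by simp
  finally show ?thesis using assms t c by simp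
qed

text \<open>Reduces the case of an inverse associator or unitor to that of the cell itself.\<close>

lemma inv2_move:
  assumes "n' \<bullet> f = n" "is_iso2 B f" "bdom B n' = bcod B f"
  shows "n \<bullet> inv2 B f = n'"
  using assms(2,3) by (simp flip: assms(1))

text \<open>Every normal form ends in a unit, so a single edge must first acquire one; hence the
  inverse right unitor.\<close>

primrec nrm :: "('o,'c) fw \<Rightarrow> 'm" where
  "nrm (FE M) = inv2 B (bru B M)"
| "nrm (FU A) = bid B (bunit B A)"
| "nrm (FC u v) = lam (fletters u) (nf (fletters v) (ftgt B v)) \<bullet> (nrm u \<star> nrm v)"

lemma fletters_chn [simp]: "\<lbrakk>fwf B w; ftgt B w = A\<rbrakk> \<Longrightarrow> chn (fletters w) A"
  and vs_fletters [simp]: "\<lbrakk>fwf B w; ftgt B w = A\<rbrakk> \<Longrightarrow> vs (fletters w) A = fsrc B w"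
proof -
  have "fwf B w \<Longrightarrow> chn (fletters w) (ftgt B w) \<and> vs (fletters w) (ftgt B w) = fsrc B w"
    by (induction w) auto
  then show "\<lbrakk>fwf B w; ftgt B w = A\<rbrakk> \<Longrightarrow> chn (fletters w) A"
    "\<lbrakk>fwf B w; ftgt B w = A\<rbrakk> \<Longrightarrow> vs (fletters w) A = fsrc B w" by auto
qed

lemma fev_type: "fwf B w \<Longrightarrow> bsrc B (fev B w) = fsrc B w \<and> btgt B (fev B w) = ftgt B w"
  by (induction w) auto

lemma src_fev [simp]: "fwf B w \<Longrightarrow> bsrc B (fev B w) = fsrc B w"
  and tgt_fev [simp]: "fwf B w \<Longrightarrow> btgt B (fev B w) = ftgt B w"
  by (simp_all add: fev_type)

lemma nrm_type: "fwf B w \<Longrightarrow> bdom B (nrm w) = fev B w \<and>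
    bcod B (nrm w) = nf (fletters w) (ftgt B w) \<and> is_iso2 B (nrm w)"
  by (induction w) auto

lemma dom_nrm [simp]: "fwf B w \<Longrightarrow> bdom B (nrm w) = fev B w"
  and cod_nrm [simp]: "fwf B w \<Longrightarrow> bcod B (nrm w) = nf (fletters w) (ftgt B w)"
  and iso_nrm [simp]: "fwf B w \<Longrightarrow> is_iso2 B (nrm w)"
  by (simp_all add: nrm_type)

lemma f2_wf: "f2wf B f \<Longrightarrow> fwf B (fdom B f) \<and> fwf B (fcod B f) \<and>
    fsrc B (fcod B f) = fsrc B (fdom B f) \<and> ftgt B (fcod B f) = ftgt B (fdom B f) \<and>
    fletters (fcod B f) = fletters (fdom B f)"
  by (induction f) auto

lemma fwf_fdom [simp]: "f2wf B f \<Longrightarrow> fwf B (fdom B f)"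
  and fwf_fcod [simp]: "f2wf B f \<Longrightarrow> fwf B (fcod B f)"
  and fsrc_fcod [simp]: "f2wf B f \<Longrightarrow> fsrc B (fcod B f) = fsrc B (fdom B f)"
  and ftgt_fcod [simp]: "f2wf B f \<Longrightarrow> ftgt B (fcod B f) = ftgt B (fdom B f)"
  and fletters_fcod [simp]: "f2wf B f \<Longrightarrow> fletters (fcod B f) = fletters (fdom B f)"
  using f2_wf by blast+

lemma f2ev_type: "f2wf B f \<Longrightarrow> bdom B (f2ev B f) = fev B (fdom B f) \<and> bcod B (f2ev B f) = fev B (fcod B f)"
  by (induction f) auto

lemma dom_f2ev [simp]: "f2wf B f \<Longrightarrow> bdom B (f2ev B f) = fev B (fdom B f)"
  and cod_f2ev [simp]: "f2wf B f \<Longrightarrow> bcod B (f2ev B f) = fev B (fcod B f)"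
  by (simp_all add: f2ev_type)

lemma nrm_FAs:
  assumes "f2wf B (FAs u v w)"
  shows "nrm (FC u (FC v w)) \<bullet> bassoc B (fev B u) (fev B v) (fev B w) = nrm (FC (FC u v) w)"
  using lam_assoc[of "fletters u" "fletters v" "fletters w" "ftgt B w" "nrm u" "nrm v" "nrm w"] assms
  by simp

lemma nrm_FLu:
  assumes "fwf B w"
  shows "nrm w \<bullet> blu B (fev B w) = nrm (FC (FU (fsrc B w)) w)"
  using lu_nat[of "nrm w"] assms by simp

lemma nrm_FRu:
  assumes "fwf B w"
  shows "nrm w \<bullet> bru B (fev B w) = nrm (FC w (FU (ftgt B w)))"
  using ru_nat[of "nrm w"] assms by (simp add: lam_unit)

text \<open>Coherence for bicategories: 2-cells of the free bicategory change only brackets and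
  units, never letters, so they normalize to identities. As \<open>nrm\<close> is invertible, their
  values depend only on their two ends.\<close>

lemma nrm_f2: "f2wf B f \<Longrightarrow> nrm (fcod B f) \<bullet> f2ev B f = nrm (fdom B f)"
proof (induction f)
  case (FAs u v w)
  then show ?case using nrm_FAs by simp
next
  case (FAsI u v w)
  then show ?case using inv2_move[OF nrm_FAs[of u v w]] by simp
next
  case (FLu w)
  then show ?case using nrm_FLu by simp
next
  case (FLuI w)
  then show ?case using inv2_move[OF nrm_FLu[of w]] by simp
next
  case (FRu w)
  then show ?case using nrm_FRu by simp
next
  case (FRuI w)
  then show ?case using inv2_move[OF nrm_FRu[of w]] by simp
next
  case (FV g f)
  then show ?case using vc_chain[of "nrm (fcod B g)" "f2ev B g" "nrm (fdom B g)" "f2ev B f"] by simp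
next
  case (FH f g)
  then show ?case by simp
qed simp

end

section \<open>Normal lax functors\<close>

locale normal_lax = D: bicategory D + C: bicategory C
  for D :: "('f,'g,'h) bicat" (structure) and C :: "('a,'b,'c) bicat" +
  fixes F :: "('a,'b,'c,'f,'g,'h) laxf"
  assumes lax: "lax_functor C D F" and normal: "is_iso2 D (lfi F A)"
begin

lemmas loc = lax[unfolded lax_functor_def, THEN conjunct1, unfolded local_functor_part_def]
lemmas laxs = lax[unfolded lax_functor_def, THEN conjunct2]

lemma src_lf [simp]: "bsrc D (lf1 F M) = lf0 F (bsrc C M)"
  and tgt_lf [simp]: "btgt D (lf1 F M) = lf0 F (btgt C M)"
  and dom_lf [simp]: "bdom D (lf2 F f) = lf1 F (bdom C f)"
  and cod_lf [simp]: "bcod D (lf2 F f) = lf1 F (bcod C f)"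
  and lf_id [simp]: "lf2 F (bid C M) = bid D (lf1 F M)"
  and lf_vc: "bcod C f = bdom C g \<Longrightarrow> lf2 F (g \<bullet>\<^bsub>C\<^esub> f) = lf2 F g \<bullet> lf2 F f"
  using loc by meson+

lemma dom_lfm [simp]: "btgt C M = bsrc C N \<Longrightarrow> bdom D (lfm F M N) = lf1 F M \<odot> lf1 F N"
  and cod_lfm [simp]: "btgt C M = bsrc C N \<Longrightarrow> bcod D (lfm F M N) = lf1 F (M \<odot>\<^bsub>C\<^esub> N)"
  and dom_lfi [simp]: "bdom D (lfi F A) = bunit D (lf0 F A)"
  and cod_lfi [simp]: "bcod D (lfi F A) = lf1 F (bunit C A)"
  and lfm_nat: "btgt C (bdom C f) = bsrc C (bdom C g) \<Longrightarrow>
    lf2 F (f \<star>\<^bsub>C\<^esub> g) \<bullet> lfm F (bdom C f) (bdom C g) =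
    lfm F (bcod C f) (bcod C g) \<bullet> (lf2 F f \<star> lf2 F g)"
  and lfm_assoc: "\<lbrakk>btgt C M = bsrc C N; btgt C N = bsrc C P\<rbrakk> \<Longrightarrow>
    lf2 F (bassoc C M N P) \<bullet> lfm F (M \<odot>\<^bsub>C\<^esub> N) P \<bullet> (lfm F M N \<star> bid D (lf1 F P)) =
    lfm F M (N \<odot>\<^bsub>C\<^esub> P) \<bullet> (bid D (lf1 F M) \<star> lfm F N P) \<bullet> bassoc D (lf1 F M) (lf1 F N) (lf1 F P)"
  and lfm_lu: "lf2 F (blu C M) \<bullet> lfm F (bunit C (bsrc C M)) M \<bullet> (lfi F (bsrc C M) \<star> bid D (lf1 F M)) =
    blu D (lf1 F M)"
  and lfm_ru: "lf2 F (bru C M) \<bullet> lfm F M (bunit C (btgt C M)) \<bullet> (bid D (lf1 F M) \<star> lfi F (btgt C M)) =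
    bru D (lf1 F M)"
  using laxs by meson+

declare normal [simp]

lemma lf_iso [simp]: "is_iso2 C f \<Longrightarrow> is_iso2 D (lf2 F f)"
  by (rule D.iso2I[of "lf2 F (inv2 C f)"]) (auto simp flip: lf_vc)

lemma lf_inv: "is_iso2 C f \<Longrightarrow> lf2 F (inv2 C f) = inv2 D (lf2 F f)"
  by (rule D.inv2_eq[symmetric]) (auto simp flip: lf_vc)

subsection \<open>The graded monoid of images of normal forms\<close>

definition mm :: "'b list \<Rightarrow> 'b list \<Rightarrow> 'a \<Rightarrow> 'h" where
  "mm b c A = lf2 F (C.lam b (C.nf c A)) \<bullet> lfm F (C.nf b (C.vs c A)) (C.nf c A)"

lemma dom_mm [simp]: "C.chn (b @ c) A \<Longrightarrow>
    bdom D (mm b c A) = lf1 F (C.nf b (C.vs c A)) \<odot> lf1 F (C.nf c A)"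
  and cod_mm [simp]: "C.chn (b @ c) A \<Longrightarrow> bcod D (mm b c A) = lf1 F (C.nf (b @ c) A)"
  by (simp_all add: mm_def)

text \<open>Associativity of the lax comparison, transported to normal forms: naturality of
  \<open>lfm\<close> moves the images of \<open>lam\<close> outwards, where
  \<open>lam_append\<close> in \<open>C\<close> compares them.\<close>

lemma mm_assoc:
  assumes "C.chn (a @ b @ c) A"
  shows "mm (a @ b) c A \<bullet> (mm a b (C.vs c A) \<star> bid D (lf1 F (C.nf c A))) =
    mm a (b @ c) A \<bullet> (bid D (lf1 F (C.nf a (C.vs (b @ c) A))) \<star> mm b c A) \<bullet>
    bassoc D (lf1 F (C.nf a (C.vs (b @ c) A))) (lf1 F (C.nf b (C.vs c A))) (lf1 F (C.nf c A))"
proof -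
  let ?a = "C.nf a (C.vs b (C.vs c A))" and ?b = "C.nf b (C.vs c A)" and ?c = "C.nf c A"
  let ?FC = "bid D (lf1 F ?c)" and ?FA = "bid D (lf1 F ?a)"
  let ?as = "bassoc D (lf1 F ?a) (lf1 F ?b) (lf1 F ?c)"
  have t: "C.chn a (C.vs b (C.vs c A))" "C.chn b (C.vs c A)" "C.chn c A" using assms by auto
  have "mm (a @ b) c A \<bullet> (mm a b (C.vs c A) \<star> ?FC) =
    lf2 F (C.lam (a @ b) ?c) \<bullet> lfm F (C.ap a ?b) ?c \<bullet> (lf2 F (C.lam a ?b) \<star> lf2 F (bid C ?c)) \<bullet>
    (lfm F ?a ?b \<star> ?FC)"
    using t by (simp add: mm_def)
  also have "\<dots> = lf2 F (C.lam (a @ b) ?c) \<bullet> lf2 F (C.lam a ?b \<star>\<^bsub>C\<^esub> bid C ?c) \<bullet>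
     lfm F (?a \<odot>\<^bsub>C\<^esub> ?b) ?c \<bullet> (lfm F ?a ?b \<star> ?FC)"
    using D.vc_chain[OF lfm_nat[symmetric, of "C.lam a ?b" "bid C ?c"],
       where k = "lfm F ?a ?b \<star> ?FC"] t by simp
  also have "\<dots> = lf2 F (C.lam (a @ b) ?c \<bullet>\<^bsub>C\<^esub> (C.lam a ?b \<star>\<^bsub>C\<^esub> bid C ?c)) \<bullet>
     lfm F (?a \<odot>\<^bsub>C\<^esub> ?b) ?c \<bullet> (lfm F ?a ?b \<star> ?FC)"
    using t by (simp add: lf_vc)
  also have "\<dots> = lf2 F (C.lam a (C.ap b ?c)) \<bullet> lf2 F (bid C ?a \<star>\<^bsub>C\<^esub> C.lam b ?c) \<bullet>
     lf2 F (bassoc C ?a ?b ?c) \<bullet> lfm F (?a \<odot>\<^bsub>C\<^esub> ?b) ?c \<bullet> (lfm F ?a ?b \<star> ?FC)"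
    using C.lam_append[of a b ?c] t by (simp add: lf_vc)
  also have "\<dots> = lf2 F (C.lam a (C.ap b ?c)) \<bullet> lf2 F (bid C ?a \<star>\<^bsub>C\<^esub> C.lam b ?c) \<bullet>
     lfm F ?a (?b \<odot>\<^bsub>C\<^esub> ?c) \<bullet> (?FA \<star> lfm F ?b ?c) \<bullet> ?as"
    using lfm_assoc[of ?a ?b ?c] t by simp
  also have "\<dots> = lf2 F (C.lam a (C.ap b ?c)) \<bullet> lfm F ?a (C.ap b ?c) \<bullet>
     (?FA \<star> lf2 F (C.lam b ?c)) \<bullet> (?FA \<star> lfm F ?b ?c) \<bullet> ?as"
    using D.vc_chain[OF lfm_nat[of "bid C ?a" "C.lam b ?c"], where k = "(?FA \<star> lfm F ?b ?c) \<bullet> ?as"] t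
    by simp
  finally show ?thesis using t by (simp add: mm_def)
qed

lemma mm_unit_left: "C.chn b A \<Longrightarrow>
    mm [] b A \<bullet> (lfi F (C.vs b A) \<star> bid D (lf1 F (C.nf b A))) = blu D (lf1 F (C.nf b A))"
  using lfm_lu[of "C.nf b A"] by (simp add: mm_def)

lemma mm_unit_right: "C.chn b A \<Longrightarrow>
    mm b [] A \<bullet> (bid D (lf1 F (C.nf b A)) \<star> lfi F A) = bru D (lf1 F (C.nf b A))"
  using lfm_ru[of "C.nf b A"] by (simp add: mm_def C.lam_unit)

subsection \<open>Lists of blocks\<close>

text \<open>The end point of a block is read off its last letter, so \<open>G b\<close> is meaningful only for \<open>b \<noteq> []\<close>.\<close>

definition G :: "'b list \<Rightarrow> 'g" where
  "G b = lf1 F (C.nf b (btgt C (last b)))"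

definition bok :: "'b list list \<Rightarrow> 'a \<Rightarrow> bool" where
  "bok bs A \<longleftrightarrow> [] \<notin> set bs \<and> C.chn (concat bs) A"

abbreviation nb :: "'b list list \<Rightarrow> 'a \<Rightarrow> 'g" where
  "nb bs A \<equiv> D.nf (map G bs) (lf0 F A)"

lemma bok_append [simp]: "bok (bs @ cs) A \<longleftrightarrow> bok bs (C.vs (concat cs) A) \<and> bok cs A"
  by (auto simp: bok_def)

lemma bok_Cons [simp]: "bok (b # cs) A \<longleftrightarrow> b \<noteq> [] \<and> C.chn b (C.vs (concat cs) A) \<and> bok cs A"
  by (auto simp: bok_def)

lemma bok_Nil [simp]: "bok [] A"
  by (simp add: bok_def)

lemma bok_chn [simp]: "bok bs A \<Longrightarrow> C.chn (concat bs) A"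
  by (simp add: bok_def)

lemma G_eq: "\<lbrakk>C.chn b A; b \<noteq> []\<rbrakk> \<Longrightarrow> G b = lf1 F (C.nf b A)"
  by (simp add: G_def C.btgt_last)

lemma chn_G [simp]: "bok bs A \<Longrightarrow> D.chn (map G bs) (lf0 F A)"
  and vs_G [simp]: "bok bs A \<Longrightarrow> D.vs (map G bs) (lf0 F A) = lf0 F (C.vs (concat bs) A)"
proof -
  have "bok bs A \<Longrightarrow> D.chn (map G bs) (lf0 F A) \<and>
      D.vs (map G bs) (lf0 F A) = lf0 F (C.vs (concat bs) A)"
    by (induction bs) (auto simp: G_eq)
  then show "bok bs A \<Longrightarrow> D.chn (map G bs) (lf0 F A)"
    "bok bs A \<Longrightarrow> D.vs (map G bs) (lf0 F A) = lf0 F (C.vs (concat bs) A)" by auto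
qed

text \<open>The word \<open>nb\<close> ends in a unit, which \<open>lfi\<close> absorbs. Hence
  \<open>mu [b] A\<close> is a right unitor rather than an identity.\<close>

primrec mu :: "'b list list \<Rightarrow> 'a \<Rightarrow> 'h" where
  "mu [] A = lfi F A"
| "mu (b # bs) A = mm b (concat bs) A \<bullet> (bid D (lf1 F (C.nf b (C.vs (concat bs) A))) \<star> mu bs A)"

lemma mu_type: "bok bs A \<Longrightarrow> bdom D (mu bs A) = nb bs A \<and> bcod D (mu bs A) = lf1 F (C.nf (concat bs) A)"
  by (induction bs) (auto simp: G_eq)

lemma dom_mu [simp]: "bok bs A \<Longrightarrow> bdom D (mu bs A) = nb bs A"
  and cod_mu [simp]: "bok bs A \<Longrightarrow> bcod D (mu bs A) = lf1 F (C.nf (concat bs) A)"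
  by (simp_all add: mu_type)

lemma mu_single: "C.chn b A \<Longrightarrow> mu [b] A = bru D (lf1 F (C.nf b A))"
  by (simp add: mm_unit_right)

text \<open>General associativity in the graded monoid, by induction on \<open>bs\<close>: the left
  unit law is the empty case and \<open>mm_assoc\<close> the step.\<close>

lemma mu_append: "bok (bs @ cs) A \<Longrightarrow>
    mu (bs @ cs) A \<bullet> D.lam (map G bs) (nb cs A) =
    mm (concat bs) (concat cs) A \<bullet> (mu bs (C.vs (concat cs) A) \<star> mu cs A)"
proof (induction bs)
  case Nil
  let ?c = "C.nf (concat cs) A" and ?v = "C.vs (concat cs) A"
  have "mm [] (concat cs) A \<bullet> (lfi F ?v \<star> mu cs A) =
    (mm [] (concat cs) A \<bullet> (lfi F ?v \<star> bid D (lf1 F ?c))) \<bullet> (bid D (bunit D (lf0 F ?v)) \<star> mu cs A)"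
    using Nil by simp
  also have "\<dots> = mu cs A \<bullet> blu D (nb cs A)"
    by (subst mm_unit_left) (use Nil D.lu_nat[of "mu cs A"] in auto)
  finally show ?case by simp
next
  case (Cons b bs)
  let ?v = "C.vs (concat cs) A" let ?u = "C.vs (concat bs) ?v"
  let ?X = "lf1 F (C.nf b ?u)" and ?Y = "lf1 F (C.nf (concat bs) ?v)" and ?Z = "lf1 F (C.nf (concat cs) A)"
  have t: "b \<noteq> []" "C.chn b ?u" "bok bs ?v" "bok cs A" using Cons.prems by auto
  note G = G_eq[OF t(2,1)]
  let ?as = "bassoc D ?X (nb bs ?v) (nb cs A)"
  have "mu ((b # bs) @ cs) A \<bullet> D.lam (map G (b # bs)) (nb cs A) =
     mm b (concat bs @ concat cs) A \<bullet> (bid D ?X \<star> (mu (bs @ cs) A \<bullet> D.lam (map G bs) (nb cs A))) \<bullet> ?as"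
    using t by (simp add: G)
  also have "\<dots> = mm b (concat bs @ concat cs) A \<bullet> (bid D ?X \<star> mm (concat bs) (concat cs) A) \<bullet>
      (bid D ?X \<star> (mu bs ?v \<star> mu cs A)) \<bullet> ?as"
    using t Cons.IH by simp
  also have "\<dots> = (mm b (concat bs @ concat cs) A \<bullet> (bid D ?X \<star> mm (concat bs) (concat cs) A) \<bullet>
     bassoc D ?X ?Y ?Z) \<bullet> ((bid D ?X \<star> mu bs ?v) \<star> mu cs A)"
    using t D.as_nat[of "bid D ?X" "mu bs ?v" "mu cs A"] by simp
  also have "\<dots> = (mm (b @ concat bs) (concat cs) A \<bullet> (mm b (concat bs) ?v \<star> bid D ?Z)) \<bullet>
      ((bid D ?X \<star> mu bs ?v) \<star> mu cs A)"
    using t mm_assoc[of b "concat bs" "concat cs" A] by simp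
  also have "\<dots> = mm (concat (b # bs)) (concat cs) A \<bullet> (mu (b # bs) ?v \<star> mu cs A)"
    using t by simp
  finally show ?case .
qed

subsection \<open>Blockwise multiplication\<close>

text \<open>The outer list groups consecutive blocks, and each group is multiplied by
  \<open>mu\<close>. The source is built from the flat list \<open>concat bss\<close>, so the
  inverse of \<open>lam\<close> must split off the first group.\<close>

primrec pm :: "'b list list list \<Rightarrow> 'a \<Rightarrow> 'h" where
  "pm [] A = bid D (bunit D (lf0 F A))"
| "pm (bs # bss) A = (mu bs (C.vs (concat (concat bss)) A) \<star> pm bss A) \<bullet>
     inv2 D (D.lam (map G bs) (nb (concat bss) A))"

text \<open>An empty group would create an empty block in \<open>map concat bss\<close>.\<close>

definition pok :: "'b list list list \<Rightarrow> 'a \<Rightarrow> bool" where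
  "pok bss A \<longleftrightarrow> [] \<notin> set bss \<and> bok (concat bss) A"

lemma concat_map_concat [simp]: "concat (map concat xs) = concat (concat xs)"
  by (induction xs) auto

lemma pok_append [simp]: "pok (bss @ css) A \<longleftrightarrow> pok bss (C.vs (concat (concat css)) A) \<and> pok css A"
  by (auto simp: pok_def)

lemma pok_Cons [simp]:
  "pok (bs # css) A \<longleftrightarrow> bs \<noteq> [] \<and> bok bs (C.vs (concat (concat css)) A) \<and> pok css A"
  by (auto simp: pok_def)

lemma pok_Nil [simp]: "pok [] A"
  by (simp add: pok_def)

lemma pok_bok [simp]: "pok bss A \<Longrightarrow> bok (concat bss) A"
  by (simp add: pok_def)

lemma concat_nonempty: "\<lbrakk>bok bs A; bs \<noteq> []\<rbrakk> \<Longrightarrow> concat bs \<noteq> []"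
  by (cases bs) auto

lemma pok_bok_concat [simp]: "pok bss A \<Longrightarrow> bok (map concat bss) A"
proof (induction bss)
  case (Cons bs bss)
  then show ?case using concat_nonempty[of bs] by auto
qed simp

lemma pm_type: "pok bss A \<Longrightarrow> bdom D (pm bss A) = nb (concat bss) A \<and> bcod D (pm bss A) = nb (map concat bss) A"
proof (induction bss)
  case (Cons bs bss)
  then show ?case using G_eq[of "concat bs" "C.vs (concat (concat bss)) A"] concat_nonempty[of bs] by auto
qed simp

lemma dom_pm [simp]: "pok bss A \<Longrightarrow> bdom D (pm bss A) = nb (concat bss) A"
  and cod_pm [simp]: "pok bss A \<Longrightarrow> bcod D (pm bss A) = nb (map concat bss) A"
  by (simp_all add: pm_type)

lemma pm_Cons_lam: "pok (bs # bss) A \<Longrightarrow>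
    pm (bs # bss) A \<bullet> D.lam (map G bs) (nb (concat bss) A) =
    mu bs (C.vs (concat (concat bss)) A) \<star> pm bss A"
  by simp

text \<open>Tested after the invertible \<open>lam\<close> that splits off the first group, this is
  \<open>mu_append\<close> together with the induction hypothesis.\<close>

lemma mu_pm: "pok bss A \<Longrightarrow> mu (map concat bss) A \<bullet> pm bss A = mu (concat bss) A"
proof (induction bss)
  case (Cons bs bss)
  let ?v = "C.vs (concat (concat bss)) A"
  have t: "bs \<noteq> []" "bok bs ?v" "pok bss A" using Cons.prems by auto
  have G: "G (concat bs) = lf1 F (C.nf (concat bs) ?v)"
    using G_eq concat_nonempty[OF t(2,1)] t by simp
  show ?case
  proof (rule D.iso_cancel_right[of "D.lam (map G bs) (nb (concat bss) A)"])
    have "(mu (map concat (bs # bss)) A \<bullet> pm (bs # bss) A) \<bullet> D.lam (map G bs) (nb (concat bss) A)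
      = mu (map concat (bs # bss)) A \<bullet> (mu bs ?v \<star> pm bss A)"
      using t concat_nonempty[OF t(2,1)] by (simp add: G)
    also have "\<dots> = mm (concat bs) (concat (concat bss)) A \<bullet> (mu bs ?v \<star> (mu (map concat bss) A \<bullet> pm bss A))"
      using t by (simp add: G)
    also have "\<dots> = mu (concat (bs # bss)) A \<bullet> D.lam (map G bs) (nb (concat bss) A)"
      using t Cons.IH mu_append[of bs "concat bss" A] by simp
    finally show "(mu (map concat (bs # bss)) A \<bullet> pm (bs # bss) A) \<bullet> D.lam (map G bs) (nb (concat bss) A)
      = mu (concat (bs # bss)) A \<bullet> D.lam (map G bs) (nb (concat bss) A)" .
  qed (use t concat_nonempty[OF t(2,1)] G in auto)
qed simp

text \<open>Lets the groupings of two factors be placed side by side; horizontal composites and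
  rotations both rest on it. The invertible \<open>?L\<close> isolates the first group so that
  \<open>lam_append\<close> applies.\<close>

lemma pm_append: "pok (bss @ css) A \<Longrightarrow>
    pm (bss @ css) A \<bullet> D.lam (map G (concat bss)) (nb (concat css) A) =
    D.lam (map G (map concat bss)) (nb (map concat css) A) \<bullet>
      (pm bss (C.vs (concat (concat css)) A) \<star> pm css A)"
proof (induction bss)
  case Nil
  then show ?case using D.lu_nat[of "pm css A"] by simp
next
  case (Cons bs bss)
  let ?w = "C.vs (concat (concat css)) A"
  let ?v = "C.vs (concat (concat bss)) ?w"
  have t: "bs \<noteq> []" "bok bs ?v" "pok bss ?w" "pok css A" using Cons.prems by auto
  have ne: "concat bs \<noteq> []" using concat_nonempty[OF t(2,1)] .
  have G: "G (concat bs) = lf1 F (C.nf (concat bs) ?v)"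
    using G_eq ne t by simp
  let ?X = "map G bs" and ?Y = "map G (concat bss)" and ?Y' = "map G (map concat bss)"
  let ?Z = "nb (concat css) A" and ?Z' = "nb (map concat css) A"
  let ?NX = "nb bs ?v" and ?NY = "nb (concat bss) ?w" and ?NY' = "nb (map concat bss) ?w"
  let ?L = "D.lam ?X ?NY \<star> bid D ?Z"
  have la: "D.lam (?X @ ?Y) ?Z \<bullet> ?L = D.lam ?X (D.ap ?Y ?Z) \<bullet> (bid D ?NX \<star> D.lam ?Y ?Z) \<bullet> bassoc D ?NX ?NY ?Z"
    using D.lam_append[of ?X ?Y ?Z] t by simp
  have "(pm ((bs # bss) @ css) A \<bullet> D.lam (map G (concat (bs # bss))) ?Z) \<bullet> ?L
     = (pm (bs # bss @ css) A \<bullet> D.lam ?X (D.ap ?Y ?Z)) \<bullet> (bid D ?NX \<star> D.lam ?Y ?Z) \<bullet> bassoc D ?NX ?NY ?Z"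
    using t la ne by (simp del: pm.simps)
  also have "\<dots> = (mu bs ?v \<star> pm (bss @ css) A) \<bullet> (bid D ?NX \<star> D.lam ?Y ?Z) \<bullet> bassoc D ?NX ?NY ?Z"
    using t pm_Cons_lam[of bs "bss @ css" A] by (simp del: pm.simps)
  also have "\<dots> = (mu bs ?v \<star> (D.lam ?Y' ?Z' \<bullet> (pm bss ?w \<star> pm css A))) \<bullet> bassoc D ?NX ?NY ?Z"
    using t Cons.IH by simp
  also have "\<dots> = (bid D (G (concat bs)) \<star> D.lam ?Y' ?Z') \<bullet> (mu bs ?v \<star> (pm bss ?w \<star> pm css A)) \<bullet> bassoc D ?NX ?NY ?Z"
    using t by (simp add: G)
  also have "\<dots> = (bid D (G (concat bs)) \<star> D.lam ?Y' ?Z') \<bullet> bassoc D (G (concat bs)) ?NY' ?Z' \<bullet>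
      ((mu bs ?v \<star> pm bss ?w) \<star> pm css A)"
    using t D.as_nat[of "mu bs ?v" "pm bss ?w" "pm css A"] by (simp add: G)
  also have "\<dots> = D.lam (map G (map concat (bs # bss))) ?Z' \<bullet>
      ((pm (bs # bss) ?w \<bullet> D.lam ?X ?NY) \<star> pm css A)"
    using t by (simp add: G)
  also have "\<dots> = (D.lam (map G (map concat (bs # bss))) ?Z' \<bullet> (pm (bs # bss) ?w \<star> pm css A)) \<bullet> ?L"
    using t ne by (simp add: G)
  finally show ?case
    by (rule D.iso_cancel_right[rotated]) (use t ne G in auto)
qed

text \<open>Here \<open>bsss\<close> is a grouping of groups: inner groups are merged first, then
  the results. At the head the claim is \<open>mu_pm\<close>, on the tail the induction
  hypothesis.\<close>

lemma pm_comp: "\<lbrakk>pok (concat bsss) A; [] \<notin> set bsss\<rbrakk> \<Longrightarrow>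
    pm (map (map concat) bsss) A \<bullet> pm (concat bsss) A = pm (map concat bsss) A"
proof (induction bsss)
  case (Cons X bsss)
  let ?v = "C.vs (concat (concat (concat bsss))) A"
  have t: "X \<noteq> []" "pok X ?v" "pok (concat bsss) A" "[] \<notin> set bsss" using Cons.prems by auto
  have bc: "concat (map (map concat) bsss) = map concat (concat bsss)" by (simp add: map_concat)
  have p1: "pok (map (map concat) bsss) A" using t pok_bok_concat[of "concat bsss" A] by (auto simp: pok_def bc)
  have "\<exists>xs\<in>set x. xs \<noteq> []" if "x \<in> set bsss" for x
    using t that by (cases x) (auto simp: pok_def)
  then have p2: "pok (map concat bsss) A" using t by (fastforce simp: pok_def)
  have X: "concat X \<noteq> []" "bok (concat X) ?v" using t by (cases X; auto simp: pok_def)+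
  let ?w = "C.vs (concat (map concat (concat bsss))) A"
  let ?L = "D.lam (map G (concat X)) (nb (concat (concat bsss)) A)"
  let ?L' = "D.lam (map G (map concat X)) (nb (map concat (concat bsss)) A)"
  show ?case
  proof (rule D.iso_cancel_right[of ?L])
    have "(pm (map (map concat) (X # bsss)) A \<bullet> pm (concat (X # bsss)) A) \<bullet> ?L =
      pm (map concat X # map (map concat) bsss) A \<bullet> pm (X @ concat bsss) A \<bullet> ?L"
      using t p1 X by (simp del: pm.simps add: bc)
    also have "\<dots> = (pm (map concat X # map (map concat) bsss) A \<bullet> ?L') \<bullet> (pm X ?v \<star> pm (concat bsss) A)"
      using t p1 X pm_append[of X "concat bsss" A] by (simp del: pm.simps add: bc)
    also have "pm (map concat X # map (map concat) bsss) A \<bullet> ?L' = mu (map concat X) ?v \<star> pm (map (map concat) bsss) A"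
      using t p1 pm_Cons_lam[of "map concat X" "map (map concat) bsss" A] by (simp del: pm.simps add: bc)
    also have "\<dots> \<bullet> (pm X ?v \<star> pm (concat bsss) A) = mu (concat X) ?v \<star> pm (map concat bsss) A"
      using t p1 Cons.IH by (simp add: mu_pm bc)
    also have "\<dots> = pm (map concat (X # bsss)) A \<bullet> ?L"
      using t p2 X pm_Cons_lam[of "concat X" "map concat bsss" A] by (simp del: pm.simps)
    finally show "(pm (map (map concat) (X # bsss)) A \<bullet> pm (concat (X # bsss)) A) \<bullet> ?L =
      pm (map concat (X # bsss)) A \<bullet> ?L" .
  qed (use t p1 p2 X in \<open>auto simp: bc simp del: pm.simps\<close>)
qed simp

text \<open>\<open>mu [b]\<close> is a right unitor, and the triangle shows that
  \<open>lam [G b]\<close> is that unitor whiskered; so the two cancel.\<close>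

lemma pm_singletons: "bok bs A \<Longrightarrow> pm (map (\<lambda>b. [b]) bs) A = bid D (nb bs A)"
proof (induction bs)
  case (Cons b bs)
  let ?v = "C.vs (concat bs) A"
  have t: "b \<noteq> []" "C.chn b ?v" "bok bs A" using Cons.prems by auto
  have e: "concat (map (\<lambda>b. [b]) bs) = bs" by (induction bs) auto
  have p: "pok (map (\<lambda>b. [b]) (b # bs)) A" using Cons.prems e by (auto simp: pok_def)
  note G = G_eq[OF t(2,1)]
  show ?case
  proof (rule D.iso_cancel_right[of "D.lam [G b] (nb bs A)"])
    show "pm (map (\<lambda>b. [b]) (b # bs)) A \<bullet> D.lam [G b] (nb bs A) =
      bid D (nb (b # bs) A) \<bullet> D.lam [G b] (nb bs A)"
      using p pm_Cons_lam[of "[b]" "map (\<lambda>b. [b]) bs" A] t Cons.IH D.triangle[of "G b" "nb bs A"]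
      by (simp add: e mu_single G del: pm.simps mu.simps)
  qed (use t p in \<open>auto simp: G e simp del: pm.simps\<close>)
qed simp

end

text \<open>A grouping of merged blocks lifts to a grouping of the original groups, which supplies
  the nested grouping for \<open>pm_comp\<close>.\<close>

lemma concat_eq_map: "concat css = map f bss \<Longrightarrow> \<exists>bsss. concat bsss = bss \<and> map (map f) bsss = css"
proof (induction css arbitrary: bss)
  case (Cons cs css)
  then obtain us vs where "bss = us @ vs" "cs = map f us" "concat css = map f vs"
    by (auto simp: append_eq_map_conv)
  with Cons.IH[of vs] obtain bsss where "concat bsss = vs" "map (map f) bsss = css" by auto
  then show ?case using \<open>bss = us @ vs\<close> \<open>cs = map f us\<close> by (intro exI[of _ "us # bsss"]) simp
qed simp

context normal_lax
begin

lemma pm_comp_ex: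
  assumes "pok bss A" "pok css A" "concat css = map concat bss"
  shows "\<exists>dss. pok dss A \<and> concat dss = concat bss \<and> map concat dss = map concat css \<and>
    pm css A \<bullet> pm bss A = pm dss A"
proof -
  obtain bsss where s: "concat bsss = bss" "map (map concat) bsss = css"
    using concat_eq_map assms(3) by metis
  have ne: "[] \<notin> set bsss" using assms(2) s(2) by (auto simp: pok_def)
  \<comment> \<open>A nonempty list of groups with empty concatenation would contain an empty group,
    which \<open>pok bss A\<close> forbids.\<close>
  have "[] \<notin> set (map concat bsss)"
  proof
    assume "[] \<in> set (map concat bsss)"
    then obtain x where x: "x \<in> set bsss" "concat x = []" by auto
    then obtain y ys where "x = y # ys" using ne by (metis list.exhaust)
    then have "y \<in> set bss" "y = []" using x s(1) by force+
    then show False using assms(1) by (simp add: pok_def)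
  qed
  then have "pok (map concat bsss) A" using assms(1) by (simp add: pok_def s(1))
  moreover have "map concat (map concat bsss) = map concat css"
    by (simp flip: s(2) add: map_map)
  ultimately show ?thesis
    using pm_comp[of bsss A] ne assms(1) s by (intro exI[of _ "map concat bsss"]) simp
qed

subsection \<open>Normalization of words in images of 1-cells\<close>

primrec blks :: "('a,'b) nw \<Rightarrow> 'b list list" where
  "blks (NPhi w) = (if fletters w = [] then [] else [fletters w])"
| "blks (NU A) = []"
| "blks (NC U V) = blks U @ blks V"

text \<open>After normalizing \<open>w\<close> in \<open>C\<close>, a letterless factor is sent to
  the unit by the inverse of \<open>lfi\<close>, which exists by normality; any other factor
  acquires a trailing unit.\<close>

primrec nn :: "('a,'b) nw \<Rightarrow> 'h" where
  "nn (NPhi w) = inv2 D (mu (blks (NPhi w)) (ftgt C w)) \<bullet> lf2 F (C.nrm w)"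
| "nn (NU A) = bid D (bunit D (lf0 F A))"
| "nn (NC U V) = D.lam (map G (blks U)) (nb (blks V) (ntgt C V)) \<bullet> (nn U \<star> nn V)"

lemma concat_blks [simp]: "concat (blks W) = nletters W"
  by (induction W) auto

lemma nletters_type: "nwf C W \<Longrightarrow> C.chn (nletters W) (ntgt C W) \<and> C.vs (nletters W) (ntgt C W) = nsrc C W"
  by (induction W) auto

lemma chn_nletters [simp]: "\<lbrakk>nwf C W; ntgt C W = A\<rbrakk> \<Longrightarrow> C.chn (nletters W) A"
  and vs_nletters [simp]: "\<lbrakk>nwf C W; ntgt C W = A\<rbrakk> \<Longrightarrow> C.vs (nletters W) A = nsrc C W"
  using nletters_type by auto

lemma bok_blks [simp]: "\<lbrakk>nwf C W; ntgt C W = A\<rbrakk> \<Longrightarrow> bok (blks W) A"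
proof -
  assume "nwf C W" "ntgt C W = A"
  moreover have "[] \<notin> set (blks W)" by (induction W) auto
  ultimately show ?thesis by (simp add: bok_def)
qed

lemma iso_mu_blks [simp]: "\<lbrakk>fwf C w; ftgt C w = A\<rbrakk> \<Longrightarrow> is_iso2 D (mu (blks (NPhi w)) A)"
  by (simp add: mu_single del: mu.simps(2))

lemma nev_type: "nwf C W \<Longrightarrow> bsrc D (nev C D F W) = lf0 F (nsrc C W) \<and> btgt D (nev C D F W) = lf0 F (ntgt C W)"
  by (induction W) auto

lemma src_nev [simp]: "nwf C W \<Longrightarrow> bsrc D (nev C D F W) = lf0 F (nsrc C W)"
  and tgt_nev [simp]: "nwf C W \<Longrightarrow> btgt D (nev C D F W) = lf0 F (ntgt C W)"
  by (simp_all add: nev_type)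

lemma nn_type: "nwf C W \<Longrightarrow> bdom D (nn W) = nev C D F W \<and> bcod D (nn W) = nb (blks W) (ntgt C W) \<and> is_iso2 D (nn W)"
proof (induction W)
  case (NPhi w)
  have "bok (blks (NPhi w)) (ftgt C w)" using NPhi bok_blks[of "NPhi w"] by simp
  moreover have "concat (blks (NPhi w)) = fletters w" by simp
  ultimately show ?case using NPhi by (simp del: blks.simps)
qed auto

lemma dom_nn [simp]: "nwf C W \<Longrightarrow> bdom D (nn W) = nev C D F W"
  and cod_nn [simp]: "nwf C W \<Longrightarrow> bcod D (nn W) = nb (blks W) (ntgt C W)"
  and iso_nn [simp]: "nwf C W \<Longrightarrow> is_iso2 D (nn W)"
  by (simp_all add: nn_type)

lemma mu_nn: "fwf C w \<Longrightarrow> mu (blks (NPhi w)) (ftgt C w) \<bullet> nn (NPhi w) = lf2 F (C.nrm w)"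
proof -
  assume w: "fwf C w"
  then have "bok (blks (NPhi w)) (ftgt C w)" using bok_blks[of "NPhi w"] by simp
  moreover have "concat (blks (NPhi w)) = fletters w" by simp
  ultimately show ?thesis using w by (simp del: blks.simps)
qed

lemma n2_wf: "n2wf C f \<Longrightarrow> nwf C (n2dom C f) \<and> nwf C (n2cod C f) \<and>
    nsrc C (n2cod C f) = nsrc C (n2dom C f) \<and> ntgt C (n2cod C f) = ntgt C (n2dom C f)"
  by (induction f) auto

lemma nwf_n2dom [simp]: "n2wf C f \<Longrightarrow> nwf C (n2dom C f)"
  and nwf_n2cod [simp]: "n2wf C f \<Longrightarrow> nwf C (n2cod C f)"
  and nsrc_n2cod [simp]: "n2wf C f \<Longrightarrow> nsrc C (n2cod C f) = nsrc C (n2dom C f)"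
  and ntgt_n2cod [simp]: "n2wf C f \<Longrightarrow> ntgt C (n2cod C f) = ntgt C (n2dom C f)"
  using n2_wf by blast+

lemma n2ev_type: "n2wf C f \<Longrightarrow>
    bdom D (n2ev C D F f) = nev C D F (n2dom C f) \<and> bcod D (n2ev C D F f) = nev C D F (n2cod C f)"
  by (induction f) auto

lemma dom_n2ev [simp]: "n2wf C f \<Longrightarrow> bdom D (n2ev C D F f) = nev C D F (n2dom C f)"
  and cod_n2ev [simp]: "n2wf C f \<Longrightarrow> bcod D (n2ev C D F f) = nev C D F (n2cod C f)"
  by (simp_all add: n2ev_type)

lemma nn_NAs:
  assumes "n2wf C (NAs u v w)"
  shows "nn (NC u (NC v w)) \<bullet> bassoc D (nev C D F u) (nev C D F v) (nev C D F w) = nn (NC (NC u v) w)"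
  using D.lam_assoc[of "map G (blks u)" "map G (blks v)" "map G (blks w)" "lf0 F (ntgt C w)" "nn u" "nn v" "nn w"] assms
  by simp

lemma nn_NLu:
  assumes "nwf C w"
  shows "nn w \<bullet> blu D (nev C D F w) = nn (NC (NU (nsrc C w)) w)"
  using D.lu_nat[of "nn w"] assms by simp

lemma nn_NRu:
  assumes "nwf C w"
  shows "nn w \<bullet> bru D (nev C D F w) = nn (NC w (NU (ntgt C w)))"
  using D.ru_nat[of "nn w"] assms by (simp add: D.lam_unit)

text \<open>Covers zero, one or two factors with letters uniformly. \<open>mu_nn\<close> rewrites
  the image of \<open>nrm\<close> on each factor as \<open>mu\<close> after \<open>nn\<close>, and
  \<open>mu_append\<close> joins the two products.\<close>

lemma nn_NM:
  assumes "fwf C u" "fwf C v" "ftgt C u = fsrc C v"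
  defines "bs \<equiv> blks (NPhi u) @ blks (NPhi v)"
  shows "nn (NPhi (FC u v)) \<bullet> lfm F (fev C u) (fev C v) =
    inv2 D (mu (blks (NPhi (FC u v))) (ftgt C v)) \<bullet> mu bs (ftgt C v) \<bullet> nn (NC (NPhi u) (NPhi v))"
proof -
  have b: "bok (blks (NPhi u)) (fsrc C v)" "bok (blks (NPhi v)) (ftgt C v)"
    using bok_blks[of "NPhi u"] bok_blks[of "NPhi v"] assms by auto
  have uv: "bok (blks (NPhi (FC u v))) (ftgt C v)"
    using bok_blks[of "NPhi (FC u v)"] assms by auto
  have cu: "concat (blks (NPhi u)) = fletters u" and cv: "concat (blks (NPhi v)) = fletters v"
    and cuv: "concat (blks (NPhi (FC u v))) = fletters u @ fletters v"
    by auto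
  have "mu bs (ftgt C v) \<bullet> nn (NC (NPhi u) (NPhi v)) =
    (mu bs (ftgt C v) \<bullet> D.lam (map G (blks (NPhi u))) (nb (blks (NPhi v)) (ftgt C v))) \<bullet>
    (nn (NPhi u) \<star> nn (NPhi v))"
    using assms(1-3) b by (simp add: bs_def cu cv del: blks.simps(1) nn.simps(1))
  also have "\<dots> = mm (fletters u) (fletters v) (ftgt C v) \<bullet>
     ((mu (blks (NPhi u)) (ftgt C u) \<bullet> nn (NPhi u)) \<star> (mu (blks (NPhi v)) (ftgt C v) \<bullet> nn (NPhi v)))"
    using mu_append[of "blks (NPhi u)" "blks (NPhi v)" "ftgt C v"] assms(1-3) b
    by (simp add: bs_def cu cv del: blks.simps(1) nn.simps(1))
  also have "\<dots> = mm (fletters u) (fletters v) (ftgt C v) \<bullet> (lf2 F (C.nrm u) \<star> lf2 F (C.nrm v))"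
    by (simp only: mu_nn[OF assms(1)] mu_nn[OF assms(2)])
  also have "\<dots> = lf2 F (C.nrm (FC u v)) \<bullet> lfm F (fev C u) (fev C v)"
    using lfm_nat[of "C.nrm u" "C.nrm v"] assms(1-3) by (simp add: mm_def lf_vc)
  finally show ?thesis using assms(1-3) uv by (simp add: cuv del: blks.simps(1) mu.simps)
qed

text \<open>By naturality of the right unitor, merging a single group differs from \<open>mu\<close>
  only by the unit that ends the target.\<close>

lemma pm_single: "\<lbrakk>bs \<noteq> []; bok bs A\<rbrakk> \<Longrightarrow>
    pm [bs] A = inv2 D (bru D (lf1 F (C.nf (concat bs) A))) \<bullet> mu bs A"
proof -
  assume bs: "bs \<noteq> []" "bok bs A"
  have "bru D (lf1 F (C.nf (concat bs) A)) \<bullet> pm [bs] A = mu bs A"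
    using D.vc_chain[OF D.ru_nat[of "mu bs A"], where k="inv2 D (bru D (nb bs A))"] bs
    by (simp add: D.lam_unit)
  then show ?thesis
    using bs concat_nonempty[of bs A] D.inv2_left_chain[of "bru D (lf1 F (C.nf (concat bs) A))" "pm [bs] A"]
    by (simp add: G_eq[of _ A] del: pm.simps D.inv2_left_chain)
qed

text \<open>The blocks of the target of a 2-cell arise by merging consecutive blocks of its source;
  the grouping \<open>bss\<close> records which ones.\<close>

lemma nn_n2: "n2wf C f \<Longrightarrow> \<exists>bss. pok bss (ntgt C (n2dom C f)) \<and>
    concat bss = blks (n2dom C f) \<and> map concat bss = blks (n2cod C f) \<and>
    nn (n2cod C f) \<bullet> n2ev C D F f = pm bss (ntgt C (n2dom C f)) \<bullet> nn (n2dom C f)"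
proof (induction f)
  \<comment> \<open>Generators that merge nothing get singleton groups, whose merging is the
    identity.\<close>
  have triv: "\<exists>bss. pok bss (ntgt C W) \<and> concat bss = blks W \<and> map concat bss = blks W' \<and>
      x = pm bss (ntgt C W) \<bullet> nn W" if "nwf C W" "blks W' = blks W" "x = nn W" for W W' x
  proof (rule exI[of _ "map (\<lambda>b. [b]) (blks W)"])
    have "concat (map (\<lambda>b. [b]) bs) = bs" "map concat (map (\<lambda>b. [b]) bs) = bs" for bs :: "'b list list"
      by (induction bs) auto
    moreover have "bok (blks W) (ntgt C W)" using that by simp
    ultimately show "pok (map (\<lambda>b. [b]) (blks W)) (ntgt C W) \<and> concat (map (\<lambda>b. [b]) (blks W)) = blks W \<and>
      map concat (map (\<lambda>b. [b]) (blks W)) = blks W' \<and> x = pm (map (\<lambda>b. [b]) (blks W)) (ntgt C W) \<bullet> nn W"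
      using that by (auto simp: pm_singletons pok_def)
  qed
  {
    case (NId w)
    then show ?case by (intro triv) auto
  next
    case (NAs u v w)
    then show ?case by (intro triv) (use nn_NAs in auto)
  next
    case (NAsI u v w)
    then show ?case by (intro triv) (use D.inv2_move[OF nn_NAs[of u v w]] in auto)
  next
    case (NLu w)
    then show ?case by (intro triv) (use nn_NLu in auto)
  next
    case (NLuI w)
    then show ?case by (intro triv) (use D.inv2_move[OF nn_NLu[of w]] in auto)
  next
    case (NRu w)
    then show ?case by (intro triv) (use nn_NRu in auto)
  next
    case (NRuI w)
    then show ?case by (intro triv) (use D.inv2_move[OF nn_NRu[of w]] in auto)
  next
    case (NI A)
    then show ?case by (intro triv) auto
  next
    case (NII A)
    then show ?case by (intro triv) auto
  next
    case (NPhi2 a)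
    then have "bok (blks (NPhi (fdom C a))) (ftgt C (fdom C a))"
      "concat (blks (NPhi (fdom C a))) = fletters (fdom C a)" "blks (NPhi (fcod C a)) = blks (NPhi (fdom C a))"
      using bok_blks[of "NPhi (fdom C a)"] by auto
    then show ?case using NPhi2
      by (intro triv) (auto simp: lf_vc[symmetric] C.nrm_f2 simp del: blks.simps)
  next
    case (NM u v)
    let ?bs = "blks (NPhi u) @ blks (NPhi v)"
    have b: "bok ?bs (ftgt C v)" using NM bok_blks[of "NC (NPhi u) (NPhi v)"] by simp
    have c: "concat ?bs = fletters u @ fletters v" by simp
    show ?case
    \<comment> \<open>Two letterless factors leave no block, and \<open>mu []\<close> cancels
      against its inverse in \<open>nn_NM\<close>. Otherwise all remaining blocks form one group,
      even if there is only one of them.\<close>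
    proof (cases "?bs = []")
      case True
      then have "fletters u = []" "fletters v = []" by (auto split: if_splits)
      then show ?thesis using NM nn_NM[of u v]
        by (intro triv) (auto simp del: nn.simps)
    next
      case False
      then have ne: "fletters u @ fletters v \<noteq> []" by auto
      then have "blks (NPhi (FC u v)) = [fletters u @ fletters v]" by simp
      then have "nn (n2cod C (NM u v)) \<bullet> n2ev C D F (NM u v) = pm [?bs] (ftgt C v) \<bullet> nn (n2dom C (NM u v))"
        using NM nn_NM[of u v] pm_single[OF False b] b
        by (simp add: mu_single c del: pm.simps nn.simps mu.simps blks.simps(1))
      then show ?thesis using NM b False ne
        by (intro exI[of _ "[?bs]"]) (simp del: pm.simps nn.simps mu.simps)
    qed
  next
    case (NV g f)
    then obtain bss css where
      b: "pok bss (ntgt C (n2dom C f))" "concat bss = blks (n2dom C f)" "map concat bss = blks (n2cod C f)"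
        "nn (n2cod C f) \<bullet> n2ev C D F f = pm bss (ntgt C (n2dom C f)) \<bullet> nn (n2dom C f)" and
      c: "pok css (ntgt C (n2dom C f))" "concat css = blks (n2cod C f)" "map concat css = blks (n2cod C g)"
        "nn (n2cod C g) \<bullet> n2ev C D F g = pm css (ntgt C (n2dom C f)) \<bullet> nn (n2cod C f)"
      by (auto simp del: pm.simps) (metis ntgt_n2cod)
    let ?A = "ntgt C (n2dom C f)"
    from pm_comp_ex[OF b(1) c(1)] b c obtain dss where
      d: "pok dss ?A" "concat dss = blks (n2dom C f)" "map concat dss = blks (n2cod C g)"
        "pm css ?A \<bullet> pm bss ?A = pm dss ?A"
      by auto
    have "ntgt C (n2dom C g) = ?A" using NV.prems ntgt_n2cod[of f] by simp
    then have "nn (n2cod C (NV g f)) \<bullet> n2ev C D F (NV g f) = (pm css ?A \<bullet> pm bss ?A) \<bullet> nn (n2dom C f)"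
      using NV.prems b c D.vc_chain[OF c(4), where k="n2ev C D F f"] by simp
    then show ?case using d by (intro exI[of _ dss]) simp
  next
    case (NH f g)
    then obtain bss css where
      b: "pok bss (ntgt C (n2dom C f))" "concat bss = blks (n2dom C f)" "map concat bss = blks (n2cod C f)"
        "nn (n2cod C f) \<bullet> n2ev C D F f = pm bss (ntgt C (n2dom C f)) \<bullet> nn (n2dom C f)" and
      c: "pok css (ntgt C (n2dom C g))" "concat css = blks (n2dom C g)" "map concat css = blks (n2cod C g)"
        "nn (n2cod C g) \<bullet> n2ev C D F g = pm css (ntgt C (n2dom C g)) \<bullet> nn (n2dom C g)"
      by auto
    let ?A = "ntgt C (n2dom C g)"
    have v: "C.vs (concat (concat css)) ?A = ntgt C (n2dom C f)" using NH.prems c(2) by simp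
    have "nn (n2cod C (NH f g)) \<bullet> n2ev C D F (NH f g) =
      (D.lam (map G (blks (n2cod C f))) (nb (blks (n2cod C g)) ?A) \<bullet>
        (pm bss (ntgt C (n2dom C f)) \<star> pm css ?A)) \<bullet> (nn (n2dom C f) \<star> nn (n2dom C g))"
      using NH.prems b c by simp
    also have "\<dots> = (pm (bss @ css) ?A \<bullet> D.lam (map G (blks (n2dom C f))) (nb (blks (n2dom C g)) ?A)) \<bullet>
       (nn (n2dom C f) \<star> nn (n2dom C g))"
      using pm_append[of bss css ?A] b c v by simp
    also have "\<dots> = pm (bss @ css) ?A \<bullet> nn (n2dom C (NH f g))"
      using NH.prems b c v by simp
    finally show ?case using NH.prems b c v by (intro exI[of _ "bss @ css"]) simp
  }
qed

end

text \<open>Both lengths lie between zero and the total, so equal residues mean equal lengths,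
  except that zero and the total are confused.\<close>

lemma append_eq_mod_length:
  assumes "us @ vs = us' @ vs'"
    "length vs mod (length us + length vs) = length vs' mod (length us + length vs)"
  shows "us = us' \<and> vs = vs' \<or> us = [] \<and> vs' = [] \<or> vs = [] \<and> us' = []"
proof -
  have l: "length us + length vs = length us' + length vs'"
    using arg_cong[OF assms(1), of length] by simp
  have "length vs = length vs' \<or> us = [] \<and> vs' = [] \<or> vs = [] \<and> us' = []"
  proof (cases "length us = 0 \<or> length us' = 0")
    case True
    then show ?thesis using l assms(2) by auto
  next
    case False
    then have "0 < length us" "0 < length us'" by auto
    then have "length vs < length us + length vs" "length vs' < length us + length vs" using l by linarith+
    then show ?thesis using assms(2) by simp
  qed
  then show ?thesis using assms(1) by auto
qed

context shadowed
begin

lemma rho_Nil_left [simp]: "cyc xs A \<Longrightarrow> rho [] xs A = sid S (sh0 S (nf xs A))"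
  using rho_rho[of "[]" xs A] sc_id_left[of "rho [] xs A"] by (simp add: cyc_def)

text \<open>If the cuts differ, one rotation is the zero turn and the other the full turn, and both
  are identities.\<close>

lemma rho_unique:
  assumes c: "cyc (xs @ ys) A" and e: "xs @ ys = xs' @ ys'"
    and n: "length ys mod (length xs + length ys) = length ys' mod (length xs + length ys)"
  shows "rho xs ys A = rho xs' ys' A"
  using append_eq_mod_length[OF e n] c e by auto

text \<open>\<open>g\<close> and the weight \<open>f\<close> are general for the sake of two uses:
  letters with \<open>g = id\<close> and weight 1, and blocks with \<open>g = G\<close> and weight
  \<open>length\<close>, which converts a rotation of blocks into its letter count.\<close>

lemma rho_comp:
  fixes g :: "'x \<Rightarrow> 'c"
  assumes c: "cyc (map g (xs @ ys)) A" and e: "ys @ xs = xs' @ ys'"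
  obtains us ws where "us @ ws = xs @ ys" "ws @ us = ys' @ xs'"
    "vs (map g ws) A = vs (map g ys') (vs (map g ys) A)"
    "rho (map g xs') (map g ys') (vs (map g ys) A) \<diamondop>\<^bsub>S\<^esub> rho (map g xs) (map g ys) A =
      rho (map g us) (map g ws) A"
    "\<forall>f :: 'x \<Rightarrow> nat. sum_list (map f ws) mod sum_list (map f (xs @ ys)) =
      (sum_list (map f ys) + sum_list (map f ys')) mod sum_list (map f (xs @ ys))"
proof -
  from e consider ms where "ys = xs' @ ms" "ys' = ms @ xs" | ms where "xs' = ys @ ms" "xs = ms @ ys'"
    by (auto simp: append_eq_append_conv2)
  then show thesis
  proof cases
    case 1
    show thesis
    proof (rule that[of "xs @ xs'" ms])
      show "rho (map g xs') (map g ys') (vs (map g ys) A) \<diamondop>\<^bsub>S\<^esub> rho (map g xs) (map g ys) A =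
        rho (map g (xs @ xs')) (map g ms) A"
        using rho_comp_short[of "map g xs" "map g xs'" "map g ms" A] c 1 by simp
      show "vs (map g ms) A = vs (map g ys') (vs (map g ys) A)" using c 1 by (simp add: cyc_def)
      show "\<forall>f :: 'x \<Rightarrow> nat. sum_list (map f ms) mod sum_list (map f (xs @ ys)) =
        (sum_list (map f ys) + sum_list (map f ys')) mod sum_list (map f (xs @ ys))"
      proof
        fix f :: "'x \<Rightarrow> nat"
        have "sum_list (map f ys) + sum_list (map f ys') = sum_list (map f ms) + sum_list (map f (xs @ ys))"
          using 1 by simp
        then show "sum_list (map f ms) mod sum_list (map f (xs @ ys)) =
          (sum_list (map f ys) + sum_list (map f ys')) mod sum_list (map f (xs @ ys))"
          by (simp only: mod_add_self2)
      qed
    qed (use 1 in auto)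
  next
    case 2
    show thesis
      by (rule that[of ms "ys' @ ys"])
         (use rho_comp_long[of "map g ms" "map g ys'" "map g ys" A] c 2 in \<open>auto simp: add.commute\<close>)
  qed
qed

text \<open>Naturality of the rotator at \<open>nrm u\<close> and \<open>nrm v\<close>;
  \<open>rho_lam\<close> then turns it into a list rotation.\<close>

lemma nrm_rot:
  assumes "fwf B u" "fwf B v" "ftgt B u = fsrc B v" "ftgt B v = fsrc B u"
  shows "sh1 S (nrm (FC v u)) \<diamondop>\<^bsub>S\<^esub> srot S (fev B u) (fev B v) =
    rho (fletters u) (fletters v) (ftgt B v) \<diamondop>\<^bsub>S\<^esub> sh1 S (nrm (FC u v))"
proof -
  let ?U = "nf (fletters u) (fsrc B v)" and ?V = "nf (fletters v) (ftgt B v)"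
  have c: "cyc (fletters u @ fletters v) (ftgt B v)" using assms by (auto simp: cyc_def)
  have "sh1 S (nrm (FC v u)) \<diamondop>\<^bsub>S\<^esub> srot S (fev B u) (fev B v) =
    sh1 S (lam (fletters v) ?U) \<diamondop>\<^bsub>S\<^esub> sh1 S (nrm v \<star> nrm u) \<diamondop>\<^bsub>S\<^esub> srot S (fev B u) (fev B v)"
    using assms by (simp add: sh1_vc)
  also have "\<dots> = (sh1 S (lam (fletters v) ?U) \<diamondop>\<^bsub>S\<^esub> srot S ?U ?V) \<diamondop>\<^bsub>S\<^esub> sh1 S (nrm u \<star> nrm v)"
    using assms rot_nat[of "nrm u" "nrm v"] by simp
  also have "\<dots> = (rho (fletters u) (fletters v) (ftgt B v) \<diamondop>\<^bsub>S\<^esub> sh1 S (lam (fletters u) ?V)) \<diamondop>\<^bsub>S\<^esub> sh1 S (nrm u \<star> nrm v)"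
    using rho_lam[OF c] assms by simp
  also have "\<dots> = rho (fletters u) (fletters v) (ftgt B v) \<diamondop>\<^bsub>S\<^esub> sh1 S (nrm (FC u v))"
    using assms c by (simp add: sh1_vc)
  finally show ?thesis .
qed

end

section \<open>Normal lax shadow functors\<close>

locale normal_lax_shadow = normal_lax D C F + D: shadowed D DS + C: shadowed C CS
  for D :: "('f,'g,'h) bicat" (structure) and C :: "('a,'b,'c) bicat"
    and F :: "('a,'b,'c,'f,'g,'h) laxf" and DS :: "('i,'j,'g,'h) shadow" and CS :: "('d,'e,'b,'c) shadow" +
  fixes H :: "('d,'e,'i,'j) shfun" and s :: "'b \<Rightarrow> 'j"
  assumes nls: "normal_lax_shadow_functor C CS D DS F H s"
begin

lemmas Hs = nls[unfolded normal_lax_shadow_functor_def sh_functor_def]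

lemma sdom_H [simp]: "sdom DS (hf1 H x) = hf0 H (sdom CS x)"
  and scod_H [simp]: "scod DS (hf1 H x) = hf0 H (scod CS x)"
  and H_id [simp]: "hf1 H (sid CS a) = sid DS (hf0 H a)"
  and H_sc: "scod CS x = sdom CS y \<Longrightarrow> hf1 H (y \<diamondop>\<^bsub>CS\<^esub> x) = hf1 H y \<diamondop>\<^bsub>DS\<^esub> hf1 H x"
  and sdom_s [simp]: "bsrc C M = btgt C M \<Longrightarrow> sdom DS (s M) = sh0 DS (lf1 F M)"
  and scod_s [simp]: "bsrc C M = btgt C M \<Longrightarrow> scod DS (s M) = hf0 H (sh0 CS M)"
  and s_nat: "bsrc C (bdom C f) = btgt C (bdom C f) \<Longrightarrow>
    s (bcod C f) \<diamondop>\<^bsub>DS\<^esub> sh1 DS (lf2 F f) = hf1 H (sh1 CS f) \<diamondop>\<^bsub>DS\<^esub> s (bdom C f)"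
  and s_rot: "\<lbrakk>btgt C M = bsrc C N; btgt C N = bsrc C M\<rbrakk> \<Longrightarrow>
    hf1 H (srot CS M N) \<diamondop>\<^bsub>DS\<^esub> s (M \<odot>\<^bsub>C\<^esub> N) \<diamondop>\<^bsub>DS\<^esub> sh1 DS (lfm F M N) =
    s (N \<odot>\<^bsub>C\<^esub> M) \<diamondop>\<^bsub>DS\<^esub> sh1 DS (lfm F N M) \<diamondop>\<^bsub>DS\<^esub> srot DS (lf1 F M) (lf1 F N)"
  using Hs by meson+

subsection \<open>Comparison of the two shadows on normal forms\<close>

definition shs :: "'b list list \<Rightarrow> 'a \<Rightarrow> 'j" where
  "shs bs A = s (C.nf (concat bs) A) \<diamondop>\<^bsub>DS\<^esub> sh1 DS (mu bs A)"

definition bcyc :: "'b list list \<Rightarrow> 'a \<Rightarrow> bool" where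
  "bcyc bs A \<longleftrightarrow> bok bs A \<and> C.vs (concat bs) A = A"

lemma bcyc_cyc [simp]: "bcyc bs A \<Longrightarrow> C.cyc (concat bs) A"
  and bcyc_cyc_G [simp]: "bcyc bs A \<Longrightarrow> D.cyc (map G bs) (lf0 F A)"
  by (auto simp: bcyc_def C.cyc_def D.cyc_def)

lemma bcyc_rotate: "bcyc (xs @ ys) A \<Longrightarrow> bcyc (ys @ xs) (C.vs (concat ys) A)"
  by (auto simp: bcyc_def)

lemma sdom_shs [simp]: "bcyc bs A \<Longrightarrow> sdom DS (shs bs A) = sh0 DS (nb bs A)"
  and scod_shs [simp]: "bcyc bs A \<Longrightarrow> scod DS (shs bs A) = hf0 H (sh0 CS (C.nf (concat bs) A))"
  by (simp_all add: shs_def bcyc_def)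

lemma shs_pm: "\<lbrakk>pok bss A; bcyc (concat bss) A\<rbrakk> \<Longrightarrow>
    shs (map concat bss) A \<diamondop>\<^bsub>DS\<^esub> sh1 DS (pm bss A) = shs (concat bss) A"
  by (simp add: shs_def bcyc_def D.sh1_vc[symmetric] mu_pm)

text \<open>The rotator axiom for \<open>s\<close>, extended from pairs of 1-cells to block lists:
  \<open>mu_append\<close> reduces it to the products of the two halves. A rotation of blocks before
  \<open>s\<close> becomes a rotation of letters after it.\<close>

lemma shs_rho:
  assumes c: "bcyc (xs @ ys) A"
  shows "shs (ys @ xs) (C.vs (concat ys) A) \<diamondop>\<^bsub>DS\<^esub> D.rho (map G xs) (map G ys) (lf0 F A) =
    hf1 H (C.rho (concat xs) (concat ys) A) \<diamondop>\<^bsub>DS\<^esub> shs (xs @ ys) A"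
proof -
  let ?v = "C.vs (concat ys) A" let ?L = "D.lam (map G xs) (nb ys A)"
  let ?x = "C.nf (concat xs) ?v" and ?y = "C.nf (concat ys) A"
  have t: "bok xs ?v" "bok ys A" "C.vs (concat xs) ?v = A" using c by (auto simp: bcyc_def)
  have cC: "C.cyc (concat xs @ concat ys) A" and cD: "D.cyc (map G xs @ map G ys) (lf0 F A)"
    using t by (auto simp: C.cyc_def D.cyc_def)
  have c': "bcyc (ys @ xs) ?v" using c by (rule bcyc_rotate)
  have "shs (ys @ xs) ?v \<diamondop>\<^bsub>DS\<^esub> D.rho (map G xs) (map G ys) (lf0 F A) \<diamondop>\<^bsub>DS\<^esub> sh1 DS ?L =
    s (C.nf (concat ys @ concat xs) ?v) \<diamondop>\<^bsub>DS\<^esub>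
    sh1 DS (mu (ys @ xs) ?v \<bullet> D.lam (map G ys) (nb xs ?v)) \<diamondop>\<^bsub>DS\<^esub> srot DS (nb xs ?v) (nb ys A)"
    using t D.rho_lam[OF cD] by (simp add: shs_def D.sh1_vc)
  also have "\<dots> = s (C.nf (concat ys @ concat xs) ?v) \<diamondop>\<^bsub>DS\<^esub> sh1 DS (mm (concat ys) (concat xs) ?v) \<diamondop>\<^bsub>DS\<^esub>
    sh1 DS (mu ys A \<star> mu xs ?v) \<diamondop>\<^bsub>DS\<^esub> srot DS (nb xs ?v) (nb ys A)"
    using t mu_append[of ys xs ?v] by (simp add: D.sh1_vc)
  also have "\<dots> = s (C.nf (concat ys @ concat xs) ?v) \<diamondop>\<^bsub>DS\<^esub> sh1 DS (mm (concat ys) (concat xs) ?v) \<diamondop>\<^bsub>DS\<^esub>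
    srot DS (lf1 F ?x) (lf1 F ?y) \<diamondop>\<^bsub>DS\<^esub> sh1 DS (mu xs ?v \<star> mu ys A)"
    using t D.rot_nat[of "mu xs ?v" "mu ys A"] by simp
  also have "\<dots> = (s (C.nf (concat ys @ concat xs) ?v) \<diamondop>\<^bsub>DS\<^esub> sh1 DS (lf2 F (C.lam (concat ys) ?x))) \<diamondop>\<^bsub>DS\<^esub>
    sh1 DS (lfm F ?y ?x) \<diamondop>\<^bsub>DS\<^esub> srot DS (lf1 F ?x) (lf1 F ?y) \<diamondop>\<^bsub>DS\<^esub> sh1 DS (mu xs ?v \<star> mu ys A)"
    using t by (simp add: mm_def D.sh1_vc)
  also have "s (C.nf (concat ys @ concat xs) ?v) \<diamondop>\<^bsub>DS\<^esub> sh1 DS (lf2 F (C.lam (concat ys) ?x)) =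
    hf1 H (sh1 CS (C.lam (concat ys) ?x)) \<diamondop>\<^bsub>DS\<^esub> s (?y \<odot>\<^bsub>C\<^esub> ?x)"
    using t s_nat[of "C.lam (concat ys) ?x"] by simp
  also have "(hf1 H (sh1 CS (C.lam (concat ys) ?x)) \<diamondop>\<^bsub>DS\<^esub> s (?y \<odot>\<^bsub>C\<^esub> ?x)) \<diamondop>\<^bsub>DS\<^esub>
    sh1 DS (lfm F ?y ?x) \<diamondop>\<^bsub>DS\<^esub> srot DS (lf1 F ?x) (lf1 F ?y) \<diamondop>\<^bsub>DS\<^esub> sh1 DS (mu xs ?v \<star> mu ys A) =
    hf1 H (sh1 CS (C.lam (concat ys) ?x)) \<diamondop>\<^bsub>DS\<^esub> (s (?y \<odot>\<^bsub>C\<^esub> ?x) \<diamondop>\<^bsub>DS\<^esub>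
    sh1 DS (lfm F ?y ?x) \<diamondop>\<^bsub>DS\<^esub> srot DS (lf1 F ?x) (lf1 F ?y)) \<diamondop>\<^bsub>DS\<^esub> sh1 DS (mu xs ?v \<star> mu ys A)"
    using t by simp
  \<comment> \<open>The axiom \<open>s_rot\<close> trades the rotator of \<open>D\<close> for the
    image under \<open>H\<close> of the rotator of \<open>C\<close>.\<close>
  also have "\<dots> = (hf1 H (sh1 CS (C.lam (concat ys) ?x)) \<diamondop>\<^bsub>DS\<^esub> hf1 H (srot CS ?x ?y)) \<diamondop>\<^bsub>DS\<^esub>
    s (?x \<odot>\<^bsub>C\<^esub> ?y) \<diamondop>\<^bsub>DS\<^esub> sh1 DS (lfm F ?x ?y) \<diamondop>\<^bsub>DS\<^esub> sh1 DS (mu xs ?v \<star> mu ys A)"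
    using t by (subst s_rot[symmetric]) auto
  also have "hf1 H (sh1 CS (C.lam (concat ys) ?x)) \<diamondop>\<^bsub>DS\<^esub> hf1 H (srot CS ?x ?y) =
    hf1 H (C.rho (concat xs) (concat ys) A) \<diamondop>\<^bsub>DS\<^esub> hf1 H (sh1 CS (C.lam (concat xs) ?y))"
    using t cC C.rho_lam[OF cC] by (simp add: H_sc[symmetric])
  also have "(hf1 H (C.rho (concat xs) (concat ys) A) \<diamondop>\<^bsub>DS\<^esub> hf1 H (sh1 CS (C.lam (concat xs) ?y))) \<diamondop>\<^bsub>DS\<^esub>
    s (?x \<odot>\<^bsub>C\<^esub> ?y) \<diamondop>\<^bsub>DS\<^esub> sh1 DS (lfm F ?x ?y) \<diamondop>\<^bsub>DS\<^esub> sh1 DS (mu xs ?v \<star> mu ys A) =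
    hf1 H (C.rho (concat xs) (concat ys) A) \<diamondop>\<^bsub>DS\<^esub> (hf1 H (sh1 CS (C.lam (concat xs) ?y)) \<diamondop>\<^bsub>DS\<^esub>
    s (?x \<odot>\<^bsub>C\<^esub> ?y)) \<diamondop>\<^bsub>DS\<^esub> sh1 DS (lfm F ?x ?y) \<diamondop>\<^bsub>DS\<^esub> sh1 DS (mu xs ?v \<star> mu ys A)"
    using t cC by simp
  also have "hf1 H (sh1 CS (C.lam (concat xs) ?y)) \<diamondop>\<^bsub>DS\<^esub> s (?x \<odot>\<^bsub>C\<^esub> ?y) =
    s (C.nf (concat xs @ concat ys) A) \<diamondop>\<^bsub>DS\<^esub> sh1 DS (lf2 F (C.lam (concat xs) ?y))"
    using t s_nat[of "C.lam (concat xs) ?y"] by simp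
  also have "hf1 H (C.rho (concat xs) (concat ys) A) \<diamondop>\<^bsub>DS\<^esub> (s (C.nf (concat xs @ concat ys) A) \<diamondop>\<^bsub>DS\<^esub>
    sh1 DS (lf2 F (C.lam (concat xs) ?y))) \<diamondop>\<^bsub>DS\<^esub> sh1 DS (lfm F ?x ?y) \<diamondop>\<^bsub>DS\<^esub> sh1 DS (mu xs ?v \<star> mu ys A) =
    hf1 H (C.rho (concat xs) (concat ys) A) \<diamondop>\<^bsub>DS\<^esub> s (C.nf (concat xs @ concat ys) A) \<diamondop>\<^bsub>DS\<^esub>
    sh1 DS (mm (concat xs) (concat ys) A \<bullet> (mu xs ?v \<star> mu ys A))"
    using t cC by (simp add: mm_def D.sh1_vc)
  also have "\<dots> = hf1 H (C.rho (concat xs) (concat ys) A) \<diamondop>\<^bsub>DS\<^esub> shs (xs @ ys) A \<diamondop>\<^bsub>DS\<^esub> sh1 DS ?L"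
    using t cC mu_append[of xs ys A] by (simp add: shs_def D.sh1_vc[symmetric])
  finally have *: "(shs (ys @ xs) ?v \<diamondop>\<^bsub>DS\<^esub> D.rho (map G xs) (map G ys) (lf0 F A)) \<diamondop>\<^bsub>DS\<^esub> sh1 DS ?L =
    (hf1 H (C.rho (concat xs) (concat ys) A) \<diamondop>\<^bsub>DS\<^esub> shs (xs @ ys) A) \<diamondop>\<^bsub>DS\<^esub> sh1 DS ?L"
    using t c c' cC cD by simp
  show ?thesis
    by (rule D.sh1_iso_cancel_right[OF *]) (use t c c' cC cD in auto)
qed

text \<open>A cut between merged blocks is a cut between groups, so the rotation can be carried out
  before merging. By \<open>pm_append\<close> this is naturality of the rotator.\<close>

lemma rho_pm:
  assumes p: "pok (xss @ yss) A" and c: "bcyc (concat (xss @ yss)) A"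
  defines "v \<equiv> C.vs (concat (concat yss)) A"
  shows "D.rho (map G (map concat xss)) (map G (map concat yss)) (lf0 F A) \<diamondop>\<^bsub>DS\<^esub> sh1 DS (pm (xss @ yss) A) =
    sh1 DS (pm (yss @ xss) v) \<diamondop>\<^bsub>DS\<^esub> D.rho (map G (concat xss)) (map G (concat yss)) (lf0 F A)"
proof -
  have t: "pok xss v" "pok yss A" "C.vs (concat (concat xss)) v = A"
    using p c by (auto simp: v_def bcyc_def)
  have c1: "D.cyc (map G (concat xss) @ map G (concat yss)) (lf0 F A)"
    and c2: "D.cyc (map G (map concat xss) @ map G (map concat yss)) (lf0 F A)"
    using t by (auto simp: D.cyc_def v_def)
  let ?x = "nb (concat xss) v" and ?y = "nb (concat yss) A"
  let ?x' = "nb (map concat xss) v" and ?y' = "nb (map concat yss) A"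
  let ?L = "D.lam (map G (concat xss)) ?y"
  let ?R' = "D.rho (map G (map concat xss)) (map G (map concat yss)) (lf0 F A)"
  let ?R = "D.rho (map G (concat xss)) (map G (concat yss)) (lf0 F A)"
  have v: "D.vs (map G (concat yss)) (lf0 F A) = lf0 F v" "D.vs (map G (map concat yss)) (lf0 F A) = lf0 F v"
    "D.vs (map G (concat xss)) (lf0 F v) = lf0 F A" "D.vs (map G (map concat xss)) (lf0 F v) = lf0 F A"
    "C.vs (concat (concat yss)) A = v"
    using t by (auto simp: v_def)
  have "?R' \<diamondop>\<^bsub>DS\<^esub> sh1 DS (pm (xss @ yss) A) \<diamondop>\<^bsub>DS\<^esub> sh1 DS ?L =
     ?R' \<diamondop>\<^bsub>DS\<^esub> sh1 DS (pm (xss @ yss) A \<bullet> ?L)"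
    using t p v by (simp add: D.sh1_vc)
  also have "\<dots> = (?R' \<diamondop>\<^bsub>DS\<^esub> sh1 DS (D.lam (map G (map concat xss)) ?y')) \<diamondop>\<^bsub>DS\<^esub> sh1 DS (pm xss v \<star> pm yss A)"
    using t p v c2 pm_append[OF p] by (simp add: D.sh1_vc)
  also have "?R' \<diamondop>\<^bsub>DS\<^esub> sh1 DS (D.lam (map G (map concat xss)) ?y') =
    sh1 DS (D.lam (map G (map concat yss)) ?x') \<diamondop>\<^bsub>DS\<^esub> srot DS ?x' ?y'"
    using D.rho_lam[OF c2] v by simp
  also have "(sh1 DS (D.lam (map G (map concat yss)) ?x') \<diamondop>\<^bsub>DS\<^esub> srot DS ?x' ?y') \<diamondop>\<^bsub>DS\<^esub> sh1 DS (pm xss v \<star> pm yss A)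
    = sh1 DS (D.lam (map G (map concat yss)) ?x') \<diamondop>\<^bsub>DS\<^esub> sh1 DS (pm yss A \<star> pm xss v) \<diamondop>\<^bsub>DS\<^esub> srot DS ?x ?y"
    using t v D.rot_nat[of "pm xss v" "pm yss A"] by simp
  also have "\<dots> = sh1 DS (pm (yss @ xss) v \<bullet> D.lam (map G (concat yss)) ?x) \<diamondop>\<^bsub>DS\<^esub> srot DS ?x ?y"
    using t v pm_append[of yss xss v] by (simp add: D.sh1_vc)
  also have "\<dots> = sh1 DS (pm (yss @ xss) v) \<diamondop>\<^bsub>DS\<^esub> ?R \<diamondop>\<^bsub>DS\<^esub> sh1 DS ?L"
    using t v D.rho_lam[OF c1] by (simp add: D.sh1_vc)
  finally have *: "(?R' \<diamondop>\<^bsub>DS\<^esub> sh1 DS (pm (xss @ yss) A)) \<diamondop>\<^bsub>DS\<^esub> sh1 DS ?L =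
    (sh1 DS (pm (yss @ xss) v) \<diamondop>\<^bsub>DS\<^esub> ?R) \<diamondop>\<^bsub>DS\<^esub> sh1 DS ?L"
    using t v c1 c2 by simp
  show ?thesis
    by (rule D.sh1_iso_cancel_right[OF *]) (use t v c1 c2 in auto)
qed

end

section \<open>Cyclic shifts, aperiodic lists and groupings\<close>

definition shifts :: "('a,'b) sm \<Rightarrow> nat \<Rightarrow> nat \<Rightarrow> bool" where
  "shifts t k n \<longleftrightarrow> (\<forall>p<n. smperm t p = (p + k) mod n)"

lemma shifts_id: "\<lbrakk>\<And>p. smperm t p = p\<rbrakk> \<Longrightarrow> shifts t 0 n"
  by (simp add: shifts_def)

lemma shifts_SV:
  assumes "shifts f k n" "shifts g l n" "m mod n = (k + l) mod n"
  shows "shifts (SV g f) m n"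
  unfolding shifts_def
proof (intro allI impI)
  fix p assume p: "p < n"
  then have "(p + k) mod n < n" by simp
  then have "smperm (SV g f) p = ((p + k) mod n + l) mod n"
    using assms(1,2) p by (simp add: shifts_def)
  also have "\<dots> = (p + (k + l)) mod n" by (simp add: mod_add_left_eq add.assoc)
  also have "\<dots> = (p + m) mod n" using assms(3) by (metis mod_add_right_eq)
  finally show "smperm (SV g f) p = (p + m) mod n" .
qed

text \<open>Position 0 decides if \<open>n\<close> is positive. For \<open>n = 0\<close> there is no
  position to test and \<open>k mod 0 = k\<close>; the bounds then make both shifts zero.\<close>

lemma shifts_unique:
  assumes "shifts t k n" "shifts u l n" "\<forall>p<n. smperm t p = smperm u p" "k \<le> n" "l \<le> n"
  shows "k mod n = l mod n"
proof (cases "n = 0")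
  case False
  then have "smperm t 0 = smperm u 0" "smperm t 0 = k mod n" "smperm u 0 = l mod n"
    using assms(1-3) by (auto simp: shifts_def)
  then show ?thesis by simp
qed (use assms(4,5) in simp)

text \<open>The difference of the two cut positions is a rotation that fixes the list, so
  aperiodicity leaves only the differences zero and the full length.\<close>

lemma aperiodic_rotation:
  assumes ap: "aperiodic (us @ ws)" and "us @ ws = us' @ ws'" "ws @ us = ws' @ us'"
  shows "length ws mod (length us + length ws) = length ws' mod (length us + length ws)"
proof -
  \<comment> \<open>The claim is symmetric in the two splittings, so the earlier cut may be taken
    first.\<close>
  have main: "length b mod (length a + length b) = length b' mod (length a + length b)"
    if ap: "aperiodic (a @ b)" and e: "a @ b = a' @ b'" "b @ a = b' @ a'" and le: "length a \<le> length a'"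
    for a b a' b' :: "'x list"
  proof -
    let ?k = "length a' - length a"
    have l: "length a + length b = length a' + length b'" using arg_cong[OF e(1), of length] by simp
    have "rotate ?k (b @ a) = rotate ?k (rotate (length a) (a @ b))" by (simp add: rotate_append)
    also have "\<dots> = rotate (length a') (a' @ b')" using le e(1) by (simp add: rotate_rotate)
    also have "\<dots> = b @ a" using e(2) by (simp add: rotate_append)
    finally have r: "rotate ?k (b @ a) = b @ a" .
    have "rotate ?k (a @ b) = rotate ?k (rotate (length b) (b @ a))" by (simp add: rotate_append)
    also have "\<dots> = rotate (length b) (rotate ?k (b @ a))" by (simp add: rotate_rotate add.commute)
    also have "\<dots> = a @ b" by (simp add: r rotate_append)
    finally have "\<not> (0 < ?k \<and> ?k < length a + length b)" using ap by (auto simp: aperiodic_def)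
    \<comment> \<open>In the second alternative \<open>?k\<close> is the full length, which forces
      \<open>a\<close> and \<open>b'\<close> to be empty.\<close>
    then have "length b = length b' \<or> length b' = 0 \<and> length a = 0" using l le by linarith
    then show ?thesis using l by auto
  qed
  have l: "length us + length ws = length us' + length ws'" using arg_cong[OF assms(2), of length] by simp
  show ?thesis
  proof (cases "length us \<le> length us'")
    case True
    show ?thesis by (rule main[OF assms True])
  next
    case False
    then have "length us' \<le> length us" by simp
    from main[OF ap[unfolded assms(2)] assms(2,3)[symmetric] this] show ?thesis by (simp only: l)
  qed
qed

text \<open>With nonempty blocks, different prefixes of a block list have different concatenations.
  So the first merged block determines the first group.\<close>

lemma grouping_unique:
  "\<lbrakk>concat bss = concat css; map concat bss = map concat css; [] \<notin> set (concat bss)\<rbrakk> \<Longrightarrow> bss = css"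
proof (induction bss arbitrary: css)
  case (Cons bs bss)
  then obtain cs css' where css: "css = cs # css'" "concat bs = concat cs" "map concat bss = map concat css'"
    by auto
  have nil: "[] \<notin> set (bs @ concat bss)" using Cons.prems by simp
  have e: "bs @ concat bss = cs @ concat css'" using Cons.prems css by simp
  then consider m where "bs = cs @ m" "m @ concat bss = concat css'"
    | m where "bs @ m = cs" "concat bss = m @ concat css'"
    by (auto simp: append_eq_append_conv2)
  then have "bs = cs"
  proof cases
    case 1
    then have "m = []" using css(2) nil by (cases m) auto
    then show ?thesis using 1 by simp
  next
    case 2
    then have "concat m = []" using css(2) by auto
    then have "m = []" using nil 2(2) by (cases m) auto
    then show ?thesis using 2 by simp
  qed
  then show ?case using Cons.IH[of css'] e nil css by simp
qed simp

context normal_lax_shadow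
begin

abbreviation ev :: "('a,'b) sm \<Rightarrow> 'j" where
  "ev \<equiv> smev C CS D DS F H s"

lemma H_sh1_cancel_left:
  assumes "hf1 H (sh1 CS f) \<diamondop>\<^bsub>DS\<^esub> g = hf1 H (sh1 CS f) \<diamondop>\<^bsub>DS\<^esub> h" "is_iso2 C f" "bsrc C (bdom C f) = btgt C (bdom C f)"
    "scod DS g = hf0 H (sh0 CS (bdom C f))" "scod DS h = hf0 H (sh0 CS (bdom C f))"
  shows "g = h"
proof -
  let ?i = "hf1 H (sh1 CS (inv2 C f))"
  have i: "?i \<diamondop>\<^bsub>DS\<^esub> hf1 H (sh1 CS f) = sid DS (hf0 H (sh0 CS (bdom C f)))"
    using assms(2,3) by (subst H_sc[symmetric]) auto
  have "?i \<diamondop>\<^bsub>DS\<^esub> hf1 H (sh1 CS f) \<diamondop>\<^bsub>DS\<^esub> g = ?i \<diamondop>\<^bsub>DS\<^esub> hf1 H (sh1 CS f) \<diamondop>\<^bsub>DS\<^esub> h"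
    by (simp only: assms(1))
  then show ?thesis using assms(2-) D.sc_chain[OF i, of g] D.sc_chain[OF i, of h] by simp
qed

primrec sowf :: "('a,'b) so \<Rightarrow> bool" where
  "sowf (SPsi w) = (fwf C w \<and> fsrc C w = ftgt C w)"
| "sowf (SSh W) = (nwf C W \<and> nsrc C W = ntgt C W)"

primrec soev :: "('a,'b) so \<Rightarrow> 'i" where
  "soev (SPsi w) = hf0 H (sh0 CS (fev C w))"
| "soev (SSh W) = sh0 DS (nev C D F W)"

lemma ev_type: "smwf C t \<Longrightarrow> sowf (smdom C t) \<and> sowf (smcod C t) \<and>
    sdom DS (ev t) = soev (smdom C t) \<and> scod DS (ev t) = soev (smcod C t)"
  by (induction t) auto

lemma sowf_smdom [simp]: "smwf C t \<Longrightarrow> sowf (smdom C t)"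
  and sowf_smcod [simp]: "smwf C t \<Longrightarrow> sowf (smcod C t)"
  and sdom_ev [simp]: "smwf C t \<Longrightarrow> sdom DS (ev t) = soev (smdom C t)"
  and scod_ev [simp]: "smwf C t \<Longrightarrow> scod DS (ev t) = soev (smcod C t)"
  by (simp_all add: ev_type)

text \<open>\<open>s\<close> leads from shadows of words into \<Psi> and no generator leads back,
  which excludes a fourth shape of normal form.\<close>

lemma smdom_Psi: "\<lbrakk>smwf C t; smdom C t = SPsi w\<rbrakk> \<Longrightarrow> \<exists>w'. smcod C t = SPsi w'"
  by (induction t arbitrary: w) auto

text \<open>The three shapes of a normal form: a rotation of letters, a rotation of letters after
  merging all blocks, and a rotation of blocks followed by merging consecutive ones.\<close>

definition nf_PP :: "('a,'b) sm \<Rightarrow> ('a,'b) fw \<Rightarrow> ('a,'b) fw \<Rightarrow> bool" where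
  "nf_PP t w w' \<longleftrightarrow> (\<exists>us ws. fletters w = us @ ws \<and> fletters w' = ws @ us \<and>
     ftgt C w' = C.vs ws (ftgt C w) \<and> shifts t (length ws) (length us + length ws) \<and>
     hf1 H (sh1 CS (C.nrm w')) \<diamondop>\<^bsub>DS\<^esub> ev t =
     hf1 H (C.rho us ws (ftgt C w)) \<diamondop>\<^bsub>DS\<^esub> hf1 H (sh1 CS (C.nrm w)))"

definition nf_WP :: "('a,'b) sm \<Rightarrow> ('a,'b) nw \<Rightarrow> ('a,'b) fw \<Rightarrow> bool" where
  "nf_WP t W w' \<longleftrightarrow> (\<exists>us ws. nletters W = us @ ws \<and> fletters w' = ws @ us \<and>
     ftgt C w' = C.vs ws (ntgt C W) \<and> shifts t (length ws) (length us + length ws) \<and>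
     hf1 H (sh1 CS (C.nrm w')) \<diamondop>\<^bsub>DS\<^esub> ev t =
     hf1 H (C.rho us ws (ntgt C W)) \<diamondop>\<^bsub>DS\<^esub> shs (blks W) (ntgt C W) \<diamondop>\<^bsub>DS\<^esub> sh1 DS (nn W))"

definition nf_WW :: "('a,'b) sm \<Rightarrow> ('a,'b) nw \<Rightarrow> ('a,'b) nw \<Rightarrow> bool" where
  "nf_WW t W W' \<longleftrightarrow> (\<exists>xs ys bss. blks W = xs @ ys \<and> concat bss = ys @ xs \<and>
     map concat bss = blks W' \<and> pok bss (ntgt C W') \<and>
     ntgt C W' = C.vs (concat ys) (ntgt C W) \<and>
     shifts t (length (concat ys)) (length (concat xs) + length (concat ys)) \<and>
     sh1 DS (nn W') \<diamondop>\<^bsub>DS\<^esub> ev t =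
     sh1 DS (pm bss (ntgt C W')) \<diamondop>\<^bsub>DS\<^esub> D.rho (map G xs) (map G ys) (lf0 F (ntgt C W)) \<diamondop>\<^bsub>DS\<^esub> sh1 DS (nn W))"

lemma bcyc_blks [simp]: "sowf (SSh W) \<Longrightarrow> bcyc (blks W) (ntgt C W)"
  by (simp add: bcyc_def)

lemma cyc_fletters [simp]: "sowf (SPsi w) \<Longrightarrow> C.cyc (fletters w) (ftgt C w)"
  by (simp add: C.cyc_def)

subsection \<open>Uniqueness of normal forms\<close>

lemma nf_PP_unique:
  assumes wf: "smwf C t" "smwf C u"
    and d: "smdom C t = SPsi w" "smdom C u = SPsi w" "smcod C t = SPsi w'" "smcod C u = SPsi w'"
    and nf: "nf_PP t w w'" "nf_PP u w w'"
    and p: "\<forall>p<length (fletters w). smperm t p = smperm u p"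
  shows "ev t = ev u"
proof -
  have o: "sowf (SPsi w)" "sowf (SPsi w')" using wf d sowf_smdom[of t] sowf_smcod[of t] by auto
  from nf obtain us ws us' ws' where
    1: "fletters w = us @ ws" "shifts t (length ws) (length us + length ws)"
      "hf1 H (sh1 CS (C.nrm w')) \<diamondop>\<^bsub>DS\<^esub> ev t = hf1 H (C.rho us ws (ftgt C w)) \<diamondop>\<^bsub>DS\<^esub> hf1 H (sh1 CS (C.nrm w))" and
    2: "fletters w = us' @ ws'" "shifts u (length ws') (length us' + length ws')"
      "hf1 H (sh1 CS (C.nrm w')) \<diamondop>\<^bsub>DS\<^esub> ev u = hf1 H (C.rho us' ws' (ftgt C w)) \<diamondop>\<^bsub>DS\<^esub> hf1 H (sh1 CS (C.nrm w))"
    unfolding nf_PP_def by blast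
  have l: "length us' + length ws' = length us + length ws"
    using 1(1) 2(1) by (metis length_append)
  have "length ws mod (length us + length ws) = length ws' mod (length us + length ws)"
    by (rule shifts_unique[OF 1(2) 2(2)[unfolded l]]) (use p 1(1) l in auto)
  then have "C.rho us ws (ftgt C w) = C.rho us' ws' (ftgt C w)"
    using 1(1) 2(1) cyc_fletters[OF o(1)] by (intro C.rho_unique) auto
  then have "hf1 H (sh1 CS (C.nrm w')) \<diamondop>\<^bsub>DS\<^esub> ev t = hf1 H (sh1 CS (C.nrm w')) \<diamondop>\<^bsub>DS\<^esub> ev u"
    using 1(3) 2(3) by simp
  then show ?thesis by (rule H_sh1_cancel_left) (use o wf d in auto)
qed

lemma nf_WP_unique:
  assumes wf: "smwf C t" "smwf C u"
    and d: "smdom C t = SSh W" "smdom C u = SSh W" "smcod C t = SPsi w'" "smcod C u = SPsi w'"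
    and nf: "nf_WP t W w'" "nf_WP u W w'"
    and p: "\<forall>p<length (nletters W). smperm t p = smperm u p"
  shows "ev t = ev u"
proof -
  have o: "sowf (SSh W)" "sowf (SPsi w')" using wf d sowf_smdom[of t] sowf_smcod[of t] by auto
  let ?r = "shs (blks W) (ntgt C W) \<diamondop>\<^bsub>DS\<^esub> sh1 DS (nn W)"
  from nf obtain us ws us' ws' where
    1: "nletters W = us @ ws" "shifts t (length ws) (length us + length ws)"
      "hf1 H (sh1 CS (C.nrm w')) \<diamondop>\<^bsub>DS\<^esub> ev t = hf1 H (C.rho us ws (ntgt C W)) \<diamondop>\<^bsub>DS\<^esub> ?r" and
    2: "nletters W = us' @ ws'" "shifts u (length ws') (length us' + length ws')"
      "hf1 H (sh1 CS (C.nrm w')) \<diamondop>\<^bsub>DS\<^esub> ev u = hf1 H (C.rho us' ws' (ntgt C W)) \<diamondop>\<^bsub>DS\<^esub> ?r"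
    unfolding nf_WP_def by blast
  have l: "length us' + length ws' = length us + length ws"
    using 1(1) 2(1) by (metis length_append)
  have "length ws mod (length us + length ws) = length ws' mod (length us + length ws)"
    by (rule shifts_unique[OF 1(2) 2(2)[unfolded l]]) (use p 1(1) l in auto)
  moreover have "C.cyc (us @ ws) (ntgt C W)" using o(1) by (auto simp: C.cyc_def simp flip: 1(1) C.chn_append C.vs_append)
  ultimately have "C.rho us ws (ntgt C W) = C.rho us' ws' (ntgt C W)"
    using 1(1) 2(1) by (intro C.rho_unique) auto
  then have "hf1 H (sh1 CS (C.nrm w')) \<diamondop>\<^bsub>DS\<^esub> ev t = hf1 H (sh1 CS (C.nrm w')) \<diamondop>\<^bsub>DS\<^esub> ev u"
    using 1(3) 2(3) by simp
  then show ?thesis by (rule H_sh1_cancel_left) (use o wf d in auto)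
qed

lemma concat_bok_Nil [simp]: "bok bs A \<Longrightarrow> concat bs = [] \<longleftrightarrow> bs = []"
  by (auto dest: concat_nonempty)

text \<open>Two different cuts have at least one block, hence a letter, between them. So the letter
  shift fixes the cut, up to confusing the zero turn with the full turn.\<close>

lemma block_rotation_unique:
  assumes b: "bok (xs @ ys) A" and e: "xs @ ys = xs' @ ys'"
    and n: "length (concat ys) mod (length (concat xs) + length (concat ys)) =
      length (concat ys') mod (length (concat xs) + length (concat ys))"
  shows "xs = xs' \<and> ys = ys' \<or> xs = [] \<and> ys' = [] \<or> ys = [] \<and> xs' = []"
proof -
  have b': "bok (xs' @ ys') A" using b e by simp
  have ce: "concat xs @ concat ys = concat xs' @ concat ys'" using arg_cong[OF e, of concat] by simp
  have "xs = xs' \<and> ys = ys'" if "concat xs = concat xs'"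
  proof -
    from e consider m where "xs = xs' @ m" | m where "xs' = xs @ m"
      by (auto simp: append_eq_append_conv2)
    then have "xs = xs'"
    proof cases
      case 1
      then have "concat m = []" using that by simp
      then show ?thesis using 1 b by (auto simp del: concat_eq_Nil_conv)
    next
      case 2
      then have "concat m = []" using that by simp
      then show ?thesis using 2 b' by (auto simp del: concat_eq_Nil_conv)
    qed
    then show ?thesis using e by simp
  qed
  with append_eq_mod_length[OF ce n] b b' show ?thesis
    by (auto simp del: concat_eq_Nil_conv)
qed

lemma nf_WW_unique:
  assumes wf: "smwf C t" "smwf C u"
    and d: "smdom C t = SSh W" "smdom C u = SSh W" "smcod C t = SSh W'" "smcod C u = SSh W'"
    and nf: "nf_WW t W W'" "nf_WW u W W'"
    and p: "\<forall>p<length (nletters W). smperm t p = smperm u p"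
  shows "ev t = ev u"
proof -
  have o: "sowf (SSh W)" "sowf (SSh W')" using wf d sowf_smdom[of t] sowf_smcod[of t] by auto
  from nf(1) obtain xs ys bss where
    1: "blks W = xs @ ys" "concat bss = ys @ xs" "map concat bss = blks W'" "pok bss (ntgt C W')"
      "shifts t (length (concat ys)) (length (concat xs) + length (concat ys))"
      "sh1 DS (nn W') \<diamondop>\<^bsub>DS\<^esub> ev t = sh1 DS (pm bss (ntgt C W')) \<diamondop>\<^bsub>DS\<^esub>
       D.rho (map G xs) (map G ys) (lf0 F (ntgt C W)) \<diamondop>\<^bsub>DS\<^esub> sh1 DS (nn W)"
    unfolding nf_WW_def by blast
  from nf(2) obtain xs' ys' css where
    2: "blks W = xs' @ ys'" "concat css = ys' @ xs'" "map concat css = blks W'" "pok css (ntgt C W')"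
      "shifts u (length (concat ys')) (length (concat xs') + length (concat ys'))"
      "sh1 DS (nn W') \<diamondop>\<^bsub>DS\<^esub> ev u = sh1 DS (pm css (ntgt C W')) \<diamondop>\<^bsub>DS\<^esub>
       D.rho (map G xs') (map G ys') (lf0 F (ntgt C W)) \<diamondop>\<^bsub>DS\<^esub> sh1 DS (nn W)"
    unfolding nf_WW_def by blast
  have e: "concat xs @ concat ys = nletters W" "concat xs' @ concat ys' = nletters W"
    using arg_cong[OF 1(1), of concat] arg_cong[OF 2(1), of concat] by simp_all
  have l: "length (concat xs') + length (concat ys') = length (concat xs) + length (concat ys)"
    "length (nletters W) = length (concat xs) + length (concat ys)"
    using arg_cong[OF e(1), of length] arg_cong[OF e(2), of length] by simp_all
  have "length (concat ys) mod (length (concat xs) + length (concat ys)) =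
      length (concat ys') mod (length (concat xs) + length (concat ys))"
    by (rule shifts_unique[OF 1(5) 2(5)[unfolded l(1)]]) (use p l in auto)
  moreover have b: "bcyc (xs @ ys) (ntgt C W)" using bcyc_blks[OF o(1)] 1(1) by simp
  ultimately have c: "xs = xs' \<and> ys = ys' \<or> xs = [] \<and> ys' = [] \<or> ys = [] \<and> xs' = []"
    using 1(1) 2(1) by (intro block_rotation_unique) (auto simp: bcyc_def)
  \<comment> \<open>The zero turn and the full turn produce the same block list, so in every case
    \<open>bss\<close> and \<open>css\<close> group one and the same list.\<close>
  then have "ys @ xs = ys' @ xs'" using 1(1) 2(1) by auto
  then have "bss = css"
    using 1(2-4) 2(2,3) by (intro grouping_unique) (simp_all add: pok_def bok_def)
  moreover have "D.rho (map G xs) (map G ys) (lf0 F (ntgt C W)) = D.rho (map G xs') (map G ys') (lf0 F (ntgt C W))"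
    using c 1(1) 2(1) bcyc_cyc_G[OF b] by auto
  ultimately have "sh1 DS (nn W') \<diamondop>\<^bsub>DS\<^esub> ev t = sh1 DS (nn W') \<diamondop>\<^bsub>DS\<^esub> ev u"
    using 1(6) 2(6) by simp
  then show ?thesis by (rule D.sh1_iso_cancel_left) (use o wf d in auto)
qed

end

lemma (in bicategory) vs_nonempty: "xs \<noteq> [] \<Longrightarrow> vs xs A = vs xs A'"
  by (cases xs) auto

context normal_lax_shadow
begin

subsection \<open>Existence of normal forms\<close>

lemma shifts_len:
  assumes "shifts f (length ws) (length us + length ws)" "shifts g (length ws') (length us' + length ws')"
    and "ws @ us = us' @ ws'"
    and "\<forall>h :: 'x \<Rightarrow> nat. sum_list (map h ws'') mod sum_list (map h (us @ ws)) =
      (sum_list (map h ws) + sum_list (map h ws')) mod sum_list (map h (us @ ws))"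
    and "us'' @ ws'' = us @ (ws :: 'x list)"
  shows "shifts (SV g f) (length ws'') (length us'' + length ws'')"
proof -
  have l: "length us' + length ws' = length us + length ws"
    using arg_cong[OF assms(3), of length] by simp
  have l': "length us'' + length ws'' = length us + length ws"
    using arg_cong[OF assms(5), of length] by simp
  have "length ws'' mod (length us + length ws) = (length ws + length ws') mod (length us + length ws)"
    using assms(4)[rule_format, of "\<lambda>_. 1"] by (simp add: sum_list_triv)
  then show ?thesis
    using shifts_SV[OF assms(1) assms(2)[unfolded l]] by (simp only: l')
qed

context
  fixes f g :: "('a,'b) sm"
  assumes wf: "smwf C f" "smwf C g" and fg: "smcod C f = smdom C g"
begin

lemma nf_PP_PP:
  assumes d: "smdom C f = SPsi w" "smcod C f = SPsi w'" "smcod C g = SPsi w''"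
    and nf: "nf_PP f w w'" "nf_PP g w' w''"
  shows "nf_PP (SV g f) w w''"
proof -
  have o: "sowf (SPsi w)" "sowf (SPsi w')" "sowf (SPsi w'')"
    using wf d sowf_smdom[of f] sowf_smcod[of f] sowf_smcod[of g] by auto
  have d': "smdom C g = SPsi w'" using fg d by simp
  from nf obtain us ws us' ws' where
    1: "fletters w = us @ ws" "fletters w' = ws @ us" "ftgt C w' = C.vs ws (ftgt C w)"
      "shifts f (length ws) (length us + length ws)"
      "hf1 H (sh1 CS (C.nrm w')) \<diamondop>\<^bsub>DS\<^esub> ev f = hf1 H (C.rho us ws (ftgt C w)) \<diamondop>\<^bsub>DS\<^esub> hf1 H (sh1 CS (C.nrm w))" and
    2: "fletters w' = us' @ ws'" "fletters w'' = ws' @ us'" "ftgt C w'' = C.vs ws' (ftgt C w')"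
      "shifts g (length ws') (length us' + length ws')"
      "hf1 H (sh1 CS (C.nrm w'')) \<diamondop>\<^bsub>DS\<^esub> ev g = hf1 H (C.rho us' ws' (ftgt C w')) \<diamondop>\<^bsub>DS\<^esub> hf1 H (sh1 CS (C.nrm w'))"
    unfolding nf_PP_def by metis
  have c: "C.cyc (us @ ws) (ftgt C w)" and c': "C.cyc (us' @ ws') (ftgt C w')"
    using cyc_fletters[OF o(1)] cyc_fletters[OF o(2)] 1(1) 2(1) by simp_all
  have e: "ws @ us = us' @ ws'" using 1(2) 2(1) by simp
  obtain us'' ws'' where 3: "us'' @ ws'' = us @ ws" "ws'' @ us'' = ws' @ us'"
    "C.vs ws'' (ftgt C w) = C.vs ws' (C.vs ws (ftgt C w))"
    "C.rho us' ws' (C.vs ws (ftgt C w)) \<diamondop>\<^bsub>CS\<^esub> C.rho us ws (ftgt C w) = C.rho us'' ws'' (ftgt C w)"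
    "\<forall>h :: 'b \<Rightarrow> nat. sum_list (map h ws'') mod sum_list (map h (us @ ws)) =
      (sum_list (map h ws) + sum_list (map h ws')) mod sum_list (map h (us @ ws))"
    by (rule C.rho_comp[where g = id, unfolded list.map_id, OF c e])
  have t: "sdom CS (C.rho us' ws' (ftgt C w')) = scod CS (C.rho us ws (ftgt C w))"
    using c c' 1(3) e by (simp flip: C.ap_append)
  have "hf1 H (sh1 CS (C.nrm w'')) \<diamondop>\<^bsub>DS\<^esub> ev (SV g f) =
    (hf1 H (sh1 CS (C.nrm w'')) \<diamondop>\<^bsub>DS\<^esub> ev g) \<diamondop>\<^bsub>DS\<^esub> ev f"
    using o wf d d' by simp
  also have "\<dots> = hf1 H (C.rho us' ws' (ftgt C w')) \<diamondop>\<^bsub>DS\<^esub> hf1 H (sh1 CS (C.nrm w')) \<diamondop>\<^bsub>DS\<^esub> ev f"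
    unfolding 2(5) using o wf d d' c' 2(1) by simp
  also have "\<dots> = hf1 H (C.rho us' ws' (ftgt C w') \<diamondop>\<^bsub>CS\<^esub> C.rho us ws (ftgt C w)) \<diamondop>\<^bsub>DS\<^esub> hf1 H (sh1 CS (C.nrm w))"
    unfolding 1(5) H_sc[OF t[symmetric]] by (rule D.sc_assoc[symmetric]) (use o c t 1(1) in auto)
  also have "\<dots> = hf1 H (C.rho us'' ws'' (ftgt C w)) \<diamondop>\<^bsub>DS\<^esub> hf1 H (sh1 CS (C.nrm w))"
    using 3(4) 1(3) by simp
  finally show ?thesis
    unfolding nf_PP_def using 1 2 3 shifts_len[OF 1(4) 2(4) e 3(5) 3(1)]
    by (intro exI[of _ us''] exI[of _ ws'']) (simp only:)
qed

lemma nf_WP_PP: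
  assumes d: "smdom C f = SSh W" "smcod C f = SPsi w'" "smcod C g = SPsi w''"
    and nf: "nf_WP f W w'" "nf_PP g w' w''"
  shows "nf_WP (SV g f) W w''"
proof -
  have o: "sowf (SSh W)" "sowf (SPsi w')" "sowf (SPsi w'')"
    using wf d sowf_smdom[of f] sowf_smcod[of f] sowf_smcod[of g] by auto
  have d': "smdom C g = SPsi w'" using fg d by simp
  let ?A = "ntgt C W"
  let ?r = "shs (blks W) ?A \<diamondop>\<^bsub>DS\<^esub> sh1 DS (nn W)"
  from nf obtain us ws us' ws' where
    1: "nletters W = us @ ws" "fletters w' = ws @ us" "ftgt C w' = C.vs ws ?A"
      "shifts f (length ws) (length us + length ws)"
      "hf1 H (sh1 CS (C.nrm w')) \<diamondop>\<^bsub>DS\<^esub> ev f = hf1 H (C.rho us ws ?A) \<diamondop>\<^bsub>DS\<^esub> ?r" and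
    2: "fletters w' = us' @ ws'" "fletters w'' = ws' @ us'" "ftgt C w'' = C.vs ws' (ftgt C w')"
      "shifts g (length ws') (length us' + length ws')"
      "hf1 H (sh1 CS (C.nrm w'')) \<diamondop>\<^bsub>DS\<^esub> ev g = hf1 H (C.rho us' ws' (ftgt C w')) \<diamondop>\<^bsub>DS\<^esub> hf1 H (sh1 CS (C.nrm w'))"
    unfolding nf_PP_def nf_WP_def by metis
  have b: "bcyc (blks W) ?A" using o(1) by (rule bcyc_blks)
  have c: "C.cyc (us @ ws) ?A" and c': "C.cyc (us' @ ws') (ftgt C w')"
    using bcyc_cyc[OF b] cyc_fletters[OF o(2)] 1(1) 2(1) by simp_all
  have e: "ws @ us = us' @ ws'" using 1(2) 2(1) by simp
  obtain us'' ws'' where 3: "us'' @ ws'' = us @ ws" "ws'' @ us'' = ws' @ us'"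
    "C.vs ws'' ?A = C.vs ws' (C.vs ws ?A)"
    "C.rho us' ws' (C.vs ws ?A) \<diamondop>\<^bsub>CS\<^esub> C.rho us ws ?A = C.rho us'' ws'' ?A"
    "\<forall>h :: 'b \<Rightarrow> nat. sum_list (map h ws'') mod sum_list (map h (us @ ws)) =
      (sum_list (map h ws) + sum_list (map h ws')) mod sum_list (map h (us @ ws))"
    by (rule C.rho_comp[where g = id, unfolded list.map_id, OF c e])
  have t: "sdom CS (C.rho us' ws' (ftgt C w')) = scod CS (C.rho us ws ?A)"
    using c c' 1(3) e by (simp flip: C.ap_append)
  have r: "scod DS ?r = hf0 H (sdom CS (C.rho us ws ?A))"
    using b o c 1(1) by simp
  have "hf1 H (sh1 CS (C.nrm w'')) \<diamondop>\<^bsub>DS\<^esub> ev (SV g f) =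
    (hf1 H (sh1 CS (C.nrm w'')) \<diamondop>\<^bsub>DS\<^esub> ev g) \<diamondop>\<^bsub>DS\<^esub> ev f"
    using o wf d d' by simp
  also have "\<dots> = hf1 H (C.rho us' ws' (ftgt C w')) \<diamondop>\<^bsub>DS\<^esub> hf1 H (sh1 CS (C.nrm w')) \<diamondop>\<^bsub>DS\<^esub> ev f"
    unfolding 2(5) using o wf d d' c' 2(1) by simp
  also have "\<dots> = hf1 H (C.rho us' ws' (ftgt C w') \<diamondop>\<^bsub>CS\<^esub> C.rho us ws ?A) \<diamondop>\<^bsub>DS\<^esub> ?r"
    unfolding 1(5) H_sc[OF t[symmetric]] by (rule D.sc_assoc[symmetric]) (use t r in auto)
  also have "\<dots> = hf1 H (C.rho us'' ws'' ?A) \<diamondop>\<^bsub>DS\<^esub> ?r"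
    using 3(4) 1(3) by simp
  finally show ?thesis
    unfolding nf_WP_def using 1 2 3 shifts_len[OF 1(4) 2(4) e 3(5) 3(1)]
    by (intro exI[of _ us''] exI[of _ ws'']) (simp only:)
qed

text \<open>Total multiplication absorbs the merging of \<open>f\<close> by \<open>shs_pm\<close>,
  and \<open>shs_rho\<close> turns its block rotation into a letter rotation, which composes with
  that of \<open>g\<close>.\<close>

lemma nf_WW_WP:
  assumes d: "smdom C f = SSh W" "smcod C f = SSh W'" "smcod C g = SPsi w''"
    and nf: "nf_WW f W W'" "nf_WP g W' w''"
  shows "nf_WP (SV g f) W w''"
proof -
  have o: "sowf (SSh W)" "sowf (SSh W')" "sowf (SPsi w'')"
    using wf d sowf_smdom[of f] sowf_smcod[of f] sowf_smcod[of g] by auto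
  have d': "smdom C g = SSh W'" using fg d by simp
  let ?A = "ntgt C W" and ?A' = "ntgt C W'"
  from nf(1) obtain xs ys bss where
    1: "blks W = xs @ ys" "concat bss = ys @ xs" "map concat bss = blks W'" "pok bss ?A'"
      "?A' = C.vs (concat ys) ?A"
      "shifts f (length (concat ys)) (length (concat xs) + length (concat ys))"
      "sh1 DS (nn W') \<diamondop>\<^bsub>DS\<^esub> ev f = sh1 DS (pm bss ?A') \<diamondop>\<^bsub>DS\<^esub>
       D.rho (map G xs) (map G ys) (lf0 F ?A) \<diamondop>\<^bsub>DS\<^esub> sh1 DS (nn W)"
    unfolding nf_WW_def by blast
  from nf(2) obtain us' ws' where
    2: "nletters W' = us' @ ws'" "fletters w'' = ws' @ us'" "ftgt C w'' = C.vs ws' ?A'"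
      "shifts g (length ws') (length us' + length ws')"
      "hf1 H (sh1 CS (C.nrm w'')) \<diamondop>\<^bsub>DS\<^esub> ev g =
       hf1 H (C.rho us' ws' ?A') \<diamondop>\<^bsub>DS\<^esub> shs (blks W') ?A' \<diamondop>\<^bsub>DS\<^esub> sh1 DS (nn W')"
    unfolding nf_WP_def by blast
  let ?us = "concat xs" and ?ws = "concat ys" and ?rD = "D.rho (map G xs) (map G ys) (lf0 F ?A)"
  have b: "bcyc (xs @ ys) ?A" and b': "bcyc (map concat bss) ?A'"
    using bcyc_blks[OF o(1)] bcyc_blks[OF o(2)] 1(1,3) by simp_all
  have b2: "bcyc (ys @ xs) ?A'" using bcyc_rotate[OF b] 1(5) by simp
  have c: "C.cyc (?us @ ?ws) ?A" using bcyc_cyc[OF b] by simp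
  have cD: "D.cyc (map G xs @ map G ys) (lf0 F ?A)" using bcyc_cyc_G[OF b] by simp
  have vD: "D.vs (map G ys) (lf0 F ?A) = lf0 F ?A'" using b 1(5) by (simp add: bcyc_def)
  have nl: "nletters W = ?us @ ?ws" using arg_cong[OF 1(1), of concat] by simp
  have "concat (blks W') = ?ws @ ?us" using arg_cong[OF 1(2), of concat] by (simp flip: 1(3))
  then have e: "?ws @ ?us = us' @ ws'" using 2(1) by simp
  have c': "C.cyc (us' @ ws') ?A'" using bcyc_cyc[OF b2] by (simp add: e del: C.chn_append C.vs_append)
  obtain us'' ws'' where 3: "us'' @ ws'' = ?us @ ?ws" "ws'' @ us'' = ws' @ us'"
    "C.vs ws'' ?A = C.vs ws' (C.vs ?ws ?A)"
    "C.rho us' ws' (C.vs ?ws ?A) \<diamondop>\<^bsub>CS\<^esub> C.rho ?us ?ws ?A = C.rho us'' ws'' ?A"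
    "\<forall>h :: 'b \<Rightarrow> nat. sum_list (map h ws'') mod sum_list (map h (?us @ ?ws)) =
      (sum_list (map h ?ws) + sum_list (map h ws')) mod sum_list (map h (?us @ ?ws))"
    by (rule C.rho_comp[where g = id, unfolded list.map_id, OF c e])
  have t: "sdom CS (C.rho us' ws' ?A') = scod CS (C.rho ?us ?ws ?A)"
    using c c' 1(5) e by (simp flip: C.ap_append)
  have nW: "scod DS (sh1 DS (nn W)) = sh0 DS (nb (xs @ ys) ?A)" using o 1(1) by simp
  have ec: "C.nf (us' @ ws') ?A' = C.nf (?ws @ ?us) ?A'" by (simp only: e)
  have "hf1 H (sh1 CS (C.nrm w'')) \<diamondop>\<^bsub>DS\<^esub> ev (SV g f) =
    (hf1 H (sh1 CS (C.nrm w'')) \<diamondop>\<^bsub>DS\<^esub> ev g) \<diamondop>\<^bsub>DS\<^esub> ev f"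
    using o wf d d' by simp
  also have "\<dots> = hf1 H (C.rho us' ws' ?A') \<diamondop>\<^bsub>DS\<^esub> shs (blks W') ?A' \<diamondop>\<^bsub>DS\<^esub> sh1 DS (nn W') \<diamondop>\<^bsub>DS\<^esub> ev f"
    unfolding 2(5) using o wf d d' c' 2(1) bcyc_blks[OF o(2)] by simp
  also have "\<dots> = hf1 H (C.rho us' ws' ?A') \<diamondop>\<^bsub>DS\<^esub> (shs (map concat bss) ?A' \<diamondop>\<^bsub>DS\<^esub> sh1 DS (pm bss ?A')) \<diamondop>\<^bsub>DS\<^esub>
      ?rD \<diamondop>\<^bsub>DS\<^esub> sh1 DS (nn W)"
    unfolding 1(7) 1(3)[symmetric] using b' 1(2,4) cD vD nW b2 by (simp add: bcyc_def)
  also have "shs (map concat bss) ?A' \<diamondop>\<^bsub>DS\<^esub> sh1 DS (pm bss ?A') = shs (ys @ xs) ?A'"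
    using shs_pm[OF 1(4)] b2 1(2) by simp
  also have "hf1 H (C.rho us' ws' ?A') \<diamondop>\<^bsub>DS\<^esub> shs (ys @ xs) ?A' \<diamondop>\<^bsub>DS\<^esub> ?rD \<diamondop>\<^bsub>DS\<^esub> sh1 DS (nn W) =
    hf1 H (C.rho us' ws' ?A') \<diamondop>\<^bsub>DS\<^esub> (hf1 H (C.rho ?us ?ws ?A) \<diamondop>\<^bsub>DS\<^esub> shs (xs @ ys) ?A) \<diamondop>\<^bsub>DS\<^esub> sh1 DS (nn W)"
    using D.sc_chain[OF shs_rho[OF b], of "sh1 DS (nn W)"] b2 cD vD nW by (simp add: 1(5))
  also have "\<dots> = hf1 H (C.rho us' ws' ?A' \<diamondop>\<^bsub>CS\<^esub> C.rho ?us ?ws ?A) \<diamondop>\<^bsub>DS\<^esub> shs (xs @ ys) ?A \<diamondop>\<^bsub>DS\<^esub> sh1 DS (nn W)"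
    unfolding H_sc[OF t[symmetric]] using t b c nW by simp
  also have "\<dots> = hf1 H (C.rho us'' ws'' ?A) \<diamondop>\<^bsub>DS\<^esub> shs (xs @ ys) ?A \<diamondop>\<^bsub>DS\<^esub> sh1 DS (nn W)"
    using 3(4) 1(5) by simp
  finally show ?thesis
    unfolding nf_WP_def using nl 2(2,3) 1(1,5) 3(1-3) shifts_len[OF 1(6) 2(4) e 3(5) 3(1)]
    by (intro exI[of _ us''] exI[of _ ws'']) (simp only:)
qed

text \<open>\<open>rho_pm\<close> moves the rotation of \<open>g\<close> before the merging of
  \<open>f\<close>. Then the two rotations compose by \<open>rho_comp\<close> and the two mergings
  by \<open>pm_comp_ex\<close>.\<close>

lemma nf_WW_WW:
  assumes d: "smdom C f = SSh W" "smcod C f = SSh W'" "smcod C g = SSh W''"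
    and nf: "nf_WW f W W'" "nf_WW g W' W''"
  shows "nf_WW (SV g f) W W''"
proof -
  have o: "sowf (SSh W)" "sowf (SSh W')" "sowf (SSh W'')"
    using wf d sowf_smdom[of f] sowf_smcod[of f] sowf_smcod[of g] by auto
  have d': "smdom C g = SSh W'" using fg d by simp
  let ?A = "ntgt C W" and ?A' = "ntgt C W'" and ?A'' = "ntgt C W''"
  from nf(1) obtain xs ys bss where
    1: "blks W = xs @ ys" "concat bss = ys @ xs" "map concat bss = blks W'" "pok bss ?A'"
      "?A' = C.vs (concat ys) ?A"
      "shifts f (length (concat ys)) (length (concat xs) + length (concat ys))"
      "sh1 DS (nn W') \<diamondop>\<^bsub>DS\<^esub> ev f = sh1 DS (pm bss ?A') \<diamondop>\<^bsub>DS\<^esub>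
       D.rho (map G xs) (map G ys) (lf0 F ?A) \<diamondop>\<^bsub>DS\<^esub> sh1 DS (nn W)"
    unfolding nf_WW_def by blast
  from nf(2) obtain xs' ys' css where
    2: "blks W' = xs' @ ys'" "concat css = ys' @ xs'" "map concat css = blks W''" "pok css ?A''"
      "?A'' = C.vs (concat ys') ?A'"
      "shifts g (length (concat ys')) (length (concat xs') + length (concat ys'))"
      "sh1 DS (nn W'') \<diamondop>\<^bsub>DS\<^esub> ev g = sh1 DS (pm css ?A'') \<diamondop>\<^bsub>DS\<^esub>
       D.rho (map G xs') (map G ys') (lf0 F ?A') \<diamondop>\<^bsub>DS\<^esub> sh1 DS (nn W')"
    unfolding nf_WW_def by blast
  \<comment> \<open>\<open>g\<close> cuts between blocks that \<open>f\<close> has merged, so the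
    cut splits the grouping \<open>bss\<close> at a group boundary.\<close>
  from 1(3) 2(1) obtain xss yss where s: "bss = xss @ yss" "xs' = map concat xss" "ys' = map concat yss"
    by (auto simp: map_eq_append_conv)
  let ?rD = "D.rho (map G xs) (map G ys) (lf0 F ?A)" and ?rD' = "D.rho (map G xs') (map G ys') (lf0 F ?A')"
  let ?us = "concat xss" and ?ws = "concat yss"
  let ?rE = "D.rho (map G ?us) (map G ?ws) (lf0 F ?A')"
  have b: "bcyc (xs @ ys) ?A" and b': "bcyc (xs' @ ys') ?A'"
    using bcyc_blks[OF o(1)] bcyc_blks[OF o(2)] 1(1) 2(1) by simp_all
  have b2: "bcyc (ys @ xs) ?A'" using bcyc_rotate[OF b] 1(5) by simp
  have b2': "bcyc (ys' @ xs') ?A''" using bcyc_rotate[OF b'] 2(5) by simp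
  have e: "ys @ xs = ?us @ ?ws" using 1(2) s(1) by simp
  have p: "pok (xss @ yss) ?A'" using 1(4) s(1) by simp
  have A'': "?A'' = C.vs (concat ?ws) ?A'" using 2(5) s(3) by simp
  have bE: "bcyc (?us @ ?ws) ?A'" using b2 e by simp
  have p': "pok (yss @ xss) ?A''" using p bE by (auto simp: A'' bcyc_def)
  have cD: "D.cyc (map G xs @ map G ys) (lf0 F ?A)" using bcyc_cyc_G[OF b] by simp
  have cD': "D.cyc (map G xs' @ map G ys') (lf0 F ?A')" using bcyc_cyc_G[OF b'] by simp
  have cE: "D.cyc (map G ?us @ map G ?ws) (lf0 F ?A')" using bcyc_cyc_G[OF bE] by simp
  have vD: "D.vs (map G ys) (lf0 F ?A) = lf0 F ?A'" using b 1(5) by (simp add: bcyc_def)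
  have vD': "D.vs (map G ys') (lf0 F ?A') = lf0 F ?A''" using b' 2(5) by (simp add: bcyc_def)
  have vE: "D.vs (map G ?ws) (lf0 F ?A') = lf0 F ?A''" using bE A'' by (simp add: bcyc_def)
  have eG: "map G ys @ map G xs = map G ?us @ map G ?ws" using arg_cong[OF e, of "map G"] by simp
  obtain us ws where 3: "us @ ws = xs @ ys" "ws @ us = ?ws @ ?us"
    "D.vs (map G ws) (lf0 F ?A) = D.vs (map G ?ws) (D.vs (map G ys) (lf0 F ?A))"
    "D.rho (map G ?us) (map G ?ws) (D.vs (map G ys) (lf0 F ?A)) \<diamondop>\<^bsub>DS\<^esub> ?rD = D.rho (map G us) (map G ws) (lf0 F ?A)"
    "\<forall>h :: 'b list \<Rightarrow> nat. sum_list (map h ws) mod sum_list (map h (xs @ ys)) =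
      (sum_list (map h ys) + sum_list (map h ?ws)) mod sum_list (map h (xs @ ys))"
    by (rule D.rho_comp[where g = G, OF bcyc_cyc_G[OF b] e])
  have bu: "bcyc (us @ ws) ?A" using b 3(1) by simp
  have sh: "shifts (SV g f) (length (concat ws)) (length (concat us) + length (concat ws))"
  proof -
    have cc: "concat us @ concat ws = concat xs @ concat ys" "concat ys @ concat xs = concat xs' @ concat ys'"
      using arg_cong[OF 3(1), of concat] arg_cong[OF e, of concat] by (simp_all add: s)
    have l: "length (concat us) + length (concat ws) = length (concat xs) + length (concat ys)"
      "length (concat xs') + length (concat ys') = length (concat xs) + length (concat ys)"
      using arg_cong[OF cc(1), of length] arg_cong[OF cc(2), of length] by simp_all
    \<comment> \<open>The weight \<open>length\<close> in \<open>rho_comp\<close> counts letters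
      where the cuts are made between blocks.\<close>
    have "length (concat ws) mod (length (concat xs) + length (concat ys)) =
      (length (concat ys) + length (concat ys')) mod (length (concat xs) + length (concat ys))"
      using 3(5)[rule_format, of length] by (simp add: length_concat s)
    then show ?thesis using shifts_SV[OF 1(6) 2(6)[unfolded l]] by (simp only: l)
  qed
  obtain dss where 4: "pok dss ?A''" "concat dss = ?ws @ ?us" "map concat dss = blks W''"
    "pm css ?A'' \<bullet> pm (yss @ xss) ?A'' = pm dss ?A''"
    using pm_comp_ex[OF p' 2(4)] 2(2,3) s by auto
  \<comment> \<open>If letters are present, both vertices are the source of the first letter of
    \<open>concat (ws @ us)\<close>; if there are none, neither rotation changes the vertex.\<close>
  have pv: "C.vs (concat ws) ?A = ?A''"
  proof (cases "concat (ws @ us) = []")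
    case True
    then have "concat ws = []" "concat ?ws = []" "concat ys = []"
      using arg_cong[OF 3(1), of concat] arg_cong[OF 3(2), of concat]
      by (auto simp del: concat_eq_Nil_conv)
    then show ?thesis using A'' 1(5) by (simp del: concat_eq_Nil_conv)
  next
    case False
    have "C.vs (concat (ws @ us)) (C.vs (concat ws) ?A) = C.vs (concat ws) ?A"
      using bcyc_rotate[OF bu] by (simp only: bcyc_def)
    moreover have "C.vs (concat (ws @ us)) ?A'' = ?A''"
      using bcyc_rotate[OF bE] by (simp only: bcyc_def 3(2) A'')
    ultimately show ?thesis using False C.vs_nonempty by metis
  qed
  have nW: "scod DS (sh1 DS (nn W)) = sh0 DS (nb (xs @ ys) ?A)" using o 1(1) by simp
  have "sh1 DS (nn W'') \<diamondop>\<^bsub>DS\<^esub> ev (SV g f) = (sh1 DS (nn W'') \<diamondop>\<^bsub>DS\<^esub> ev g) \<diamondop>\<^bsub>DS\<^esub> ev f"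
    using o wf d d' by simp
  also have "\<dots> = sh1 DS (pm css ?A'') \<diamondop>\<^bsub>DS\<^esub> ?rD' \<diamondop>\<^bsub>DS\<^esub> sh1 DS (nn W') \<diamondop>\<^bsub>DS\<^esub> ev f"
    unfolding 2(7) using o wf d d' b' b2' 2(1,2,4) cD' vD' by (simp add: bcyc_def)
  also have "\<dots> = sh1 DS (pm css ?A'') \<diamondop>\<^bsub>DS\<^esub> (?rD' \<diamondop>\<^bsub>DS\<^esub> sh1 DS (pm (xss @ yss) ?A')) \<diamondop>\<^bsub>DS\<^esub> ?rD \<diamondop>\<^bsub>DS\<^esub> sh1 DS (nn W)"
    unfolding 1(7) using p 1(2) s b' cD cD' vD nW b2 by (simp add: bcyc_def)
  also have "?rD' \<diamondop>\<^bsub>DS\<^esub> sh1 DS (pm (xss @ yss) ?A') = sh1 DS (pm (yss @ xss) ?A'') \<diamondop>\<^bsub>DS\<^esub> ?rE"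
    using rho_pm[OF p] bE by (simp add: s A'')
  also have "sh1 DS (pm css ?A'') \<diamondop>\<^bsub>DS\<^esub> (sh1 DS (pm (yss @ xss) ?A'') \<diamondop>\<^bsub>DS\<^esub> ?rE) \<diamondop>\<^bsub>DS\<^esub> ?rD \<diamondop>\<^bsub>DS\<^esub> sh1 DS (nn W) =
    sh1 DS (pm css ?A'' \<bullet> pm (yss @ xss) ?A'') \<diamondop>\<^bsub>DS\<^esub> (?rE \<diamondop>\<^bsub>DS\<^esub> ?rD) \<diamondop>\<^bsub>DS\<^esub> sh1 DS (nn W)"
  proof -
    have "scod DS ?rD = sdom DS ?rE"
      using cD cE vD eG by (simp del: D.ap_append)
    moreover have "bcyc (?ws @ ?us) ?A''" using bcyc_rotate[OF bE] by (simp add: A'')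
    moreover have "scod DS ?rE = sh0 DS (nb (concat (yss @ xss)) ?A'')"
      using cE vE by simp
    moreover have "sdom DS ?rD = sh0 DS (nb (xs @ ys) ?A)" using cD by simp
    moreover have "concat css = map concat (yss @ xss)" using 2(2) s by simp
    ultimately show ?thesis using p' 2(4) nW
      by (simp add: D.sh1_vc bcyc_def del: D.sdom_rho D.scod_rho)
  qed
  also have "\<dots> = sh1 DS (pm dss ?A'') \<diamondop>\<^bsub>DS\<^esub> D.rho (map G us) (map G ws) (lf0 F ?A) \<diamondop>\<^bsub>DS\<^esub> sh1 DS (nn W)"
    using 3(4) 4(4) vD by simp
  finally show ?thesis
    unfolding nf_WW_def using 1(1) 3(1,2) 4(1-3) sh pv
    by (intro exI[of _ us] exI[of _ ws] exI[of _ dss]) (simp only:)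
qed

end

section \<open>Normal forms of the generating morphisms\<close>

lemma nf_PP_SPsi2:
  assumes "smwf C (SPsi2 a)"
  shows "nf_PP (SPsi2 a) (fdom C a) (fcod C a)"
proof -
  have "hf1 H (sh1 CS (C.nrm (fcod C a))) \<diamondop>\<^bsub>DS\<^esub> hf1 H (sh1 CS (f2ev C a)) = hf1 H (sh1 CS (C.nrm (fdom C a)))"
    using assms by (simp add: H_sc[symmetric] C.sh1_vc[symmetric] C.nrm_f2)
  moreover have "C.cyc (fletters (fdom C a)) (ftgt C (fdom C a))" using assms by (simp add: C.cyc_def)
  ultimately show ?thesis unfolding nf_PP_def using assms
    by (intro exI[of _ "fletters (fdom C a)"] exI[of _ "[]"]) (auto intro: shifts_id)
qed

lemma nf_PP_SPsiRot:
  assumes "smwf C (SPsiRot u v)"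
  shows "nf_PP (SPsiRot u v) (FC u v) (FC v u)"
proof -
  have c: "C.cyc (fletters u @ fletters v) (ftgt C v)" using assms by (simp add: C.cyc_def)
  have "hf1 H (sh1 CS (C.nrm (FC v u))) \<diamondop>\<^bsub>DS\<^esub> hf1 H (srot CS (fev C u) (fev C v)) =
    hf1 H (C.rho (fletters u) (fletters v) (ftgt C v)) \<diamondop>\<^bsub>DS\<^esub> hf1 H (sh1 CS (C.nrm (FC u v)))"
    using assms c C.nrm_rot[of u v]
    by (simp add: H_sc[symmetric] del: C.nrm.simps)
  then show ?thesis unfolding nf_PP_def using assms
    by (intro exI[of _ "fletters u"] exI[of _ "fletters v"]) (auto simp: shifts_def simp del: C.nrm.simps)
qed

text \<open>Naturality of \<open>s\<close> at \<open>nrm w\<close> moves this normalization into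
  \<open>D\<close>, where \<open>mu_nn\<close> factors it into \<open>nn\<close> followed by total
  multiplication.\<close>

lemma nf_WP_Ss:
  assumes "smwf C (Ss w)"
  shows "nf_WP (Ss w) (NPhi w) w"
proof -
  let ?A = "ftgt C w"
  have b: "bcyc (blks (NPhi w)) ?A" using assms bcyc_blks[of "NPhi w"] by simp
  have cb: "concat (blks (NPhi w)) = fletters w" by simp
  have "hf1 H (sh1 CS (C.nrm w)) \<diamondop>\<^bsub>DS\<^esub> s (fev C w) =
    s (C.nf (fletters w) ?A) \<diamondop>\<^bsub>DS\<^esub> sh1 DS (mu (blks (NPhi w)) ?A \<bullet> nn (NPhi w))"
    using assms s_nat[of "C.nrm w"] mu_nn[of w] by (simp del: nn.simps blks.simps)
  also have "\<dots> = shs (blks (NPhi w)) ?A \<diamondop>\<^bsub>DS\<^esub> sh1 DS (nn (NPhi w))"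
    using assms b dom_nn[of "NPhi w"] cod_nn[of "NPhi w"]
    by (simp add: shs_def D.sh1_vc cb bcyc_def del: nn.simps blks.simps)
  finally show ?thesis unfolding nf_WP_def using assms b bcyc_cyc[OF b]
    by (intro exI[of _ "fletters w"] exI[of _ "[]"])
       (auto simp: cb intro: shifts_id simp del: nn.simps blks.simps)
qed

lemma nf_WW_SSh2:
  assumes "smwf C (SSh2 f)"
  shows "nf_WW (SSh2 f) (n2dom C f) (n2cod C f)"
proof -
  let ?A = "ntgt C (n2dom C f)"
  obtain bss where b: "pok bss ?A" "concat bss = blks (n2dom C f)" "map concat bss = blks (n2cod C f)"
      "nn (n2cod C f) \<bullet> n2ev C D F f = pm bss ?A \<bullet> nn (n2dom C f)"
    using nn_n2[of f] assms by auto
  have c: "bcyc (blks (n2dom C f)) ?A" using assms by simp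
  have "sh1 DS (nn (n2cod C f)) \<diamondop>\<^bsub>DS\<^esub> sh1 DS (n2ev C D F f) = sh1 DS (pm bss ?A) \<diamondop>\<^bsub>DS\<^esub> sh1 DS (nn (n2dom C f))"
    using assms b(1,2) by (simp add: b(4) D.sh1_vc[symmetric])
  then show ?thesis unfolding nf_WW_def using assms b bcyc_cyc_G[OF c]
    by (intro exI[of _ "blks (n2dom C f)"] exI[of _ "[]"] exI[of _ bss]) (auto intro: shifts_id)
qed

lemma nf_WW_SRot:
  assumes "smwf C (SRot U V)"
  shows "nf_WW (SRot U V) (NC U V) (NC V U)"
proof -
  let ?u = "nb (blks U) (ntgt C U)" and ?v = "nb (blks V) (ntgt C V)"
  \<comment> \<open>Singleton groups, since a rotator merges nothing.\<close>
  let ?bss = "map (\<lambda>b. [b]) (blks V @ blks U)"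
  have o: "sowf (SSh (NC U V))" "sowf (SSh (NC V U))" using assms by auto
  have c: "D.cyc (map G (blks U) @ map G (blks V)) (lf0 F (ntgt C V))"
    using bcyc_cyc_G[OF bcyc_blks[OF o(1)]] by simp
  have b: "bok (blks V @ blks U) (ntgt C U)" using assms by simp
  have e: "concat ?bss = blks V @ blks U" "map concat ?bss = blks V @ blks U"
  proof -
    have "map concat (map (\<lambda>b. [b]) bs) = bs" for bs :: "'b list list" by (induction bs) auto
    then show "concat ?bss = blks V @ blks U" "map concat ?bss = blks V @ blks U" by simp_all
  qed
  have p: "pok ?bss (ntgt C U)" using b e(1) by (auto simp: pok_def)
  have i: "pm ?bss (ntgt C U) = bid D (nb (blks V @ blks U) (ntgt C U))"
    by (rule pm_singletons[OF b])
  have "sh1 DS (nn (NC V U)) \<diamondop>\<^bsub>DS\<^esub> srot DS (nev C D F U) (nev C D F V) =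
    sh1 DS (D.lam (map G (blks V)) ?u) \<diamondop>\<^bsub>DS\<^esub> sh1 DS (nn V \<star> nn U) \<diamondop>\<^bsub>DS\<^esub> srot DS (nev C D F U) (nev C D F V)"
    using assms by (simp add: D.sh1_vc)
  also have "\<dots> = (sh1 DS (D.lam (map G (blks V)) ?u) \<diamondop>\<^bsub>DS\<^esub> srot DS ?u ?v) \<diamondop>\<^bsub>DS\<^esub> sh1 DS (nn U \<star> nn V)"
    using assms D.rot_nat[of "nn U" "nn V"] by simp
  also have "\<dots> = (D.rho (map G (blks U)) (map G (blks V)) (lf0 F (ntgt C V)) \<diamondop>\<^bsub>DS\<^esub>
      sh1 DS (D.lam (map G (blks U)) ?v)) \<diamondop>\<^bsub>DS\<^esub> sh1 DS (nn U \<star> nn V)"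
    using D.rho_lam[OF c] assms by simp
  also have "\<dots> = D.rho (map G (blks U)) (map G (blks V)) (lf0 F (ntgt C V)) \<diamondop>\<^bsub>DS\<^esub> sh1 DS (nn (NC U V))"
    using assms c by (simp add: D.sh1_vc)
  finally have *: "sh1 DS (nn (NC V U)) \<diamondop>\<^bsub>DS\<^esub> srot DS (nev C D F U) (nev C D F V) =
    sh1 DS (pm ?bss (ntgt C U)) \<diamondop>\<^bsub>DS\<^esub>
    D.rho (map G (blks U)) (map G (blks V)) (lf0 F (ntgt C V)) \<diamondop>\<^bsub>DS\<^esub> sh1 DS (nn (NC U V))"
    unfolding i using assms c o by simp
  show ?thesis unfolding nf_WW_def using * assms e p
    by (intro exI[of _ "blks U"] exI[of _ "blks V"] exI[of _ ?bss])
       (auto simp: shifts_def simp del: nn.simps)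
qed

lemma nf_exists:
  "smwf C t \<Longrightarrow>
    (\<forall>w w'. smdom C t = SPsi w \<and> smcod C t = SPsi w' \<longrightarrow> nf_PP t w w') \<and>
    (\<forall>W w'. smdom C t = SSh W \<and> smcod C t = SPsi w' \<longrightarrow> nf_WP t W w') \<and>
    (\<forall>W W'. smdom C t = SSh W \<and> smcod C t = SSh W' \<longrightarrow> nf_WW t W W')"
proof (induction t)
  case (SPsi2 a)
  then show ?case using nf_PP_SPsi2 by simp
next
  case (SPsiRot u v)
  then show ?case using nf_PP_SPsiRot by simp
next
  case (SSh2 f)
  then show ?case using nf_WW_SSh2 by simp
next
  case (SRot U V)
  then show ?case using nf_WW_SRot by simp
next
  case (Ss w)
  then show ?case using nf_WP_Ss by simp
next
  case (SV g f)
  then have wf: "smwf C f" "smwf C g" "smcod C f = smdom C g" by auto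
  show ?case
  proof (intro conjI allI impI)
    fix w w'' assume d: "smdom C (SV g f) = SPsi w \<and> smcod C (SV g f) = SPsi w''"
    then obtain w' where "smcod C f = SPsi w'" using smdom_Psi[OF wf(1)] by auto
    then show "nf_PP (SV g f) w w''"
      using SV.IH wf d by (intro nf_PP_PP[of f g w w']) auto
  next
    fix W w'' assume d: "smdom C (SV g f) = SSh W \<and> smcod C (SV g f) = SPsi w''"
    show "nf_WP (SV g f) W w''"
    proof (cases "smcod C f")
      case (SPsi w')
      then show ?thesis using SV.IH wf d by (intro nf_WP_PP[of f g W w']) auto
    next
      case (SSh W')
      then show ?thesis using SV.IH wf d by (intro nf_WW_WP[of f g W W']) auto
    qed
  next
    fix W W'' assume d: "smdom C (SV g f) = SSh W \<and> smcod C (SV g f) = SSh W''"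
    \<comment> \<open>If \<open>f\<close> ended in a \<Psi>-object, so would \<open>g\<close>,
      contrary to the target \<open>SSh W''\<close>.\<close>
    then obtain W' where "smcod C f = SSh W'"
      using smdom_Psi[OF wf(2)] wf(3) by (metis smcod.simps(6) so.distinct(1) so.exhaust)
    then show "nf_WW (SV g f) W W''"
      using SV.IH wf d by (intro nf_WW_WW[of f g W W']) auto
  qed
qed

text \<open>The normal form exhibits the permutation of any formal morphism as one rotation between
  the letter lists of its ends. The aperiodic case needs only this much of it.\<close>

lemma rotation_exists:
  assumes "smwf C t"
  obtains us ws where "soletters (smdom C t) = us @ ws" "soletters (smcod C t) = ws @ us"
    "shifts t (length ws) (length us + length ws)"
proof (cases "smdom C t")
  case (SPsi w)
  then obtain w' where "smcod C t = SPsi w'" using smdom_Psi assms by blast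
  then show thesis using nf_exists[OF assms] SPsi that by (force simp: nf_PP_def)
next
  case (SSh W)
  show thesis
  proof (cases "smcod C t")
    case (SPsi w')
    then show thesis using nf_exists[OF assms] SSh that by (force simp: nf_WP_def)
  next
    case (SSh W')
    with nf_exists[OF assms] \<open>smdom C t = SSh W\<close> have "nf_WW t W W'" by blast
    then obtain xs ys bss where 1: "blks W = xs @ ys" "concat bss = ys @ xs" "map concat bss = blks W'"
      "shifts t (length (concat ys)) (length (concat xs) + length (concat ys))"
      unfolding nf_WW_def by blast
    have "nletters W = concat xs @ concat ys" using arg_cong[OF 1(1), of concat] by simp
    moreover have "nletters W' = concat ys @ concat xs"
      using arg_cong[OF 1(3), of concat] 1(2) by simp
    ultimately show thesis using that[of "concat xs" "concat ys"] 1(4) SSh \<open>smdom C t = SSh W\<close> by simp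
  qed
qed

lemma ev_unique:
  assumes wf: "smwf C t" "smwf C u" and d: "smdom C t = smdom C u" "smcod C t = smcod C u"
    and p: "\<forall>p<length (soletters (smdom C t)). smperm t p = smperm u p"
  shows "ev t = ev u"
proof (cases "smdom C t")
  case (SPsi w)
  then obtain w' where "smcod C t = SPsi w'" using smdom_Psi wf by blast
  then show ?thesis using nf_exists[OF wf(1)] nf_exists[OF wf(2)] SPsi d p wf
    by (intro nf_PP_unique[of t u w w']) auto
next
  case (SSh W)
  note W = SSh
  show ?thesis
  proof (cases "smcod C t")
    case (SPsi w')
    then show ?thesis using nf_exists[OF wf(1)] nf_exists[OF wf(2)] W d p wf
      by (intro nf_WP_unique[of t u W w']) auto
  next
    case (SSh W')
    then show ?thesis using nf_exists[OF wf(1)] nf_exists[OF wf(2)] W d p wf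
      by (intro nf_WW_unique[of t u W W']) auto
  qed
qed

theorem coherence: "formal_coherence C CS D DS F H s"
  unfolding formal_coherence_def
proof (intro conjI allI impI)
  fix t u :: "('a,'b) sm"
  assume "smwf C t \<and> smwf C u \<and> smdom C t = smdom C u \<and> smcod C t = smcod C u \<and>
    (\<forall>p<length (soletters (smdom C t)). smperm t p = smperm u p)"
  then show "ev t = ev u" using ev_unique by blast
next
  fix t u :: "('a,'b) sm"
  assume a: "smwf C t \<and> smwf C u \<and> smdom C t = smdom C u \<and> smcod C t = smcod C u \<and>
    aperiodic (soletters (smdom C t))"
  obtain us ws where 1: "soletters (smdom C t) = us @ ws" "soletters (smcod C t) = ws @ us"
    "shifts t (length ws) (length us + length ws)"
    using rotation_exists a by metis
  obtain us' ws' where 2: "soletters (smdom C u) = us' @ ws'" "soletters (smcod C u) = ws' @ us'"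
    "shifts u (length ws') (length us' + length ws')"
    using rotation_exists a by metis
  have e: "us @ ws = us' @ ws'" "ws @ us = ws' @ us'" using 1 2 a by simp_all
  have l: "length us' + length ws' = length us + length ws"
    using arg_cong[OF e(1), of length] by simp
  \<comment> \<open>Both rotations carry the same source list to the same target list, so
    aperiodicity leaves one possible residue for the shift.\<close>
  have "length ws mod (length us + length ws) = length ws' mod (length us + length ws)"
    using aperiodic_rotation[OF _ e] a 1(1) by simp
  then have "(p + length ws) mod (length us + length ws) = (p + length ws') mod (length us + length ws)" for p
    by (metis mod_add_right_eq)
  then have "\<forall>p<length (soletters (smdom C t)). smperm t p = smperm u p"
    using 1(1,3) 2(3) by (simp add: shifts_def l)
  then show "ev t = ev u" using ev_unique a by blast
qed

end

section \<open>Duality between lax and oplax shadow functors\<close>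

lemma co_simps [simp]:
  "bsrc (co B) = bsrc B" "btgt (co B) = btgt B" "bhc (co B) = bhc B" "bunit (co B) = bunit B"
  "bdom (co B) = bcod B" "bcod (co B) = bdom B" "bvc (co B) g f = bvc B f g" "bid (co B) = bid B"
  "bhm (co B) = bhm B" "bassoc (co B) M N P = inv2 B (bassoc B M N P)"
  "blu (co B) M = inv2 B (blu B M)" "bru (co B) M = inv2 B (bru B M)"
  by (simp_all add: co_def)

lemma co_sh_simps [simp]:
  "sdom (co_sh S) = scod S" "scod (co_sh S) = sdom S" "scomp (co_sh S) g f = scomp S f g"
  "sid (co_sh S) = sid S" "sh0 (co_sh S) = sh0 S" "sh1 (co_sh S) = sh1 S" "srot (co_sh S) M N = srot S N M"
  by (simp_all add: co_sh_def)

lemma is_iso2_co [simp]: "is_iso2 (co B) f = is_iso2 B f"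
  by (auto simp: is_iso2_def)

lemma inv2_co [simp]: "inv2 (co B) f = inv2 B f"
  unfolding inv2_def by (rule arg_cong[of _ _ The]) auto

context bicategory
begin

text \<open>Transposes a commuting square along its two invertible sides. The constraints of the
  dual are inverses, so its naturality axioms arise in this way.\<close>

lemma inv2_square:
  assumes "a \<bullet> f = g \<bullet> b" "is_iso2 B a" "is_iso2 B b" "bcod B f = bdom B a" "bcod B b = bdom B g"
    "bdom B f = bdom B b" "bcod B g = bcod B a"
  shows "f \<bullet> inv2 B b = inv2 B a \<bullet> g"
proof -
  have "a \<bullet> f \<bullet> inv2 B b = g"
    using vc_chain[OF assms(1), of "inv2 B b"] assms(2-) by simp
  then have "inv2 B a \<bullet> a \<bullet> f \<bullet> inv2 B b = inv2 B a \<bullet> g" by (simp only:)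
  then show ?thesis using assms(2-) by simp
qed

lemma bicat_co: "bicat (co B)"
  unfolding bicat_def co_simps is_iso2_co
proof (intro conjI allI impI; (elim conjE)?)
  fix f g h
  assume t: "btgt B (bcod B f) = bsrc B (bcod B g)" "btgt B (bcod B g) = bsrc B (bcod B h)"
  show "((f \<star> g) \<star> h) \<bullet> inv2 B (bassoc B (bdom B f) (bdom B g) (bdom B h)) =
       inv2 B (bassoc B (bcod B f) (bcod B g) (bcod B h)) \<bullet> (f \<star> (g \<star> h))"
    by (rule inv2_square[OF as_nat]) (use t in auto)
next
  fix f
  show "(bid B (bunit B (bsrc B (bcod B f))) \<star> f) \<bullet> inv2 B (blu B (bdom B f)) = inv2 B (blu B (bcod B f)) \<bullet> f"
    unfolding src_cod by (rule inv2_square[OF lu_nat]) auto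
next
  fix f
  show "(f \<star> bid B (bunit B (btgt B (bcod B f)))) \<bullet> inv2 B (bru B (bdom B f)) = inv2 B (bru B (bcod B f)) \<bullet> f"
    unfolding tgt_cod by (rule inv2_square[OF ru_nat]) auto
next
  fix M N P Q
  assume "btgt B M = bsrc B N" "btgt B N = bsrc B P" "btgt B P = bsrc B Q"
  then show "inv2 B (bassoc B (M \<odot> N) P Q) \<bullet> inv2 B (bassoc B M N (P \<odot> Q)) =
    ((inv2 B (bassoc B M N P) \<star> bid B Q) \<bullet> inv2 B (bassoc B M (N \<odot> P) Q)) \<bullet> (bid B M \<star> inv2 B (bassoc B N P Q))"
    using arg_cong[OF pentagon[of M N P Q], of "inv2 B"] by (simp add: inv2_vc inv2_hm)
next
  fix M N
  assume "btgt B M = bsrc B N"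
  then show "inv2 B (bassoc B M (bunit B (btgt B M)) N) \<bullet> (bid B M \<star> inv2 B (blu B N)) =
    inv2 B (bru B M) \<star> bid B N"
    using arg_cong[OF triangle[of M N], of "inv2 B"] by (simp add: inv2_vc inv2_hm)
qed simp_all

end

context shadowed
begin

lemma rot_rot_chain:
  "\<lbrakk>btgt B M = bsrc B N; btgt B N = bsrc B M; scod S k = sh0 S (M \<odot> N)\<rbrakk> \<Longrightarrow>
    srot S N M \<diamondop>\<^bsub>S\<^esub> srot S M N \<diamondop>\<^bsub>S\<^esub> k = k"
  using sc_chain[OF rot_rot, of M N k] by simp

lemma sh1_inv_chain:
  assumes "is_iso2 B f" "bsrc B (bdom B f) = btgt B (bdom B f)"
  shows "scod S k = sh0 S (bdom B f) \<Longrightarrow> sh1 S (inv2 B f) \<diamondop>\<^bsub>S\<^esub> sh1 S f \<diamondop>\<^bsub>S\<^esub> k = k"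
    and "scod S k = sh0 S (bcod B f) \<Longrightarrow> sh1 S f \<diamondop>\<^bsub>S\<^esub> sh1 S (inv2 B f) \<diamondop>\<^bsub>S\<^esub> k = k"
  using sc_chain[OF sh1_inv_left, of f k] sc_chain[OF sh1_inv_right, of f k] assms by simp_all

text \<open>A rotator is inverse to the one with exchanged arguments, so exchanging arguments gives
  rotators for the reversed arrows, and the unit axiom and the hexagon appear in inverted
  form.\<close>

lemma shadow_co: "bicat_with_shadow (co B) (co_sh S)"
  unfolding bicat_with_shadow_def category_part_def co_simps co_sh_simps inv2_co
proof (intro conjI allI impI bicat_co; (elim conjE)?)
  fix f g
  assume "btgt B (bcod B f) = bsrc B (bcod B g)" "btgt B (bcod B g) = bsrc B (bcod B f)"
  then show "sh1 S (f \<star> g) \<diamondop>\<^bsub>S\<^esub> srot S (bdom B g) (bdom B f) =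
      srot S (bcod B g) (bcod B f) \<diamondop>\<^bsub>S\<^esub> sh1 S (g \<star> f)"
    using rot_nat[of g f] by simp
next
  fix X assume X: "bsrc B X = btgt B X"
  let ?I = "bunit B (bsrc B X)"
  show "srot S ?I X \<diamondop>\<^bsub>S\<^esub> sh1 S (inv2 B (blu B X)) = sh1 S (inv2 B (bru B X))"
  proof (rule sh1_iso_cancel_left[of "bru B X"])
    have "sh1 S (bru B X) \<diamondop>\<^bsub>S\<^esub> srot S ?I X \<diamondop>\<^bsub>S\<^esub> sh1 S (inv2 B (blu B X)) =
      sh1 S (blu B X) \<diamondop>\<^bsub>S\<^esub> srot S X ?I \<diamondop>\<^bsub>S\<^esub> srot S ?I X \<diamondop>\<^bsub>S\<^esub> sh1 S (inv2 B (blu B X))"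
      using X by (simp flip: rot_unit)
    then show "sh1 S (bru B X) \<diamondop>\<^bsub>S\<^esub> srot S ?I X \<diamondop>\<^bsub>S\<^esub> sh1 S (inv2 B (blu B X)) =
      sh1 S (bru B X) \<diamondop>\<^bsub>S\<^esub> sh1 S (inv2 B (bru B X))"
      using X by (simp add: rot_rot_chain)
  qed (use X in auto)
next
  fix M N P
  assume t: "btgt B M = bsrc B N" "btgt B N = bsrc B P" "btgt B P = bsrc B M"
  \<comment> \<open>\<open>?L\<close> is a left inverse of \<open>?K\<close>, the left side of the
    hexagon, and \<open>?R\<close> is a right inverse of its right side; hence they agree.\<close>
  let ?L = "srot S P (M \<odot> N) \<diamondop>\<^bsub>S\<^esub> sh1 S (bassoc B P M N) \<diamondop>\<^bsub>S\<^esub> srot S N (P \<odot> M)"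
  let ?K = "srot S (P \<odot> M) N \<diamondop>\<^bsub>S\<^esub> sh1 S (inv2 B (bassoc B P M N)) \<diamondop>\<^bsub>S\<^esub> srot S (M \<odot> N) P"
  let ?R = "sh1 S (inv2 B (bassoc B M N P)) \<diamondop>\<^bsub>S\<^esub> srot S (N \<odot> P) M \<diamondop>\<^bsub>S\<^esub> sh1 S (inv2 B (bassoc B N P M))"
  have LK: "?L \<diamondop>\<^bsub>S\<^esub> ?K = sid S (sh0 S ((M \<odot> N) \<odot> P))"
    using t by (simp add: rot_rot_chain sh1_inv_chain rot_rot)
  have KR: "?K \<diamondop>\<^bsub>S\<^esub> ?R = sid S (sh0 S (N \<odot> P \<odot> M))"
    unfolding hexagon[OF t] using t by (simp add: rot_rot_chain sh1_inv_chain rot_rot)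
  have "?L = ?L \<diamondop>\<^bsub>S\<^esub> ?K \<diamondop>\<^bsub>S\<^esub> ?R" unfolding KR using t by simp
  also have "\<dots> = (?L \<diamondop>\<^bsub>S\<^esub> ?K) \<diamondop>\<^bsub>S\<^esub> ?R" by (rule sc_assoc[symmetric]) (use t in auto)
  also have "\<dots> = ?R" unfolding LK using t by simp
  finally show "(srot S P (M \<odot> N) \<diamondop>\<^bsub>S\<^esub> sh1 S (inv2 B (inv2 B (bassoc B P M N)))) \<diamondop>\<^bsub>S\<^esub> srot S N (P \<odot> M) =
    (sh1 S (inv2 B (bassoc B M N P)) \<diamondop>\<^bsub>S\<^esub> srot S (N \<odot> P) M) \<diamondop>\<^bsub>S\<^esub> sh1 S (inv2 B (bassoc B N P M))"
    using t by simp
qed (simp_all add: rot_rot sh1_vc)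

end

locale oplax_shadow = D: shadowed D DS + C: shadowed C CS
  for D :: "('f,'g,'h) bicat" (structure) and C :: "('a,'b,'c) bicat"
    and DS :: "('i,'j,'g,'h) shadow" and CS :: "('d,'e,'b,'c) shadow" +
  fixes F :: "('a,'b,'c,'f,'g,'h) laxf" and H :: "('d,'e,'i,'j) shfun" and s :: "'b \<Rightarrow> 'j"
  assumes nos: "normal_oplax_shadow_functor C CS D DS F H s"
begin

lemmas oplax = nos[unfolded normal_oplax_shadow_functor_def, THEN conjunct1, unfolded oplax_functor_def]
lemmas loc = oplax[THEN conjunct1, unfolded local_functor_part_def]
lemmas oplaxs = oplax[THEN conjunct2]
lemmas shs = nos[unfolded normal_oplax_shadow_functor_def sh_functor_def, THEN conjunct2]

lemma src_lf [simp]: "bsrc D (lf1 F M) = lf0 F (bsrc C M)"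
  and tgt_lf [simp]: "btgt D (lf1 F M) = lf0 F (btgt C M)"
  and dom_lf [simp]: "bdom D (lf2 F f) = lf1 F (bdom C f)"
  and cod_lf [simp]: "bcod D (lf2 F f) = lf1 F (bcod C f)"
  and lf_id [simp]: "lf2 F (bid C M) = bid D (lf1 F M)"
  and lf_vc: "bcod C f = bdom C g \<Longrightarrow> lf2 F (g \<bullet>\<^bsub>C\<^esub> f) = lf2 F g \<bullet> lf2 F f"
  using loc by meson+

lemma dom_lfm [simp]: "btgt C M = bsrc C N \<Longrightarrow> bdom D (lfm F M N) = lf1 F (M \<odot>\<^bsub>C\<^esub> N)"
  and cod_lfm [simp]: "btgt C M = bsrc C N \<Longrightarrow> bcod D (lfm F M N) = lf1 F M \<odot> lf1 F N"
  and dom_lfi [simp]: "bdom D (lfi F A) = lf1 F (bunit C A)"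
  and cod_lfi [simp]: "bcod D (lfi F A) = bunit D (lf0 F A)"
  and lfm_nat: "btgt C (bdom C f) = bsrc C (bdom C g) \<Longrightarrow>
    (lf2 F f \<star> lf2 F g) \<bullet> lfm F (bdom C f) (bdom C g) =
    lfm F (bcod C f) (bcod C g) \<bullet> lf2 F (f \<star>\<^bsub>C\<^esub> g)"
  and lfm_assoc: "\<lbrakk>btgt C M = bsrc C N; btgt C N = bsrc C P\<rbrakk> \<Longrightarrow>
    bassoc D (lf1 F M) (lf1 F N) (lf1 F P) \<bullet> (lfm F M N \<star> bid D (lf1 F P)) \<bullet> lfm F (M \<odot>\<^bsub>C\<^esub> N) P =
    (bid D (lf1 F M) \<star> lfm F N P) \<bullet> lfm F M (N \<odot>\<^bsub>C\<^esub> P) \<bullet> lf2 F (bassoc C M N P)"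
  and lfm_lu: "blu D (lf1 F M) \<bullet> (lfi F (bsrc C M) \<star> bid D (lf1 F M)) \<bullet> lfm F (bunit C (bsrc C M)) M =
    lf2 F (blu C M)"
  and lfm_ru: "bru D (lf1 F M) \<bullet> (bid D (lf1 F M) \<star> lfi F (btgt C M)) \<bullet> lfm F M (bunit C (btgt C M)) =
    lf2 F (bru C M)"
  using oplaxs by meson+

lemma lf_iso [simp]: "is_iso2 C f \<Longrightarrow> is_iso2 D (lf2 F f)"
  by (rule D.iso2I[of "lf2 F (inv2 C f)"]) (auto simp flip: lf_vc)

lemma lf_inv: "is_iso2 C f \<Longrightarrow> lf2 F (inv2 C f) = inv2 D (lf2 F f)"
  by (rule D.inv2_eq[symmetric]) (auto simp flip: lf_vc)

text \<open>Moving the associator or unitors to the other side of an oplax axiom, as inverses, gives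
  the lax axiom for reversed 2-cells.\<close>

lemma lax_co: "lax_functor (co C) (co D) F"
  unfolding lax_functor_def local_functor_part_def co_simps
proof (intro conjI allI impI; (elim conjE)?)
  fix f g assume "btgt C (bcod C f) = bsrc C (bcod C g)"
  then show "lfm F (bcod C f) (bcod C g) \<bullet> lf2 F (f \<star>\<^bsub>C\<^esub> g) =
    (lf2 F f \<star> lf2 F g) \<bullet> lfm F (bdom C f) (bdom C g)"
    using lfm_nat[of f g] by simp
next
  fix M N P assume t: "btgt C M = bsrc C N" "btgt C N = bsrc C P"
  have "((lfm F M N \<star> bid D (lf1 F P)) \<bullet> lfm F (M \<odot>\<^bsub>C\<^esub> N) P) \<bullet> inv2 D (lf2 F (bassoc C M N P)) =
    inv2 D (bassoc D (lf1 F M) (lf1 F N) (lf1 F P)) \<bullet> (bid D (lf1 F M) \<star> lfm F N P) \<bullet> lfm F M (N \<odot>\<^bsub>C\<^esub> P)"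
    by (rule D.inv2_square) (use t lfm_assoc[of M N P] in auto)
  then show "((lfm F M N \<star> bid D (lf1 F P)) \<bullet> lfm F (M \<odot>\<^bsub>C\<^esub> N) P) \<bullet> lf2 F (inv2 C (bassoc C M N P)) =
    (inv2 D (bassoc D (lf1 F M) (lf1 F N) (lf1 F P)) \<bullet> (bid D (lf1 F M) \<star> lfm F N P)) \<bullet> lfm F M (N \<odot>\<^bsub>C\<^esub> P)"
    using t by (simp add: lf_inv)
next
  fix M
  \<comment> \<open>An identity is appended so that the unit law becomes a square to which
    \<open>inv2_square\<close> applies.\<close>
  have "((lfi F (bsrc C M) \<star> bid D (lf1 F M)) \<bullet> lfm F (bunit C (bsrc C M)) M) \<bullet> inv2 D (lf2 F (blu C M)) =
    inv2 D (blu D (lf1 F M)) \<bullet> bid D (lf1 F M)"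
    by (rule D.inv2_square) (use lfm_lu[of M] in auto)
  then show "((lfi F (bsrc C M) \<star> bid D (lf1 F M)) \<bullet> lfm F (bunit C (bsrc C M)) M) \<bullet> lf2 F (inv2 C (blu C M)) =
    inv2 D (blu D (lf1 F M))"
    by (simp add: lf_inv)
next
  fix M
  have "((bid D (lf1 F M) \<star> lfi F (btgt C M)) \<bullet> lfm F M (bunit C (btgt C M))) \<bullet> inv2 D (lf2 F (bru C M)) =
    inv2 D (bru D (lf1 F M)) \<bullet> bid D (lf1 F M)"
    by (rule D.inv2_square) (use lfm_ru[of M] in auto)
  then show "((bid D (lf1 F M) \<star> lfi F (btgt C M)) \<bullet> lfm F M (bunit C (btgt C M))) \<bullet> lf2 F (inv2 C (bru C M)) =
    inv2 D (bru D (lf1 F M))"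
    by (simp add: lf_inv)
qed (simp_all add: lf_vc)

lemma sdom_H [simp]: "sdom DS (hf1 H x) = hf0 H (sdom CS x)"
  and scod_H [simp]: "scod DS (hf1 H x) = hf0 H (scod CS x)"
  and H_id [simp]: "hf1 H (sid CS a) = sid DS (hf0 H a)"
  and H_sc: "scod CS x = sdom CS y \<Longrightarrow> hf1 H (y \<diamondop>\<^bsub>CS\<^esub> x) = hf1 H y \<diamondop>\<^bsub>DS\<^esub> hf1 H x"
  and sdom_s [simp]: "bsrc C M = btgt C M \<Longrightarrow> sdom DS (s M) = hf0 H (sh0 CS M)"
  and scod_s [simp]: "bsrc C M = btgt C M \<Longrightarrow> scod DS (s M) = sh0 DS (lf1 F M)"
  and s_nat: "bsrc C (bdom C f) = btgt C (bdom C f) \<Longrightarrow>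
    sh1 DS (lf2 F f) \<diamondop>\<^bsub>DS\<^esub> s (bdom C f) = s (bcod C f) \<diamondop>\<^bsub>DS\<^esub> hf1 H (sh1 CS f)"
  and s_rot: "\<lbrakk>btgt C M = bsrc C N; btgt C N = bsrc C M\<rbrakk> \<Longrightarrow>
    sh1 DS (lfm F N M) \<diamondop>\<^bsub>DS\<^esub> s (N \<odot>\<^bsub>C\<^esub> M) \<diamondop>\<^bsub>DS\<^esub> hf1 H (srot CS M N) =
    srot DS (lf1 F M) (lf1 F N) \<diamondop>\<^bsub>DS\<^esub> sh1 DS (lfm F M N) \<diamondop>\<^bsub>DS\<^esub> s (M \<odot>\<^bsub>C\<^esub> N)"
  and iso_lfi: "is_iso2 D (lfi F A)"
  using shs by meson+

lemma normal_lax_co: "normal_lax_shadow_functor (co C) (co_sh CS) (co D) (co_sh DS) F H s"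
  unfolding normal_lax_shadow_functor_def sh_functor_def co_simps co_sh_simps is_iso2_co
proof (intro conjI allI impI lax_co; (elim conjE)?)
  fix M N assume "btgt C M = bsrc C N" "btgt C N = bsrc C M"
  then show "(sh1 DS (lfm F M N) \<diamondop>\<^bsub>DS\<^esub> s (M \<odot>\<^bsub>C\<^esub> N)) \<diamondop>\<^bsub>DS\<^esub> hf1 H (srot CS N M) =
    (srot DS (lf1 F N) (lf1 F M) \<diamondop>\<^bsub>DS\<^esub> sh1 DS (lfm F N M)) \<diamondop>\<^bsub>DS\<^esub> s (N \<odot>\<^bsub>C\<^esub> M)"
    using s_rot[of N M] by simp
qed (simp_all add: s_nat iso_lfi H_sc)

end

lemma bicat_with_shadow_imp_bicat: "bicat_with_shadow B S \<Longrightarrow> bicat B"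
  by (simp add: bicat_with_shadow_def)

lemma normal_lax_imp_lax: "normal_lax_shadow_functor C CS D DS F H s \<Longrightarrow> lax_functor C D F"
  by (simp add: normal_lax_shadow_functor_def)

lemma normal_lax_imp_iso: "normal_lax_shadow_functor C CS D DS F H s \<Longrightarrow> is_iso2 D (lfi F A)"
  by (simp add: normal_lax_shadow_functor_def)

theorem mainTheorem16:
  fixes C :: "('a,'b,'c) bicat" and CS :: "('d,'e,'b,'c) shadow"
    and D :: "('f,'g,'h) bicat" and DS :: "('i,'j,'g,'h) shadow"
    and F :: "('a,'b,'c,'f,'g,'h) laxf" and H :: "('d,'e,'i,'j) shfun" and s :: "'b \<Rightarrow> 'j"
  assumes "bicat_with_shadow C CS" and "bicat_with_shadow D DS"
  shows "(normal_lax_shadow_functor C CS D DS F H s \<longrightarrow> formal_coherence C CS D DS F H s) \<and>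
         (normal_oplax_shadow_functor C CS D DS F H s \<longrightarrow>
            formal_coherence (co C) (co_sh CS) (co D) (co_sh DS) F H s)"
proof -
  \<comment> \<open>Stated for fresh bicategories and shadows, because the oplax case applies it to
    the duals.\<close>
  have lax: "formal_coherence C CS D DS F H s"
    if "bicat_with_shadow C CS" "bicat_with_shadow D DS" "normal_lax_shadow_functor C CS D DS F H s"
    for C :: "('a,'b,'c) bicat" and CS :: "('d,'e,'b,'c) shadow"
      and D :: "('f,'g,'h) bicat" and DS :: "('i,'j,'g,'h) shadow"
  proof -
    interpret normal_lax_shadow D C F DS CS H s
      using that
      by unfold_locales (simp_all add: bicat_with_shadow_imp_bicat normal_lax_imp_lax normal_lax_imp_iso)
    show ?thesis by (rule coherence)
  qed
  have "formal_coherence (co C) (co_sh CS) (co D) (co_sh DS) F H s"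
    if "normal_oplax_shadow_functor C CS D DS F H s"
  proof -
    interpret oplax_shadow D C DS CS F H s
      using assms that by unfold_locales (simp_all add: bicat_with_shadow_imp_bicat)
    show ?thesis by (rule lax[OF C.shadow_co D.shadow_co normal_lax_co])
  qed
  then show ?thesis using lax assms by blast
qed

end
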